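(* Let $G$ be a profinite group acting continuously and residually freely on a connected profinite graph $\Gamma$, without edge inversions. Then $\Gamma/G$ is a profinite graph and the orbit mapping $f\colon\Gamma\to\Gamma/G$ is a regular covering of profinite graphs. Moreover, $G=\operatorname{Aut}(\Gamma,f)$ and they are isomorphic as profinite groups.
   Context: A graph $\Gamma$ is a set that is the disjoint union of a set $V(\Gamma)$ of vertices and a set $E(\Gamma)$ of edges, with maps $s,t\colon E(\Gamma)\to V(\Gamma)$ and an involution $e\mapsto\overline e$ of $E(\Gamma)$ such that $\overline e\ne e$, $s(\overline e)=t(e)$, $t(\overline e)=s(e)$. A map of graphs sends vertices to vertices and edges to edges and commutes with $s$, $t$ and $e\mapsto\overline e$. A map of graphs $f$ is locally bijective if for every vertex $v$ it restricts to a bijection from $\{e\mid s(e)=v\}$ onto $\{e'\mid s(e')=f(v)\}$. A graph is path connected if it is nonempty and any two vertices are joined by a finite edge path. A regular covering of finite path connected graphs is a locally bijective map $q\colon X\to Y$ of such graphs with $q_*\pi_1(X,x)$ normal in $\pi_1(Y,q(x))$ for a vertex $x$ (equivalently, the group of automorphisms of $X$ over $Y$ is transitive on each vertex fiber). An equivalence relation $R$ on a graph $\Gamma$ is compatible if no vertex is equivalent to an edge, if $(e_1,e_2)\in R$ for edges implies $(s(e_1),s(e_2)),(t(e_1),t(e_2)),(\overline{e_1},\overline{e_2})\in R$, and $(e,\overline e)\notin R$ for all edges $e$; thus the set $\Gamma/R$ of classes $R[x]$ is a graph. A cofinite graph is a graph with a Hausdorff uniformity in which every entourage contains a compatible cofinite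 entourage, i.e. an entourage that is a compatible equivalence relation with finitely many classes. A profinite graph is a compact cofinite graph (equivalently, an inverse limit of finite discrete graphs). It is connected if $\Gamma/R$ is path connected for every compatible cofinite entourage $R$. A fundamental system of entourages is a set of entourages such that every entourage contains one of them. An inverse system of maps $(f_i\colon\Gamma_i\to\Delta_i,\phi_{ij},\psi_{ij})$ over a directed set $I$ consists of continuous maps of graphs $f_i$, and, for $j\ge i$, continuous maps of graphs $\phi_{ij}\colon\Gamma_j\to\Gamma_i$, $\psi_{ij}\colon\Delta_j\to\Delta_i$ forming inverse systems, with $f_i\phi_{ij}=\psi_{ij}f_j$. Its inverse limit is the induced continuous map $f\colon\varprojlim\Gamma_i\to\varprojlim\Delta_i$. A map of profinite graphs is a regular covering if it is the inverse limit of an inverse system in which each $f_i$ is a regular covering of path connected finite discrete graphs. Groups act on graphs by automorphisms of graphs. The action is continuous if $G\times\Gamma\to\Gamma$ is continuous, and without edge inversions if $ge\neq\overline e$ for all $g\in G$ and edges $e$; the orbit set $\Gamma/G$ is then a graph and is given the quotient topology. The action is residually free if there is a fundamental system of entourages of $\Gamma$ consisting of $G$-invariant compatible cofinite entourages $R$ (i.e. $(g\times g)[R]=R$ for all $g$) such that the induced faithful action of $G/N_R$ on $\Gamma/R$ is free, where $N_R$ is the kernel of the action $g\cdot R[x]=R[gx]$ of $G$ on $\Gamma/R$. $\operatorname{Aut}(\Gamma,f)$ is the group $A$ of continuous maps of graphs $h\colon\Gamma\to\Gamma$ with continuous inverse and $fh=f$ (the covering transformations). It carries the group topology induced by its action: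 a base of neighbourhoods of $1$ is given by the finite-index normal subgroups $\{\alpha\in A\mid (\alpha x,x)\in R\ \forall x\in\Gamma\}$, where $R$ runs over the $A$-invariant compatible cofinite entourages of $\Gamma$.
   Formalization: The isomorphism of G with Aut(Γ,f) as profinite groups is asserted only when G acts faithfully (it fails for Z/2 acting trivially on a single vertex); in general the transformations given by G are shown to be exactly the elements of Aut(Γ,f). *)

theory Defs
  imports "HOL-Analysis.Analysis" "HOL-Algebra.Group_Action"
begin

section \<open>Graphs\<close>

text \<open>Vertices and edges live in one carrier type, so that a graph is literally the disjoint
  union of its vertex set and its edge set.\<close>

record 'a graph =
  verts :: "'a set"
  edges :: "'a set"
  src :: "'a \<Rightarrow> 'a"
  tgt :: "'a \<Rightarrow> 'a"
  bar :: "'a \<Rightarrow> 'a"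

definition elems :: "'a graph \<Rightarrow> 'a set" where
  "elems \<Gamma> = verts \<Gamma> \<union> edges \<Gamma>"

definition wf_graph :: "'a graph \<Rightarrow> bool" where
  "wf_graph \<Gamma> \<longleftrightarrow> verts \<Gamma> \<inter> edges \<Gamma> = {} \<and>
    (\<forall>e\<in>edges \<Gamma>. src \<Gamma> e \<in> verts \<Gamma> \<and> tgt \<Gamma> e \<in> verts \<Gamma> \<and> bar \<Gamma> e \<in> edges \<Gamma> \<and>
       bar \<Gamma> (bar \<Gamma> e) = e \<and> bar \<Gamma> e \<noteq> e \<and>
       src \<Gamma> (bar \<Gamma> e) = tgt \<Gamma> e \<and> tgt \<Gamma> (bar \<Gamma> e) = src \<Gamma> e)"

definition graph_map :: "'a graph \<Rightarrow> 'b graph \<Rightarrow> ('a \<Rightarrow> 'b) \<Rightarrow> bool" where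
  "graph_map \<Gamma> \<Delta> f \<longleftrightarrow> f \<in> verts \<Gamma> \<rightarrow> verts \<Delta> \<and> f \<in> edges \<Gamma> \<rightarrow> edges \<Delta> \<and>
    (\<forall>e\<in>edges \<Gamma>. f (src \<Gamma> e) = src \<Delta> (f e) \<and> f (tgt \<Gamma> e) = tgt \<Delta> (f e) \<and>
       f (bar \<Gamma> e) = bar \<Delta> (f e))"

definition locally_bijective :: "'a graph \<Rightarrow> 'b graph \<Rightarrow> ('a \<Rightarrow> 'b) \<Rightarrow> bool" where
  "locally_bijective \<Gamma> \<Delta> f \<longleftrightarrow> (\<forall>v\<in>verts \<Gamma>.
     bij_betw f {e\<in>edges \<Gamma>. src \<Gamma> e = v} {e\<in>edges \<Delta>. src \<Delta> e = f v})"

fun edge_path :: "'a graph \<Rightarrow> 'a \<Rightarrow> 'a list \<Rightarrow> 'a \<Rightarrow> bool" where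
  "edge_path \<Gamma> u [] v \<longleftrightarrow> u \<in> verts \<Gamma> \<and> u = v"
| "edge_path \<Gamma> u (e # p) v \<longleftrightarrow> e \<in> edges \<Gamma> \<and> src \<Gamma> e = u \<and> edge_path \<Gamma> (tgt \<Gamma> e) p v"

definition path_connected_graph :: "'a graph \<Rightarrow> bool" where
  "path_connected_graph \<Gamma> \<longleftrightarrow> elems \<Gamma> \<noteq> {} \<and>
    (\<forall>u\<in>verts \<Gamma>. \<forall>v\<in>verts \<Gamma>. \<exists>p. edge_path \<Gamma> u p v)"


section \<open>Fundamental group and regular coverings of finite graphs\<close>

definition loops :: "'a graph \<Rightarrow> 'a \<Rightarrow> 'a list set" where
  "loops \<Gamma> v = {p. edge_path \<Gamma> v p v}"

text \<open>Elementary homotopies insert or delete a backtracking \<open>e, bar e\<close>.\<close>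

definition backtrack_insertion :: "'a graph \<Rightarrow> 'a \<Rightarrow> ('a list \<times> 'a list) set" where
  "backtrack_insertion \<Gamma> v = {(p @ q, p @ [e, bar \<Gamma> e] @ q) | p e q.
     e \<in> edges \<Gamma> \<and> p @ q \<in> loops \<Gamma> v \<and> p @ [e, bar \<Gamma> e] @ q \<in> loops \<Gamma> v}"

definition loop_homotopy :: "'a graph \<Rightarrow> 'a \<Rightarrow> ('a list \<times> 'a list) set" where
  "loop_homotopy \<Gamma> v =
     (backtrack_insertion \<Gamma> v \<union> (backtrack_insertion \<Gamma> v)\<inverse>)\<^sup>* \<inter> (loops \<Gamma> v \<times> loops \<Gamma> v)"

definition fundamental_group :: "'a graph \<Rightarrow> 'a \<Rightarrow> 'a list set monoid" where
  "fundamental_group \<Gamma> v =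
    \<lparr>carrier = loops \<Gamma> v // loop_homotopy \<Gamma> v,
     mult = (\<lambda>P Q. loop_homotopy \<Gamma> v `` {p @ q | p q. p \<in> P \<and> q \<in> Q}),
     one = loop_homotopy \<Gamma> v `` {[]}\<rparr>"

definition fundamental_group_map ::
    "'b graph \<Rightarrow> ('a \<Rightarrow> 'b) \<Rightarrow> 'a \<Rightarrow> 'a list set \<Rightarrow> 'b list set" where
  "fundamental_group_map \<Delta> f v P = loop_homotopy \<Delta> (f v) `` (map f ` P)"

definition finite_regular_covering :: "'a graph \<Rightarrow> 'b graph \<Rightarrow> ('a \<Rightarrow> 'b) \<Rightarrow> bool" where
  "finite_regular_covering X Y q \<longleftrightarrow>
     wf_graph X \<and> wf_graph Y \<and> finite (elems X) \<and> finite (elems Y) \<and>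
     path_connected_graph X \<and> path_connected_graph Y \<and>
     graph_map X Y q \<and> locally_bijective X Y q \<and>
     (\<exists>x\<in>verts X. normal (fundamental_group_map Y q x ` carrier (fundamental_group X x))
                        (fundamental_group Y (q x)))"


section \<open>Uniformities, cofinite graphs and profinite graphs\<close>

text \<open>The uniform structures of the library are carried by a type class and hence by whole types;
  here a uniformity is given by its set \<open>U\<close> of entourages on a carrier set \<open>X\<close>.\<close>

definition uniform_structure :: "'a set \<Rightarrow> ('a \<times> 'a) set set \<Rightarrow> bool" where
  "uniform_structure X U \<longleftrightarrow> U \<noteq> {} \<and>
    (\<forall>W\<in>U. Id_on X \<subseteq> W \<and> W \<subseteq> X \<times> X) \<and>
    (\<forall>W\<in>U. \<forall>W'. W \<subseteq> W' \<and> W' \<subseteq> X \<times> X \<longrightarrow> W' \<in> U) \<and>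
    (\<forall>W\<in>U. \<forall>W'\<in>U. W \<inter> W' \<in> U) \<and>
    (\<forall>W\<in>U. W\<inverse> \<in> U) \<and>
    (\<forall>W\<in>U. \<exists>D\<in>U. D O D \<subseteq> W)"

definition uniform_topology :: "'a set \<Rightarrow> ('a \<times> 'a) set set \<Rightarrow> 'a topology" where
  "uniform_topology X U = topology (\<lambda>S. S \<subseteq> X \<and> (\<forall>x\<in>S. \<exists>W\<in>U. W `` {x} \<subseteq> S))"

lemma uniform_structure_Int:
  assumes "uniform_structure X U" "W \<in> U" "W' \<in> U"
  shows "W \<inter> W' \<in> U"
proof -
  have "\<forall>W\<in>U. \<forall>W'\<in>U. W \<inter> W' \<in> U"
    using assms(1) unfolding uniform_structure_def by (elim conjE)
  then show ?thesis using assms(2,3) by (elim ballE) auto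
qed

lemma openin_uniform_topology:
  assumes "uniform_structure X U"
  shows "openin (uniform_topology X U) S \<longleftrightarrow> S \<subseteq> X \<and> (\<forall>x\<in>S. \<exists>W\<in>U. W `` {x} \<subseteq> S)"
proof -
  have "istopology (\<lambda>S. S \<subseteq> X \<and> (\<forall>x\<in>S. \<exists>W\<in>U. W `` {x} \<subseteq> S))"
    unfolding istopology_def
  proof (intro conjI allI impI)
    fix S S' assume S: "S \<subseteq> X \<and> (\<forall>x\<in>S. \<exists>W\<in>U. W `` {x} \<subseteq> S)"
      and S': "S' \<subseteq> X \<and> (\<forall>x\<in>S'. \<exists>W\<in>U. W `` {x} \<subseteq> S')"
    show "S \<inter> S' \<subseteq> X" using S by blast
    show "\<forall>x\<in>S \<inter> S'. \<exists>W\<in>U. W `` {x} \<subseteq> S \<inter> S'"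
    proof
      fix x assume "x \<in> S \<inter> S'"
      then obtain W W' where "W \<in> U" "W' \<in> U" "W `` {x} \<subseteq> S" "W' `` {x} \<subseteq> S'"
        using S S' by (meson IntD1 IntD2)
      moreover have "W \<inter> W' \<in> U"
        using uniform_structure_Int[OF assms \<open>W \<in> U\<close> \<open>W' \<in> U\<close>] .
      ultimately show "\<exists>W\<in>U. W `` {x} \<subseteq> S \<inter> S'" by blast
    qed
  next
    fix \<K> assume K: "\<forall>K\<in>\<K>. K \<subseteq> X \<and> (\<forall>x\<in>K. \<exists>W\<in>U. W `` {x} \<subseteq> K)"
    show "\<Union> \<K> \<subseteq> X" using K by blast
    show "\<forall>x\<in>\<Union> \<K>. \<exists>W\<in>U. W `` {x} \<subseteq> \<Union> \<K>"
    proof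
      fix x assume "x \<in> \<Union> \<K>"
      then obtain C where C: "C \<in> \<K>" "x \<in> C" by (rule UnionE)
      with K obtain W where "W \<in> U" "W `` {x} \<subseteq> C" by meson
      then show "\<exists>W\<in>U. W `` {x} \<subseteq> \<Union> \<K>"
        using Union_upper[OF C(1)] by (meson subset_trans)
    qed
  qed
  then show ?thesis by (simp add: uniform_topology_def)
qed

definition compatible :: "'a graph \<Rightarrow> ('a \<times> 'a) set \<Rightarrow> bool" where
  "compatible \<Gamma> R \<longleftrightarrow> equiv (elems \<Gamma>) R \<and>
    (\<forall>v\<in>verts \<Gamma>. \<forall>e\<in>edges \<Gamma>. (v, e) \<notin> R) \<and>
    (\<forall>e1\<in>edges \<Gamma>. \<forall>e2\<in>edges \<Gamma>. (e1, e2) \<in> R \<longrightarrow>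
       (src \<Gamma> e1, src \<Gamma> e2) \<in> R \<and> (tgt \<Gamma> e1, tgt \<Gamma> e2) \<in> R \<and> (bar \<Gamma> e1, bar \<Gamma> e2) \<in> R) \<and>
    (\<forall>e\<in>edges \<Gamma>. (e, bar \<Gamma> e) \<notin> R)"

text \<open>Structure maps on classes: the class of \<open>src e\<close> for any representative \<open>e\<close>.\<close>

definition quotient_graph :: "'a graph \<Rightarrow> ('a \<times> 'a) set \<Rightarrow> 'a set graph" where
  "quotient_graph \<Gamma> R =
    \<lparr>verts = verts \<Gamma> // R, edges = edges \<Gamma> // R,
     src = (\<lambda>C. R `` (src \<Gamma> ` C)), tgt = (\<lambda>C. R `` (tgt \<Gamma> ` C)), bar = (\<lambda>C. R `` (bar \<Gamma> ` C))\<rparr>"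

definition compatible_cofinite_entourage ::
    "'a graph \<Rightarrow> ('a \<times> 'a) set set \<Rightarrow> ('a \<times> 'a) set \<Rightarrow> bool" where
  "compatible_cofinite_entourage \<Gamma> U R \<longleftrightarrow> R \<in> U \<and> compatible \<Gamma> R \<and> finite (elems \<Gamma> // R)"

definition cofinite_graph :: "'a graph \<Rightarrow> ('a \<times> 'a) set set \<Rightarrow> bool" where
  "cofinite_graph \<Gamma> U \<longleftrightarrow> wf_graph \<Gamma> \<and> uniform_structure (elems \<Gamma>) U \<and>
    Hausdorff_space (uniform_topology (elems \<Gamma>) U) \<and>
    (\<forall>W\<in>U. \<exists>R. compatible_cofinite_entourage \<Gamma> U R \<and> R \<subseteq> W)"

definition profinite_graph :: "'a graph \<Rightarrow> ('a \<times> 'a) set set \<Rightarrow> bool" where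
  "profinite_graph \<Gamma> U \<longleftrightarrow>
     cofinite_graph \<Gamma> U \<and> compact_space (uniform_topology (elems \<Gamma>) U)"

definition connected_cofinite_graph :: "'a graph \<Rightarrow> ('a \<times> 'a) set set \<Rightarrow> bool" where
  "connected_cofinite_graph \<Gamma> U \<longleftrightarrow>
     (\<forall>R. compatible_cofinite_entourage \<Gamma> U R \<longrightarrow> path_connected_graph (quotient_graph \<Gamma> R))"

text \<open>A graph given with a topology only is profinite if some uniformity inducing that topology
  makes it so (such a uniformity is unique, the space being compact Hausdorff).\<close>

definition profinite_graph_space :: "'a graph \<Rightarrow> 'a topology \<Rightarrow> bool" where
  "profinite_graph_space \<Gamma> T \<longleftrightarrow>
     (\<exists>U. profinite_graph \<Gamma> U \<and> uniform_topology (elems \<Gamma>) U = T)"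

definition fundamental_system ::
    "('a \<times> 'a) set set \<Rightarrow> ('a \<times> 'a) set set \<Rightarrow> bool" where
  "fundamental_system U F \<longleftrightarrow> F \<subseteq> U \<and> (\<forall>W\<in>U. \<exists>R\<in>F. R \<subseteq> W)"


section \<open>Inverse limits and regular coverings of profinite graphs\<close>

definition directed_set :: "'i set \<Rightarrow> ('i \<Rightarrow> 'i \<Rightarrow> bool) \<Rightarrow> bool" where
  "directed_set I leq \<longleftrightarrow> I \<noteq> {} \<and> (\<forall>i\<in>I. leq i i) \<and>
     (\<forall>i\<in>I. \<forall>j\<in>I. \<forall>k\<in>I. leq i j \<and> leq j k \<longrightarrow> leq i k) \<and>
     (\<forall>i\<in>I. \<forall>j\<in>I. \<exists>k\<in>I. leq i k \<and> leq j k)"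

definition inverse_system ::
    "'i set \<Rightarrow> ('i \<Rightarrow> 'i \<Rightarrow> bool) \<Rightarrow> ('i \<Rightarrow> 'a graph) \<Rightarrow> ('i \<Rightarrow> 'a topology) \<Rightarrow>
     ('i \<Rightarrow> 'i \<Rightarrow> 'a \<Rightarrow> 'a) \<Rightarrow> bool" where
  "inverse_system I leq X T \<phi> \<longleftrightarrow> directed_set I leq \<and>
     (\<forall>i\<in>I. wf_graph (X i) \<and> topspace (T i) = elems (X i)) \<and>
     (\<forall>i\<in>I. \<forall>j\<in>I. leq i j \<longrightarrow>
        graph_map (X j) (X i) (\<phi> i j) \<and> continuous_map (T j) (T i) (\<phi> i j)) \<and>
     (\<forall>i\<in>I. \<forall>x\<in>elems (X i). \<phi> i i x = x) \<and>
     (\<forall>i\<in>I. \<forall>j\<in>I. \<forall>k\<in>I. leq i j \<and> leq j k \<longrightarrow>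
        (\<forall>x\<in>elems (X k). \<phi> i j (\<phi> j k x) = \<phi> i k x))"

definition inverse_limit_graph ::
    "'i set \<Rightarrow> ('i \<Rightarrow> 'i \<Rightarrow> bool) \<Rightarrow> ('i \<Rightarrow> 'a graph) \<Rightarrow> ('i \<Rightarrow> 'i \<Rightarrow> 'a \<Rightarrow> 'a) \<Rightarrow> ('i \<Rightarrow> 'a) graph" where
  "inverse_limit_graph I leq X \<phi> =
    \<lparr>verts = {x \<in> (\<Pi>\<^sub>E i\<in>I. verts (X i)). \<forall>i\<in>I. \<forall>j\<in>I. leq i j \<longrightarrow> \<phi> i j (x j) = x i},
     edges = {x \<in> (\<Pi>\<^sub>E i\<in>I. edges (X i)). \<forall>i\<in>I. \<forall>j\<in>I. leq i j \<longrightarrow> \<phi> i j (x j) = x i},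
     src = (\<lambda>x. \<lambda>i\<in>I. src (X i) (x i)),
     tgt = (\<lambda>x. \<lambda>i\<in>I. tgt (X i) (x i)),
     bar = (\<lambda>x. \<lambda>i\<in>I. bar (X i) (x i))\<rparr>"

definition inverse_limit_topology ::
    "'i set \<Rightarrow> ('i \<Rightarrow> 'i \<Rightarrow> bool) \<Rightarrow> ('i \<Rightarrow> 'a graph) \<Rightarrow> ('i \<Rightarrow> 'a topology) \<Rightarrow>
     ('i \<Rightarrow> 'i \<Rightarrow> 'a \<Rightarrow> 'a) \<Rightarrow> ('i \<Rightarrow> 'a) topology" where
  "inverse_limit_topology I leq X T \<phi> =
     subtopology (product_topology T I) (elems (inverse_limit_graph I leq X \<phi>))"

definition inverse_system_of_maps ::
    "'i set \<Rightarrow> ('i \<Rightarrow> 'i \<Rightarrow> bool) \<Rightarrow>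
     ('i \<Rightarrow> 'a graph) \<Rightarrow> ('i \<Rightarrow> 'a topology) \<Rightarrow> ('i \<Rightarrow> 'i \<Rightarrow> 'a \<Rightarrow> 'a) \<Rightarrow>
     ('i \<Rightarrow> 'b graph) \<Rightarrow> ('i \<Rightarrow> 'b topology) \<Rightarrow> ('i \<Rightarrow> 'i \<Rightarrow> 'b \<Rightarrow> 'b) \<Rightarrow>
     ('i \<Rightarrow> 'a \<Rightarrow> 'b) \<Rightarrow> bool" where
  "inverse_system_of_maps I leq X T \<phi> Y S \<psi> f \<longleftrightarrow>
     inverse_system I leq X T \<phi> \<and> inverse_system I leq Y S \<psi> \<and>
     (\<forall>i\<in>I. graph_map (X i) (Y i) (f i) \<and> continuous_map (T i) (S i) (f i)) \<and>
     (\<forall>i\<in>I. \<forall>j\<in>I. leq i j \<longrightarrow> (\<forall>x\<in>elems (X j). f i (\<phi> i j x) = \<psi> i j (f j x)))"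

definition inverse_limit_map :: "'i set \<Rightarrow> ('i \<Rightarrow> 'a \<Rightarrow> 'b) \<Rightarrow> ('i \<Rightarrow> 'a) \<Rightarrow> ('i \<Rightarrow> 'b)" where
  "inverse_limit_map I f x = (\<lambda>i\<in>I. f i (x i))"

definition graph_homeomorphism ::
    "'a graph \<Rightarrow> 'a topology \<Rightarrow> 'b graph \<Rightarrow> 'b topology \<Rightarrow> ('a \<Rightarrow> 'b) \<Rightarrow> bool" where
  "graph_homeomorphism \<Gamma> T \<Delta> S h \<longleftrightarrow> graph_map \<Gamma> \<Delta> h \<and> homeomorphic_map T S h"

text \<open>Being an inverse limit is meant up to isomorphism of the source and of the target.\<close>

definition is_inverse_limit_of_maps where
  "is_inverse_limit_of_maps \<Gamma> T\<^sub>\<Gamma> \<Delta> T\<^sub>\<Delta> h I leq X T \<phi> Y S \<psi> f \<longleftrightarrow>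
     (\<exists>a b. graph_homeomorphism \<Gamma> T\<^sub>\<Gamma>
              (inverse_limit_graph I leq X \<phi>) (inverse_limit_topology I leq X T \<phi>) a \<and>
            graph_homeomorphism \<Delta> T\<^sub>\<Delta>
              (inverse_limit_graph I leq Y \<psi>) (inverse_limit_topology I leq Y S \<psi>) b \<and>
            (\<forall>x\<in>elems \<Gamma>. b (h x) = inverse_limit_map I f (a x)))"

text \<open>The existential quantifiers need fixed types.  Every finite graph has a copy on \<open>nat\<close>, and
  it is enough to index the system by relations on the source, for instance by the kernels of
  the projections to the finite graphs.\<close>

definition regular_covering ::
    "'a graph \<Rightarrow> 'a topology \<Rightarrow> 'b graph \<Rightarrow> 'b topology \<Rightarrow> ('a \<Rightarrow> 'b) \<Rightarrow> bool" where
  "regular_covering \<Gamma> T \<Delta> S h \<longleftrightarrow>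
     profinite_graph_space \<Gamma> T \<and> profinite_graph_space \<Delta> S \<and>
     graph_map \<Gamma> \<Delta> h \<and> continuous_map T S h \<and>
     (\<exists>(I :: ('a \<times> 'a) set set) leq (X :: ('a \<times> 'a) set \<Rightarrow> nat graph) \<phi>
        (Y :: ('a \<times> 'a) set \<Rightarrow> nat graph) \<psi> f.
        inverse_system_of_maps I leq
          X (\<lambda>i. discrete_topology (elems (X i))) \<phi>
          Y (\<lambda>i. discrete_topology (elems (Y i))) \<psi> f \<and>
        (\<forall>i\<in>I. finite_regular_covering (X i) (Y i) (f i)) \<and>
        is_inverse_limit_of_maps \<Gamma> T \<Delta> S h I leq
          X (\<lambda>i. discrete_topology (elems (X i))) \<phi>
          Y (\<lambda>i. discrete_topology (elems (Y i))) \<psi> f)"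


section \<open>Profinite groups and their actions on graphs\<close>

definition topological_group :: "('g, 'm) monoid_scheme \<Rightarrow> 'g topology \<Rightarrow> bool" where
  "topological_group G T \<longleftrightarrow> group G \<and> topspace T = carrier G \<and>
     continuous_map (prod_topology T T) T (\<lambda>(x, y). x \<otimes>\<^bsub>G\<^esub> y) \<and>
     continuous_map T T (\<lambda>x. inv\<^bsub>G\<^esub> x)"

definition profinite_group :: "('g, 'm) monoid_scheme \<Rightarrow> 'g topology \<Rightarrow> bool" where
  "profinite_group G T \<longleftrightarrow> topological_group G T \<and> compact_space T \<and> Hausdorff_space T \<and>
     (\<forall>C. connectedin T C \<longrightarrow> (\<exists>x. C \<subseteq> {x}))"

definition profinite_group_iso where
  "profinite_group_iso G T H S \<phi> \<longleftrightarrow>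
     profinite_group G T \<and> profinite_group H S \<and> \<phi> \<in> iso G H \<and> homeomorphic_map T S \<phi>"

definition graph_action ::
    "('g, 'm) monoid_scheme \<Rightarrow> 'a graph \<Rightarrow> ('g \<Rightarrow> 'a \<Rightarrow> 'a) \<Rightarrow> bool" where
  "graph_action G \<Gamma> \<phi> \<longleftrightarrow>
     group_action G (elems \<Gamma>) \<phi> \<and> (\<forall>g\<in>carrier G. graph_map \<Gamma> \<Gamma> (\<phi> g))"

definition continuous_action ::
    "'g topology \<Rightarrow> 'a topology \<Rightarrow> ('g \<Rightarrow> 'a \<Rightarrow> 'a) \<Rightarrow> bool" where
  "continuous_action TG T \<phi> \<longleftrightarrow> continuous_map (prod_topology TG T) T (\<lambda>(g, x). \<phi> g x)"

definition without_edge_inversions ::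
    "('g, 'm) monoid_scheme \<Rightarrow> 'a graph \<Rightarrow> ('g \<Rightarrow> 'a \<Rightarrow> 'a) \<Rightarrow> bool" where
  "without_edge_inversions G \<Gamma> \<phi> \<longleftrightarrow> (\<forall>g\<in>carrier G. \<forall>e\<in>edges \<Gamma>. \<phi> g e \<noteq> bar \<Gamma> e)"

definition invariant_relation ::
    "('g, 'm) monoid_scheme \<Rightarrow> ('g \<Rightarrow> 'a \<Rightarrow> 'a) \<Rightarrow> ('a \<times> 'a) set \<Rightarrow> bool" where
  "invariant_relation G \<phi> R \<longleftrightarrow> (\<forall>g\<in>carrier G. map_prod (\<phi> g) (\<phi> g) ` R = R)"

text \<open>\<open>g \<cdot> R[x] = R[g x]\<close> for an invariant equivalence relation \<open>R\<close>.\<close>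

definition class_action ::
    "('g \<Rightarrow> 'a \<Rightarrow> 'a) \<Rightarrow> ('a \<times> 'a) set \<Rightarrow> 'g \<Rightarrow> 'a set \<Rightarrow> 'a set" where
  "class_action \<phi> R g C = R `` (\<phi> g ` C)"

definition class_kernel ::
    "('g, 'm) monoid_scheme \<Rightarrow> 'a graph \<Rightarrow> ('g \<Rightarrow> 'a \<Rightarrow> 'a) \<Rightarrow> ('a \<times> 'a) set \<Rightarrow> 'g set" where
  "class_kernel G \<Gamma> \<phi> R = {g\<in>carrier G. \<forall>C\<in>elems \<Gamma> // R. class_action \<phi> R g C = C}"

text \<open>A coset \<open>K\<close> of the kernel acts by any of its members, so that the union is of equal sets.\<close>

definition coset_action ::
    "('g \<Rightarrow> 'a \<Rightarrow> 'a) \<Rightarrow> ('a \<times> 'a) set \<Rightarrow> 'g set \<Rightarrow> 'a set \<Rightarrow> 'a set" where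
  "coset_action \<phi> R K C = (\<Union>g\<in>K. class_action \<phi> R g C)"

definition free_action ::
    "('h, 'm) monoid_scheme \<Rightarrow> 'x set \<Rightarrow> ('h \<Rightarrow> 'x \<Rightarrow> 'x) \<Rightarrow> bool" where
  "free_action H X \<psi> \<longleftrightarrow> (\<forall>h\<in>carrier H. \<forall>x\<in>X. \<psi> h x = x \<longrightarrow> h = \<one>\<^bsub>H\<^esub>)"

definition residually_free ::
    "('g, 'm) monoid_scheme \<Rightarrow> 'a graph \<Rightarrow> ('a \<times> 'a) set set \<Rightarrow> ('g \<Rightarrow> 'a \<Rightarrow> 'a) \<Rightarrow> bool" where
  "residually_free G \<Gamma> U \<phi> \<longleftrightarrow> (\<exists>F. fundamental_system U F \<and>
     (\<forall>R\<in>F. compatible_cofinite_entourage \<Gamma> U R \<and> invariant_relation G \<phi> R \<and>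
        free_action (G Mod class_kernel G \<Gamma> \<phi> R) (elems \<Gamma> // R) (coset_action \<phi> R)))"


section \<open>The orbit graph and covering transformations\<close>

definition orbit_graph ::
    "('g, 'm) monoid_scheme \<Rightarrow> 'a graph \<Rightarrow> ('g \<Rightarrow> 'a \<Rightarrow> 'a) \<Rightarrow> 'a set graph" where
  "orbit_graph G \<Gamma> \<phi> =
    \<lparr>verts = orbits G (verts \<Gamma>) \<phi>, edges = orbits G (edges \<Gamma>) \<phi>,
     src = (\<lambda>C. src \<Gamma> ` C), tgt = (\<lambda>C. tgt \<Gamma> ` C), bar = (\<lambda>C. bar \<Gamma> ` C)\<rparr>"

definition quotient_topology :: "'a topology \<Rightarrow> ('a \<Rightarrow> 'b) \<Rightarrow> 'b topology" where
  "quotient_topology T f =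
     topology (\<lambda>W. W \<subseteq> f ` topspace T \<and> openin T {x\<in>topspace T. f x \<in> W})"

lemma openin_quotient_topology:
  "openin (quotient_topology T f) W \<longleftrightarrow> W \<subseteq> f ` topspace T \<and> openin T {x\<in>topspace T. f x \<in> W}"
proof -
  have "istopology (\<lambda>W. W \<subseteq> f ` topspace T \<and> openin T {x\<in>topspace T. f x \<in> W})"
    unfolding istopology_def
  proof (intro conjI allI impI)
    fix V W assume V: "V \<subseteq> f ` topspace T \<and> openin T {x \<in> topspace T. f x \<in> V}"
      and W: "W \<subseteq> f ` topspace T \<and> openin T {x \<in> topspace T. f x \<in> W}"
    show "V \<inter> W \<subseteq> f ` topspace T" using V by blast
    have "{x \<in> topspace T. f x \<in> V \<inter> W} =
        {x \<in> topspace T. f x \<in> V} \<inter> {x \<in> topspace T. f x \<in> W}" by blast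
    then show "openin T {x \<in> topspace T. f x \<in> V \<inter> W}" using V W by (simp add: openin_Int)
  next
    fix \<K> assume K: "\<forall>K\<in>\<K>. K \<subseteq> f ` topspace T \<and> openin T {x \<in> topspace T. f x \<in> K}"
    show "\<Union> \<K> \<subseteq> f ` topspace T" using K by blast
    have "{x \<in> topspace T. f x \<in> \<Union> \<K>} = (\<Union>K\<in>\<K>. {x \<in> topspace T. f x \<in> K})" by blast
    then show "openin T {x \<in> topspace T. f x \<in> \<Union> \<K>}" using K by auto
  qed
  then show ?thesis by (simp add: quotient_topology_def)
qed

lemma quotient_map_quotient_topology: "quotient_map T (quotient_topology T f) f"
proof -
  have "{x \<in> topspace T. f x \<in> f ` topspace T} = topspace T" by blast
  then have "openin (quotient_topology T f) (f ` topspace T)"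
    by (simp add: openin_quotient_topology)
  moreover have "topspace (quotient_topology T f) \<subseteq> f ` topspace T"
    using openin_quotient_topology[of T f "topspace (quotient_topology T f)"] by simp
  ultimately have "topspace (quotient_topology T f) = f ` topspace T"
    using openin_subset by blast
  then show ?thesis by (simp add: quotient_map_def openin_quotient_topology)
qed

definition covering_transformations ::
    "'a graph \<Rightarrow> 'a topology \<Rightarrow> ('a \<Rightarrow> 'b) \<Rightarrow> ('a \<Rightarrow> 'a) monoid" where
  "covering_transformations \<Gamma> T f = (BijGroup (elems \<Gamma>))
    \<lparr>carrier := {h \<in> Bij (elems \<Gamma>). graph_map \<Gamma> \<Gamma> h \<and> homeomorphic_map T T h \<and>
                   (\<forall>x\<in>elems \<Gamma>. f (h x) = f x)}\<rparr>"

text \<open>The topology induced on a group \<open>A\<close> of self-maps: the subgroups \<open>displacement_subgroup A \<Gamma> R\<close>,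
  for \<open>A\<close>-invariant compatible cofinite entourages \<open>R\<close>, form a base of neighbourhoods of \<open>1\<close>.\<close>

definition displacement_subgroup ::
    "('a \<Rightarrow> 'a) monoid \<Rightarrow> 'a graph \<Rightarrow> ('a \<times> 'a) set \<Rightarrow> ('a \<Rightarrow> 'a) set" where
  "displacement_subgroup A \<Gamma> R = {\<alpha>\<in>carrier A. \<forall>x\<in>elems \<Gamma>. (\<alpha> x, x) \<in> R}"

definition action_topology ::
    "('a \<Rightarrow> 'a) monoid \<Rightarrow> 'a graph \<Rightarrow> ('a \<times> 'a) set set \<Rightarrow> ('a \<Rightarrow> 'a) topology" where
  "action_topology A \<Gamma> U = topology (\<lambda>W. W \<subseteq> carrier A \<and>
     (\<forall>\<alpha>\<in>W. \<exists>R. compatible_cofinite_entourage \<Gamma> U R \<and> invariant_relation A (\<lambda>\<alpha>. \<alpha>) R \<and>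
        \<alpha> <#\<^bsub>A\<^esub> displacement_subgroup A \<Gamma> R \<subseteq> W))"

lemma compatible_cofinite_entourage_Int:
  assumes U: "uniform_structure (elems \<Gamma>) U"
    and R: "compatible_cofinite_entourage \<Gamma> U R" and S: "compatible_cofinite_entourage \<Gamma> U S"
  shows "compatible_cofinite_entourage \<Gamma> U (R \<inter> S)"
proof -
  have eR: "equiv (elems \<Gamma>) R" and eS: "equiv (elems \<Gamma>) S"
    using R S by (auto simp: compatible_cofinite_entourage_def compatible_def)
  then have "equiv (elems \<Gamma>) (R \<inter> S)"
    unfolding equiv_def by (simp add: refl_on_def sym_Int trans_Int le_infI1)
  moreover have "R \<inter> S \<in> U"
    using uniform_structure_Int[OF U] R S by (simp add: compatible_cofinite_entourage_def)
  moreover have "finite (elems \<Gamma> // (R \<inter> S))"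
  proof (rule finite_subset)
    show "elems \<Gamma> // (R \<inter> S) \<subseteq> (\<lambda>(C, D). C \<inter> D) ` (elems \<Gamma> // R \<times> elems \<Gamma> // S)"
    proof
      fix C assume "C \<in> elems \<Gamma> // (R \<inter> S)"
      then obtain x where x: "x \<in> elems \<Gamma>" "C = (R \<inter> S) `` {x}" by (auto elim: quotientE)
      then have "C = R `` {x} \<inter> S `` {x}" by blast
      then show "C \<in> (\<lambda>(C, D). C \<inter> D) ` (elems \<Gamma> // R \<times> elems \<Gamma> // S)"
        using x by (auto intro!: image_eqI[of _ _ "(R `` {x}, S `` {x})"] quotientI)
    qed
    show "finite ((\<lambda>(C, D). C \<inter> D) ` (elems \<Gamma> // R \<times> elems \<Gamma> // S))"
      using R S by (simp add: compatible_cofinite_entourage_def)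
  qed
  ultimately show ?thesis
    using R S unfolding compatible_cofinite_entourage_def compatible_def
    by (intro conjI ballI impI) simp_all
qed

lemma invariant_relation_Int:
  assumes A: "\<And>g. g \<in> carrier G \<Longrightarrow> inj_on (\<phi> g) X" and X: "R \<subseteq> X \<times> X" "S \<subseteq> X \<times> X"
    and R: "invariant_relation G \<phi> R" and S: "invariant_relation G \<phi> S"
  shows "invariant_relation G \<phi> (R \<inter> S)"
  unfolding invariant_relation_def
proof
  fix g assume g: "g \<in> carrier G"
  have "inj_on (map_prod (\<phi> g) (\<phi> g)) (X \<times> X)"
    using A[OF g] by (simp add: map_prod_inj_on)
  then have "map_prod (\<phi> g) (\<phi> g) ` (R \<inter> S) =
      map_prod (\<phi> g) (\<phi> g) ` R \<inter> map_prod (\<phi> g) (\<phi> g) ` S"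
    using X by (rule inj_on_image_Int)
  then show "map_prod (\<phi> g) (\<phi> g) ` (R \<inter> S) = R \<inter> S"
    using R S g by (simp add: invariant_relation_def)
qed

lemma openin_action_topology:
  assumes U: "uniform_structure (elems \<Gamma>) U" and A: "carrier A \<subseteq> Bij (elems \<Gamma>)"
  shows "openin (action_topology A \<Gamma> U) W \<longleftrightarrow> W \<subseteq> carrier A \<and>
     (\<forall>\<alpha>\<in>W. \<exists>R. compatible_cofinite_entourage \<Gamma> U R \<and> invariant_relation A (\<lambda>\<alpha>. \<alpha>) R \<and>
        \<alpha> <#\<^bsub>A\<^esub> displacement_subgroup A \<Gamma> R \<subseteq> W)"
    (is "_ \<longleftrightarrow> ?P W")
proof -
  have inj: "inj_on \<alpha> (elems \<Gamma>)" if "\<alpha> \<in> carrier A" for \<alpha>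
    using that A by (auto simp: Bij_def bij_betw_def)
  have "istopology ?P"
    unfolding istopology_def
  proof (intro conjI allI impI)
    fix V W assume V: "?P V" and W: "?P W"
    show "V \<inter> W \<subseteq> carrier A" using V by blast
    show "\<forall>\<alpha>\<in>V \<inter> W. \<exists>R. compatible_cofinite_entourage \<Gamma> U R \<and>
        invariant_relation A (\<lambda>\<alpha>. \<alpha>) R \<and> \<alpha> <#\<^bsub>A\<^esub> displacement_subgroup A \<Gamma> R \<subseteq> V \<inter> W"
    proof
      fix \<alpha> assume "\<alpha> \<in> V \<inter> W"
      then obtain R S where
        R: "compatible_cofinite_entourage \<Gamma> U R" "invariant_relation A (\<lambda>\<alpha>. \<alpha>) R"
           "\<alpha> <#\<^bsub>A\<^esub> displacement_subgroup A \<Gamma> R \<subseteq> V" and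
        S: "compatible_cofinite_entourage \<Gamma> U S" "invariant_relation A (\<lambda>\<alpha>. \<alpha>) S"
           "\<alpha> <#\<^bsub>A\<^esub> displacement_subgroup A \<Gamma> S \<subseteq> W"
        using V W by (meson IntD1 IntD2)
      have sub: "R \<subseteq> elems \<Gamma> \<times> elems \<Gamma>" "S \<subseteq> elems \<Gamma> \<times> elems \<Gamma>"
        using R(1) S(1) by (auto simp: compatible_cofinite_entourage_def compatible_def equiv_def)
      have "invariant_relation A (\<lambda>\<alpha>. \<alpha>) (R \<inter> S)"
        using invariant_relation_Int[of A "\<lambda>\<alpha>. \<alpha>", OF inj sub R(2) S(2)] .
      moreover have "\<alpha> <#\<^bsub>A\<^esub> displacement_subgroup A \<Gamma> (R \<inter> S) \<subseteq> V \<inter> W"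
        using R(3) S(3) by (simp add: l_coset_def displacement_subgroup_def UN_subset_iff)
      ultimately show "\<exists>R. compatible_cofinite_entourage \<Gamma> U R \<and>
          invariant_relation A (\<lambda>\<alpha>. \<alpha>) R \<and> \<alpha> <#\<^bsub>A\<^esub> displacement_subgroup A \<Gamma> R \<subseteq> V \<inter> W"
        using compatible_cofinite_entourage_Int[OF U R(1) S(1)] by blast
    qed
  next
    fix \<K> assume K: "\<forall>K\<in>\<K>. ?P K"
    show "\<Union> \<K> \<subseteq> carrier A" using K by blast
    show "\<forall>\<alpha>\<in>\<Union> \<K>. \<exists>R. compatible_cofinite_entourage \<Gamma> U R \<and>
        invariant_relation A (\<lambda>\<alpha>. \<alpha>) R \<and> \<alpha> <#\<^bsub>A\<^esub> displacement_subgroup A \<Gamma> R \<subseteq> \<Union> \<K>"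
    proof
      fix \<alpha> assume "\<alpha> \<in> \<Union> \<K>"
      then obtain C where C: "C \<in> \<K>" "\<alpha> \<in> C" by (rule UnionE)
      with K obtain R where "compatible_cofinite_entourage \<Gamma> U R"
        "invariant_relation A (\<lambda>\<alpha>. \<alpha>) R" "\<alpha> <#\<^bsub>A\<^esub> displacement_subgroup A \<Gamma> R \<subseteq> C" by meson
      then show "\<exists>R. compatible_cofinite_entourage \<Gamma> U R \<and>
          invariant_relation A (\<lambda>\<alpha>. \<alpha>) R \<and> \<alpha> <#\<^bsub>A\<^esub> displacement_subgroup A \<Gamma> R \<subseteq> \<Union> \<K>"
        using Union_upper[OF C(1)] by (meson subset_trans)
    qed
  qed
  then show ?thesis by (simp add: action_topology_def)
qed

end

theory Submission
  imports Defs
begin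

text \<open>Let \<open>\<R>\<close> be the set of invariant compatible cofinite entourages \<open>R\<close> for which \<open>G/N\<^sub>R\<close> acts freely
  and without inversions on \<open>\<Gamma>/R\<close>.  It is a fundamental system, because compactness of \<open>G \<times> \<Gamma>\<close> keeps
  all pairs \<open>(g e, bar e)\<close> outside some entourage.  For \<open>R \<in> \<R>\<close> the relation
  \<open>G R = {(x, y). \<exists>g. (g x, y) \<in> R}\<close> is again compatible, and \<open>\<Gamma>/R \<rightarrow> \<Gamma>/(G R)\<close> is the
  quotient by a free action, hence a regular covering of finite graphs.  By compactness
  \<open>\<Gamma>\<close> and \<open>\<Gamma>/G\<close> are the inverse limits of the \<open>\<Gamma>/R\<close> and of the \<open>\<Gamma>/(G R)\<close>; that the \<open>G R\<close> separate
  the orbits is the closedness of orbits.  A covering transformation \<open>h\<close> agrees with some \<open>g \<in> G\<close> at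
  one vertex; unique path lifting, applied on \<open>\<Gamma>/S\<close> for an entourage \<open>S\<close> that \<open>h\<close> maps into \<open>R\<close>,
  shows that they agree modulo every \<open>R \<in> \<R>\<close>.  Finally a continuous bijection from the compact \<open>G\<close>
  onto the Hausdorff group of covering transformations is a homeomorphism.\<close>

subsection \<open>Quotients of graphs\<close>

text \<open>Three points shape the development. A finite quotient is never fixed as one particular
  graph: it is any surjection \<open>p\<close> whose kernel is the relation in question. The
  connectedness hypothesis speaks of graphs of classes, \<open>regular_covering\<close> asks for
  graphs on \<open>nat\<close>, and the orbit graph consists of orbits; \<open>kernel_on\<close> and
  \<open>graph_quotient\<close> serve all three, and every map between quotients comes from
  comparing kernels. Freeness is used pointwise, without cosets: an element of G that fixes one
  class modulo R fixes all of them. This yields injectivity on stars and uniqueness of lifts.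
  Translations by G yield surjectivity on stars and deck transformations transitive on vertex
  fibres, from which normality of the image of the fundamental group is derived. A covering
  transformation h is not known in advance to preserve any R. It is therefore compared with g as a
  map from a finer quotient \<Gamma>/S to \<Gamma>/R, where h is defined by its uniform
  continuity.\<close>

definition kernel_on :: "'a set \<Rightarrow> ('a \<Rightarrow> 'b) \<Rightarrow> ('a \<times> 'a) set" where
  "kernel_on X p = {(x, y). x \<in> X \<and> y \<in> X \<and> p x = p y}"

lemma kernel_on_iff: "(x, y) \<in> kernel_on X p \<longleftrightarrow> x \<in> X \<and> y \<in> X \<and> p x = p y"
  by (simp add: kernel_on_def)

lemma equiv_kernel_on: "equiv X (kernel_on X p)"
  by (auto simp: kernel_on_def equiv_def refl_on_def sym_def trans_def)

definition graph_quotient :: "'a graph \<Rightarrow> 'b graph \<Rightarrow> ('a \<Rightarrow> 'b) \<Rightarrow> bool" where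
  "graph_quotient \<Gamma> \<Delta> p \<longleftrightarrow>
     graph_map \<Gamma> \<Delta> p \<and> verts \<Delta> = p ` verts \<Gamma> \<and> edges \<Delta> = p ` edges \<Gamma>"

text \<open>The map through which \<open>q\<close> factors over \<open>p\<close>.
  \<open>SOME\<close> picks an arbitrary preimage, so the value is meaningful only where
  \<open>q\<close> is constant on the fibres of \<open>p\<close>.\<close>

definition factor_map :: "'a set \<Rightarrow> ('a \<Rightarrow> 'b) \<Rightarrow> ('a \<Rightarrow> 'c) \<Rightarrow> 'b \<Rightarrow> 'c" where
  "factor_map X p q n = q (SOME x. x \<in> X \<and> p x = n)"

text \<open>A copy of the quotient by the kernel of \<open>p\<close> on whatever type
  \<open>p\<close> takes its values in; a numbering of the classes then gives a graph on
  \<open>nat\<close>.\<close>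

definition image_graph :: "'a graph \<Rightarrow> ('a \<Rightarrow> 'b) \<Rightarrow> 'b graph" where
  "image_graph \<Gamma> p =
    \<lparr>verts = p ` verts \<Gamma>, edges = p ` edges \<Gamma>,
     src = factor_map (edges \<Gamma>) p (p \<circ> src \<Gamma>),
     tgt = factor_map (edges \<Gamma>) p (p \<circ> tgt \<Gamma>),
     bar = factor_map (edges \<Gamma>) p (p \<circ> bar \<Gamma>)\<rparr>"

lemma factor_map_eq:
  assumes "x \<in> X" "\<And>x y. x \<in> X \<Longrightarrow> y \<in> X \<Longrightarrow> p x = p y \<Longrightarrow> q x = q y"
  shows "factor_map X p q (p x) = q x"
proof -
  have "(SOME y. y \<in> X \<and> p y = p x) \<in> X \<and> p (SOME y. y \<in> X \<and> p y = p x) = p x"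
    by (rule someI[of "\<lambda>y. y \<in> X \<and> p y = p x" x]) (simp add: assms)
  then show ?thesis unfolding factor_map_def using assms by blast
qed

lemma elems_simps [simp]: "v \<in> verts \<Gamma> \<Longrightarrow> v \<in> elems \<Gamma>" "e \<in> edges \<Gamma> \<Longrightarrow> e \<in> elems \<Gamma>"
  by (auto simp: elems_def)

lemma wf_graphD:
  assumes "wf_graph \<Gamma>" "e \<in> edges \<Gamma>"
  shows "src \<Gamma> e \<in> verts \<Gamma>" "tgt \<Gamma> e \<in> verts \<Gamma>" "bar \<Gamma> e \<in> edges \<Gamma>"
    "bar \<Gamma> (bar \<Gamma> e) = e" "bar \<Gamma> e \<noteq> e" "src \<Gamma> (bar \<Gamma> e) = tgt \<Gamma> e" "tgt \<Gamma> (bar \<Gamma> e) = src \<Gamma> e"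
  using assms by (auto simp: wf_graph_def)

lemma wf_graph_disjoint: "wf_graph \<Gamma> \<Longrightarrow> x \<in> verts \<Gamma> \<Longrightarrow> x \<in> edges \<Gamma> \<Longrightarrow> False"
  by (auto simp: wf_graph_def)

lemma graph_mapD:
  assumes "graph_map \<Gamma> \<Delta> f"
  shows "v \<in> verts \<Gamma> \<Longrightarrow> f v \<in> verts \<Delta>" "e \<in> edges \<Gamma> \<Longrightarrow> f e \<in> edges \<Delta>"
    "x \<in> elems \<Gamma> \<Longrightarrow> f x \<in> elems \<Delta>"
    "e \<in> edges \<Gamma> \<Longrightarrow> f (src \<Gamma> e) = src \<Delta> (f e)"
    "e \<in> edges \<Gamma> \<Longrightarrow> f (tgt \<Gamma> e) = tgt \<Delta> (f e)"
    "e \<in> edges \<Gamma> \<Longrightarrow> f (bar \<Gamma> e) = bar \<Delta> (f e)"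
  using assms by (auto simp: graph_map_def elems_def Pi_iff)

lemma compatibleD:
  assumes "compatible \<Gamma> R"
  shows "equiv (elems \<Gamma>) R"
    "v \<in> verts \<Gamma> \<Longrightarrow> e \<in> edges \<Gamma> \<Longrightarrow> (v, e) \<notin> R"
    "v \<in> verts \<Gamma> \<Longrightarrow> e \<in> edges \<Gamma> \<Longrightarrow> (e, v) \<notin> R"
    "e1 \<in> edges \<Gamma> \<Longrightarrow> e2 \<in> edges \<Gamma> \<Longrightarrow> (e1, e2) \<in> R \<Longrightarrow> (src \<Gamma> e1, src \<Gamma> e2) \<in> R"
    "e1 \<in> edges \<Gamma> \<Longrightarrow> e2 \<in> edges \<Gamma> \<Longrightarrow> (e1, e2) \<in> R \<Longrightarrow> (tgt \<Gamma> e1, tgt \<Gamma> e2) \<in> R"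
    "e1 \<in> edges \<Gamma> \<Longrightarrow> e2 \<in> edges \<Gamma> \<Longrightarrow> (e1, e2) \<in> R \<Longrightarrow> (bar \<Gamma> e1, bar \<Gamma> e2) \<in> R"
    "e \<in> edges \<Gamma> \<Longrightarrow> (e, bar \<Gamma> e) \<notin> R"
  using assms by (auto simp: compatible_def equiv_def dest: symD)

lemma compatible_edge_iff:
  assumes "compatible \<Gamma> R" "(x, y) \<in> R"
  shows "x \<in> edges \<Gamma> \<longleftrightarrow> y \<in> edges \<Gamma>" "x \<in> verts \<Gamma> \<longleftrightarrow> y \<in> verts \<Gamma>"
    and "x \<in> elems \<Gamma>" "y \<in> elems \<Gamma>"
proof -
  show *: "x \<in> elems \<Gamma>" "y \<in> elems \<Gamma>"
    using assms by (auto simp: compatible_def equiv_def)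
  show "x \<in> edges \<Gamma> \<longleftrightarrow> y \<in> edges \<Gamma>" "x \<in> verts \<Gamma> \<longleftrightarrow> y \<in> verts \<Gamma>"
    using * compatibleD(2,3)[OF assms(1)] assms(2) by (auto simp: elems_def)
qed

lemma graph_quotientD:
  assumes "graph_quotient \<Gamma> \<Delta> p"
  shows "graph_map \<Gamma> \<Delta> p" "verts \<Delta> = p ` verts \<Gamma>" "edges \<Delta> = p ` edges \<Gamma>"
    "elems \<Delta> = p ` elems \<Gamma>"
  using assms by (auto simp: graph_quotient_def elems_def)

text \<open>The clauses of \<open>compatible\<close> on the kernel are what descends: no vertex
  equivalent to an edge keeps the two kinds disjoint in the image, and no edge equivalent to its
  reverse keeps \<open>bar\<close> free of fixed points. The remaining identities are images of
  those in \<Gamma>.\<close>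

lemma graph_quotient_wf:
  assumes wf: "wf_graph \<Gamma>" and q: "graph_quotient \<Gamma> \<Delta> p"
    and c: "compatible \<Gamma> (kernel_on (elems \<Gamma>) p)"
  shows "wf_graph \<Delta>"
  unfolding wf_graph_def
proof
  show "verts \<Delta> \<inter> edges \<Delta> = {}"
    using compatibleD(2)[OF c] by (auto simp: graph_quotientD[OF q] kernel_on_iff)
  show "\<forall>e\<in>edges \<Delta>. src \<Delta> e \<in> verts \<Delta> \<and> tgt \<Delta> e \<in> verts \<Delta> \<and> bar \<Delta> e \<in> edges \<Delta> \<and>
       bar \<Delta> (bar \<Delta> e) = e \<and> bar \<Delta> e \<noteq> e \<and>
       src \<Delta> (bar \<Delta> e) = tgt \<Delta> e \<and> tgt \<Delta> (bar \<Delta> e) = src \<Delta> e"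
  proof
    fix n assume "n \<in> edges \<Delta>"
    then obtain e where e: "e \<in> edges \<Gamma>" "n = p e" by (auto simp: graph_quotientD[OF q])
    note m = graph_mapD(4-6)[OF graph_quotientD(1)[OF q], OF e(1), symmetric]
      graph_mapD(4-6)[OF graph_quotientD(1)[OF q], OF wf_graphD(3)[OF wf e(1)], symmetric]
    have "p (bar \<Gamma> e) \<noteq> p e"
      using compatibleD(7)[OF c e(1)] e(1) wf_graphD[OF wf e(1)] by (auto simp: kernel_on_iff)
    then show "src \<Delta> n \<in> verts \<Delta> \<and> tgt \<Delta> n \<in> verts \<Delta> \<and> bar \<Delta> n \<in> edges \<Delta> \<and>
       bar \<Delta> (bar \<Delta> n) = n \<and> bar \<Delta> n \<noteq> n \<and>
       src \<Delta> (bar \<Delta> n) = tgt \<Delta> n \<and> tgt \<Delta> (bar \<Delta> n) = src \<Delta> n"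
      using e wf_graphD[OF wf e(1)] by (simp add: m graph_quotientD(2,3)[OF q])
  qed
qed

lemma graph_quotient_image_graph:
  assumes wf: "wf_graph \<Gamma>" and c: "compatible \<Gamma> (kernel_on (elems \<Gamma>) p)"
  shows "graph_quotient \<Gamma> (image_graph \<Gamma> p) p"
proof -
  have "factor_map (edges \<Gamma>) p (p \<circ> s) (p e) = p (s e)"
    if e: "e \<in> edges \<Gamma>" and s: "s \<in> {src \<Gamma>, tgt \<Gamma>, bar \<Gamma>}" for e s
  proof (subst factor_map_eq[OF e])
    fix x y assume "x \<in> edges \<Gamma>" "y \<in> edges \<Gamma>" "p x = p y"
    then show "(p \<circ> s) x = (p \<circ> s) y"
      using compatibleD(4-6)[OF c, of x y] s by (auto simp: kernel_on_iff)
  qed simp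
  then show ?thesis
    unfolding graph_quotient_def graph_map_def image_graph_def by simp
qed

text \<open>Surjectivity of \<open>p\<close> lifts every edge of \<Delta> to \<Gamma>, where the
  identities for \<open>r\<close> are those for \<open>q\<close>. Transition maps, coverings and
  deck transformations are all recognised as graph maps in this way.\<close>

lemma graph_quotient_factor:
  assumes wf: "wf_graph \<Gamma>" and p: "graph_quotient \<Gamma> \<Delta> p" and q: "graph_map \<Gamma> \<Delta>' q"
    and r: "\<And>x. x \<in> elems \<Gamma> \<Longrightarrow> r (p x) = q x"
  shows "graph_map \<Delta> \<Delta>' r"
  unfolding graph_map_def
proof (intro conjI ballI funcsetI)
  fix n assume "n \<in> edges \<Delta>"
  then obtain e where e: "e \<in> edges \<Gamma>" "n = p e" by (auto simp: graph_quotientD[OF p])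
  note m = graph_mapD(4-6)[OF graph_quotientD(1)[OF p], OF e(1), symmetric]
    and m' = graph_mapD(2,4-6)[OF q, OF e(1)]
  show "r n \<in> edges \<Delta>'" "r (src \<Delta> n) = src \<Delta>' (r n)" "r (tgt \<Delta> n) = tgt \<Delta>' (r n)"
      "r (bar \<Delta> n) = bar \<Delta>' (r n)"
    using e wf_graphD[OF wf e(1)] by (simp_all add: m m' r)
qed (use graph_mapD(1)[OF q] r in \<open>auto simp: graph_quotientD[OF p]\<close>)

lemma graph_quotient_comp_factor:
  assumes wf: "wf_graph \<Gamma>" and p: "graph_quotient \<Gamma> \<Delta> p" and q: "graph_quotient \<Gamma> \<Delta>' q"
    and r: "\<And>x. x \<in> elems \<Gamma> \<Longrightarrow> r (p x) = q x"
  shows "graph_quotient \<Delta> \<Delta>' r"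
proof -
  have "r ` p ` verts \<Gamma> = q ` verts \<Gamma>" "r ` p ` edges \<Gamma> = q ` edges \<Gamma>"
    using r by (auto simp: image_image)
  then show ?thesis
    using graph_quotient_factor[OF wf p graph_quotientD(1)[OF q], of r] r
    unfolding graph_quotient_def[of \<Delta>] by (simp add: graph_quotientD[OF p] graph_quotientD[OF q])
qed

section \<open>Edge paths and path connectedness\<close>

lemma edge_path_start: "wf_graph \<Gamma> \<Longrightarrow> edge_path \<Gamma> u p v \<Longrightarrow> u \<in> verts \<Gamma>"
  by (cases p) (auto dest: wf_graphD)

lemma edge_path_append:
  assumes "wf_graph \<Gamma>"
  shows "edge_path \<Gamma> u (p @ q) w \<longleftrightarrow> (\<exists>v. edge_path \<Gamma> u p v \<and> edge_path \<Gamma> v q w)"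
  by (induction p arbitrary: u) (auto dest: edge_path_start[OF assms])

lemma edge_path_end: "wf_graph \<Gamma> \<Longrightarrow> edge_path \<Gamma> u p v \<Longrightarrow> v \<in> verts \<Gamma>"
  by (induction p arbitrary: u) auto

lemma edge_path_map:
  assumes "wf_graph \<Gamma>" and "graph_map \<Gamma> \<Delta> f" and "edge_path \<Gamma> u p v"
  shows "edge_path \<Delta> (f u) (map f p) (f v)"
  using assms(3)
proof (induction p arbitrary: u)
  case (Cons e p)
  then show ?case using graph_mapD(2)[OF assms(2), of e] graph_mapD(4,5)[OF assms(2), of e, symmetric]
    by auto
qed (use graph_mapD[OF assms(2)] in auto)

lemma edge_path_rev:
  assumes "wf_graph \<Gamma>" and "edge_path \<Gamma> u p v"
  shows "edge_path \<Gamma> v (rev (map (bar \<Gamma>) p)) u"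
  using assms(2)
proof (induction p arbitrary: u)
  case (Cons e p)
  then show ?case using wf_graphD[OF assms(1), of e] by (auto simp: edge_path_append[OF assms(1)])
qed auto

lemma path_connected_graph_image:
  assumes wf: "wf_graph \<Gamma>" and q: "graph_quotient \<Gamma> \<Delta> p" and c: "path_connected_graph \<Gamma>"
  shows "path_connected_graph \<Delta>"
proof -
  have "\<exists>l. edge_path \<Delta> (p u) l (p v)" if "u \<in> verts \<Gamma>" "v \<in> verts \<Gamma>" for u v
    using c that edge_path_map[OF wf graph_quotientD(1)[OF q]]
    unfolding path_connected_graph_def by meson
  then show ?thesis
    using c unfolding path_connected_graph_def by (auto simp: graph_quotientD[OF q])
qed

subsection \<open>Fundamental groups and regular coverings\<close>

lemma loop_homotopy_equiv: "equiv (loops \<Gamma> v) (loop_homotopy \<Gamma> v)"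
proof -
  let ?B = "backtrack_insertion \<Gamma> v \<union> (backtrack_insertion \<Gamma> v)\<inverse>"
  have "sym ?B" by (auto simp: sym_def)
  then have "sym (?B\<^sup>*)" by (rule sym_rtrancl)
  then show ?thesis
    unfolding loop_homotopy_def equiv_def refl_on_def sym_def
    by (auto intro!: trans_Int simp: trans_def intro: rtrancl_trans)
qed

lemma loops_iff: "p \<in> loops \<Gamma> v \<longleftrightarrow> edge_path \<Gamma> v p v"
  by (simp add: loops_def)

lemma loop_homotopyD:
  assumes "(p, p') \<in> loop_homotopy \<Gamma> v"
  shows "p \<in> loops \<Gamma> v" "p' \<in> loops \<Gamma> v"
  using assms by (auto simp: loop_homotopy_def)

text \<open>By induction along a chain of insertions and deletions, a map of loops respects homotopy
  once it does so for a single insertion. It is applied to appending on either side and to the map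
  induced by a graph map.\<close>

lemma loop_homotopy_map:
  assumes B: "\<And>p p'. (p, p') \<in> backtrack_insertion \<Gamma> v \<Longrightarrow> (F p, F p') \<in> loop_homotopy \<Delta> w"
    and L: "\<And>p. p \<in> loops \<Gamma> v \<Longrightarrow> F p \<in> loops \<Delta> w"
    and h: "(p, p') \<in> loop_homotopy \<Gamma> v"
  shows "(F p, F p') \<in> loop_homotopy \<Delta> w"
proof -
  note E = loop_homotopy_equiv[of \<Delta> w]
  have "(p, p') \<in> (backtrack_insertion \<Gamma> v \<union> (backtrack_insertion \<Gamma> v)\<inverse>)\<^sup>*"
    using h by (simp add: loop_homotopy_def)
  then show ?thesis
  proof (induction rule: rtrancl_induct)
    case base
    show ?case using E L loop_homotopyD(1)[OF h] by (auto simp: equiv_def refl_on_def)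
  next
    case (step y z)
    then have "(F y, F z) \<in> loop_homotopy \<Delta> w"
      using B E by (auto simp: equiv_def dest: symD)
    then show ?case using step.IH E by (auto simp: equiv_def dest: transD)
  qed
qed

lemma backtrack_homotopy:
  assumes "e \<in> edges \<Gamma>" "p @ q \<in> loops \<Gamma> v" "p @ [e, bar \<Gamma> e] @ q \<in> loops \<Gamma> v"
  shows "(p @ q, p @ [e, bar \<Gamma> e] @ q) \<in> loop_homotopy \<Gamma> v"
proof -
  have "(p @ q, p @ [e, bar \<Gamma> e] @ q) \<in> backtrack_insertion \<Gamma> v"
    unfolding backtrack_insertion_def using assms by blast
  then show ?thesis unfolding loop_homotopy_def using assms(2,3) by blast
qed

lemma backtrack_insertionE:
  assumes "(r, r') \<in> backtrack_insertion \<Gamma> v"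
  obtains a e b where "r = a @ b" "r' = a @ [e, bar \<Gamma> e] @ b" "e \<in> edges \<Gamma>"
    "r \<in> loops \<Gamma> v" "r' \<in> loops \<Gamma> v"
  using assms unfolding backtrack_insertion_def by blast

section \<open>The group laws for homotopy classes of loops\<close>

context
  fixes \<Gamma> :: "'a graph"
  assumes wf: "wf_graph \<Gamma>"
begin

lemma loops_append: "p \<in> loops \<Gamma> v \<Longrightarrow> q \<in> loops \<Gamma> v \<Longrightarrow> p @ q \<in> loops \<Gamma> v"
  by (auto simp: loops_iff edge_path_append[OF wf])

text \<open>One factor is changed at a time, since a backtrack in one factor is a backtrack of the
  product with the other factor held fixed; transitivity joins the two steps.\<close>

lemma loop_homotopy_append:
  assumes p: "(p, p') \<in> loop_homotopy \<Gamma> v" and q: "(q, q') \<in> loop_homotopy \<Gamma> v"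
  shows "(p @ q, p' @ q') \<in> loop_homotopy \<Gamma> v"
proof -
  note E = loop_homotopy_equiv[of \<Gamma> v]
  have "(p @ q, p' @ q) \<in> loop_homotopy \<Gamma> v"
  proof (rule loop_homotopy_map[where F = "\<lambda>p. p @ q", OF _ _ p])
    fix r r' assume "(r, r') \<in> backtrack_insertion \<Gamma> v"
    then obtain a e b where r: "r = a @ b" "r' = a @ [e, bar \<Gamma> e] @ b" "e \<in> edges \<Gamma>"
      "r \<in> loops \<Gamma> v" "r' \<in> loops \<Gamma> v" by (rule backtrack_insertionE)
    then show "(r @ q, r' @ q) \<in> loop_homotopy \<Gamma> v"
      using backtrack_homotopy[of e \<Gamma> a "b @ q" v] loops_append[OF r(4) loop_homotopyD(1)[OF q]] loops_append[OF r(5) loop_homotopyD(1)[OF q]]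
      by simp
  qed (rule loops_append[OF _ loop_homotopyD(1)[OF q]])
  moreover have "(p' @ q, p' @ q') \<in> loop_homotopy \<Gamma> v"
  proof (rule loop_homotopy_map[where F = "\<lambda>q. p' @ q", OF _ _ q])
    fix r r' assume "(r, r') \<in> backtrack_insertion \<Gamma> v"
    then obtain a e b where r: "r = a @ b" "r' = a @ [e, bar \<Gamma> e] @ b" "e \<in> edges \<Gamma>"
      "r \<in> loops \<Gamma> v" "r' \<in> loops \<Gamma> v" by (rule backtrack_insertionE)
    then show "(p' @ r, p' @ r') \<in> loop_homotopy \<Gamma> v"
      using backtrack_homotopy[of e \<Gamma> "p' @ a" b v] loops_append[OF loop_homotopyD(2)[OF p] r(4)] loops_append[OF loop_homotopyD(2)[OF p] r(5)]
      by simp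
  qed (rule loops_append[OF loop_homotopyD(2)[OF p]])
  ultimately show ?thesis using E by (auto simp: equiv_def dest: transD)
qed

lemma loop_homotopy_rev:
  assumes "edge_path \<Gamma> u p v"
  shows "(rev (map (bar \<Gamma>) p) @ p, []) \<in> loop_homotopy \<Gamma> v"
  using assms
proof (induction p arbitrary: u)
  case Nil
  then show ?case using loop_homotopy_equiv[of \<Gamma> v] by (auto simp: equiv_def refl_on_def loops_iff)
next
  case (Cons e p)
  let ?r = "rev (map (bar \<Gamma>) p)"
  note e = wf_graphD[OF wf, of e]
  have p: "e \<in> edges \<Gamma>" "edge_path \<Gamma> (tgt \<Gamma> e) p v" using Cons.prems by auto
  \<comment> \<open>The innermost pair of the word for \<open>e # p\<close> is
    \<open>bar e, e\<close>. As \<open>bar (bar e) = e\<close>, it is the backtrack along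
    \<open>bar e\<close>, and removing it leaves the word for \<open>p\<close>.\<close>
  have "?r @ p \<in> loops \<Gamma> v" "?r @ [bar \<Gamma> e, bar \<Gamma> (bar \<Gamma> e)] @ p \<in> loops \<Gamma> v"
    using p edge_path_rev[OF wf p(2)] e by (auto simp: loops_iff edge_path_append[OF wf])
  then have "(?r @ p, rev (map (bar \<Gamma>) (e # p)) @ e # p) \<in> loop_homotopy \<Gamma> v"
    using backtrack_homotopy[OF e(3)[OF p(1)], of ?r p v] e(4) p(1) by simp
  then show ?case using Cons.IH[OF p(2)] loop_homotopy_equiv[of \<Gamma> v]
    unfolding equiv_def by (meson symD transD)
qed

text \<open>Products are defined from all representatives at once. Compatibility of homotopy with
  concatenation shows that one pair of representatives is enough, so that the group laws become laws
  of lists.\<close>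

lemma fundamental_group_mult:
  assumes "p \<in> loops \<Gamma> v" "q \<in> loops \<Gamma> v"
  shows "(loop_homotopy \<Gamma> v `` {p}) \<otimes>\<^bsub>fundamental_group \<Gamma> v\<^esub> (loop_homotopy \<Gamma> v `` {q}) =
    loop_homotopy \<Gamma> v `` {p @ q}"
proof -
  note E = loop_homotopy_equiv[of \<Gamma> v]
  have "(p @ q, r) \<in> loop_homotopy \<Gamma> v \<longleftrightarrow>
     (\<exists>p' q'. (p, p') \<in> loop_homotopy \<Gamma> v \<and> (q, q') \<in> loop_homotopy \<Gamma> v \<and>
       (p' @ q', r) \<in> loop_homotopy \<Gamma> v)" for r
    using loop_homotopy_append[of p _ v q] assms E
    unfolding equiv_def refl_on_def by (meson symD transD)
  then show ?thesis unfolding fundamental_group_def by (simp add: Image_def set_eq_iff) blast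
qed

lemma carrier_fundamental_group:
  "carrier (fundamental_group \<Gamma> v) = (\<lambda>p. loop_homotopy \<Gamma> v `` {p}) ` loops \<Gamma> v"
  by (auto simp: fundamental_group_def quotient_def)

lemma one_fundamental_group: "\<one>\<^bsub>fundamental_group \<Gamma> v\<^esub> = loop_homotopy \<Gamma> v `` {[]}"
  by (simp add: fundamental_group_def)

lemma loops_rev: "p \<in> loops \<Gamma> v \<Longrightarrow> rev (map (bar \<Gamma>) p) \<in> loops \<Gamma> v"
  using edge_path_rev[OF wf] by (auto simp: loops_iff)

lemma fundamental_group_l_inv:
  assumes "p \<in> loops \<Gamma> v"
  shows "(loop_homotopy \<Gamma> v `` {rev (map (bar \<Gamma>) p)}) \<otimes>\<^bsub>fundamental_group \<Gamma> v\<^esub>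
    (loop_homotopy \<Gamma> v `` {p}) = \<one>\<^bsub>fundamental_group \<Gamma> v\<^esub>"
  unfolding fundamental_group_mult[OF loops_rev[OF assms] assms] one_fundamental_group
  using loop_homotopy_rev assms by (auto simp: loops_iff intro!: equiv_class_eq[OF loop_homotopy_equiv])

lemma group_fundamental_group:
  assumes v: "v \<in> verts \<Gamma>"
  shows "group (fundamental_group \<Gamma> v)"
proof (rule groupI)
  have nil: "[] \<in> loops \<Gamma> v" using v by (simp add: loops_iff)
  show "\<one>\<^bsub>fundamental_group \<Gamma> v\<^esub> \<in> carrier (fundamental_group \<Gamma> v)"
    using nil by (auto simp: carrier_fundamental_group one_fundamental_group)
  fix x assume "x \<in> carrier (fundamental_group \<Gamma> v)"
  then obtain p where p: "p \<in> loops \<Gamma> v" "x = loop_homotopy \<Gamma> v `` {p}"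
    by (auto simp: carrier_fundamental_group)
  show "\<one>\<^bsub>fundamental_group \<Gamma> v\<^esub> \<otimes>\<^bsub>fundamental_group \<Gamma> v\<^esub> x = x"
    using p nil by (simp add: one_fundamental_group fundamental_group_mult)
  show "\<exists>y\<in>carrier (fundamental_group \<Gamma> v). y \<otimes>\<^bsub>fundamental_group \<Gamma> v\<^esub> x = \<one>\<^bsub>fundamental_group \<Gamma> v\<^esub>"
    using fundamental_group_l_inv[OF p(1)] p loops_rev[OF p(1)]
    unfolding carrier_fundamental_group by blast
  fix y assume "y \<in> carrier (fundamental_group \<Gamma> v)"
  then obtain q where q: "q \<in> loops \<Gamma> v" "y = loop_homotopy \<Gamma> v `` {q}"
    by (auto simp: carrier_fundamental_group)
  show "x \<otimes>\<^bsub>fundamental_group \<Gamma> v\<^esub> y \<in> carrier (fundamental_group \<Gamma> v)"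
    using p q loops_append by (simp add: fundamental_group_mult carrier_fundamental_group)
  fix z assume "z \<in> carrier (fundamental_group \<Gamma> v)"
  then obtain r where r: "r \<in> loops \<Gamma> v" "z = loop_homotopy \<Gamma> v `` {r}"
    by (auto simp: carrier_fundamental_group)
  show "x \<otimes>\<^bsub>fundamental_group \<Gamma> v\<^esub> y \<otimes>\<^bsub>fundamental_group \<Gamma> v\<^esub> z =
      x \<otimes>\<^bsub>fundamental_group \<Gamma> v\<^esub> (y \<otimes>\<^bsub>fundamental_group \<Gamma> v\<^esub> z)"
    using p q r loops_append by (simp add: fundamental_group_mult)
qed

lemma fundamental_group_inv:
  assumes "v \<in> verts \<Gamma>" "p \<in> loops \<Gamma> v"
  shows "inv\<^bsub>fundamental_group \<Gamma> v\<^esub> (loop_homotopy \<Gamma> v `` {p}) =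
    loop_homotopy \<Gamma> v `` {rev (map (bar \<Gamma>) p)}"
  using group.inv_equality[OF group_fundamental_group[OF assms(1)] fundamental_group_l_inv[OF assms(2)]]
    assms(2) loops_rev by (auto simp: carrier_fundamental_group)

end

section \<open>Induced maps, path lifting and regularity\<close>

lemma fundamental_group_map_class:
  assumes X: "wf_graph X" and q: "graph_map X Y q" and p: "p \<in> loops X x"
  shows "fundamental_group_map Y q x (loop_homotopy X x `` {p}) = loop_homotopy Y (q x) `` {map q p}"
proof -
  have L: "map q p \<in> loops Y (q x)" if "p \<in> loops X x" for p
    using that edge_path_map[OF X q] by (auto simp: loops_iff)
  have "(map q p, map q p') \<in> loop_homotopy Y (q x)" if "(p, p') \<in> loop_homotopy X x" for p'
  proof (rule loop_homotopy_map[where F = "map q", OF _ _ that])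
    fix r r' assume "(r, r') \<in> backtrack_insertion X x"
    then obtain a e b where r: "r = a @ b" "r' = a @ [e, bar X e] @ b" "e \<in> edges X"
      "r \<in> loops X x" "r' \<in> loops X x" by (rule backtrack_insertionE)
    then show "(map q r, map q r') \<in> loop_homotopy Y (q x)"
      using backtrack_homotopy[OF graph_mapD(2)[OF q r(3)], of "map q a" "map q b" "q x"]
        L[OF r(4)] L[OF r(5)] graph_mapD(6)[OF q r(3)] by simp
  qed (rule L)
  moreover have "(p, p) \<in> loop_homotopy X x"
    using p loop_homotopy_equiv[of X x] by (auto simp: equiv_def refl_on_def)
  ultimately show ?thesis
    unfolding fundamental_group_map_def using loop_homotopy_equiv[of Y "q x"]
    by (auto simp: equiv_def Image_iff intro: transD)
qed

text \<open>Edge by edge, surjectivity on the star at the current end point supplies the next edge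
  of the lift. The lift of a loop need not close up, whence the free end point
  \<open>v\<close>.\<close>

lemma locally_bijective_lift_path:
  assumes X: "wf_graph X" and q: "graph_map X Y q" and l: "locally_bijective X Y q"
    and u: "u \<in> verts X" and P: "edge_path Y (q u) P w"
  shows "\<exists>p v. edge_path X u p v \<and> map q p = P \<and> q v = w"
  using u P
proof (induction P arbitrary: u)
  case Nil
  then show ?case by (intro exI[of _ "[]"] exI[of _ u]) auto
next
  case (Cons e P)
  then have e: "e \<in> {e\<in>edges Y. src Y e = q u}" by auto
  moreover have "q ` {e\<in>edges X. src X e = u} = {e\<in>edges Y. src Y e = q u}"
    using l Cons.prems(1) unfolding locally_bijective_def bij_betw_def by blast
  ultimately obtain d where d: "d \<in> edges X" "src X d = u" "q d = e" by force
  then have "edge_path Y (q (tgt X d)) P w"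
    using Cons.prems(2) graph_mapD(5)[OF q d(1)] by simp
  then obtain p v where "edge_path X (tgt X d) p v" "map q p = P" "q v = w"
    using Cons.IH wf_graphD(2)[OF X d(1)] by blast
  then show ?case using d by (intro exI[of _ "d # p"] exI[of _ v]) auto
qed

text \<open>A loop \<open>P\<close> of \<open>Y\<close> lifts to a path from \<open>x\<close> to some \<open>\<sigma> x\<close>; conjugating the image of a loop
  \<open>p\<close> by \<open>P\<close> gives the image of the loop that follows the lift, then \<open>\<sigma> p\<close>, then the lift back.\<close>

lemma finite_regular_coveringI:
  assumes X: "wf_graph X" "finite (elems X)" "path_connected_graph X"
    and Y: "wf_graph Y" "finite (elems Y)" "path_connected_graph Y"
    and q: "graph_map X Y q" "locally_bijective X Y q"
    and tr: "\<And>x x'. x \<in> verts X \<Longrightarrow> x' \<in> verts X \<Longrightarrow> q x = q x' \<Longrightarrow>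
      \<exists>\<sigma>. graph_map X X \<sigma> \<and> \<sigma> x = x' \<and> (\<forall>y\<in>elems X. q (\<sigma> y) = q y)"
  shows "finite_regular_covering X Y q"
proof -
  obtain x where x: "x \<in> verts X"
    using X(1,3) by (force simp: path_connected_graph_def elems_def dest: wf_graphD)
  let ?G = "fundamental_group Y (q x)" and ?c = "\<lambda>p. loop_homotopy Y (q x) `` {p}"
  let ?H = "fundamental_group_map Y q x ` carrier (fundamental_group X x)"
  have qx: "q x \<in> verts Y" using graph_mapD(1)[OF q(1) x] .
  interpret group ?G by (rule group_fundamental_group[OF Y(1) qx])
  have H: "?H = (\<lambda>p. ?c (map q p)) ` loops X x"
    using fundamental_group_map_class[OF X(1) q(1)]
    by (simp add: carrier_fundamental_group[OF X(1)] image_image)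
  have L: "map q p \<in> loops Y (q x)" if "p \<in> loops X x" for p
    using that edge_path_map[OF X(1) q(1)] by (auto simp: loops_iff)
  \<comment> \<open>Stated for arbitrary paths, as the tails met in the induction on a loop need not
    be loops.\<close>
  have rev: "rev (map (bar Y) (map q p)) = map q (rev (map (bar X) p))" if "edge_path X u p v" for u p v
    using that by (induction p arbitrary: u) (auto simp: graph_mapD(6)[OF q(1)])
  have "subgroup ?H ?G"
  proof (rule subgroupI)
    show "?H \<subseteq> carrier ?G"
      unfolding H carrier_fundamental_group[OF Y(1)] using L by blast
    show "?H \<noteq> {}" using x loops_iff[of "[]" X x] by (auto simp: H)
  next
    fix a assume "a \<in> ?H"
    then obtain p where p: "p \<in> loops X x" "a = ?c (map q p)" by (auto simp: H)
    have "inv\<^bsub>?G\<^esub> a = ?c (map q (rev (map (bar X) p)))"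
      using rev p unfolding p(2) fundamental_group_inv[OF Y(1) qx L[OF p(1)]] loops_iff by metis
    then show "inv\<^bsub>?G\<^esub> a \<in> ?H" unfolding H using loops_rev[OF X(1) p(1)] by blast
    fix b assume "b \<in> ?H"
    then obtain r where r: "r \<in> loops X x" "b = ?c (map q r)" by (auto simp: H)
    have "a \<otimes>\<^bsub>?G\<^esub> b = ?c (map q (p @ r))"
      unfolding p(2) r(2) by (simp add: fundamental_group_mult[OF Y(1) L[OF p(1)] L[OF r(1)]])
    then show "a \<otimes>\<^bsub>?G\<^esub> b \<in> ?H" unfolding H using loops_append[OF X(1) p(1) r(1)] by blast
  qed
  moreover have "a \<otimes>\<^bsub>?G\<^esub> h \<otimes>\<^bsub>?G\<^esub> inv\<^bsub>?G\<^esub> a \<in> ?H" if a: "a \<in> carrier ?G" and h: "h \<in> ?H" for a h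
  proof -
    from a obtain P where P: "P \<in> loops Y (q x)" "a = ?c P"
      by (auto simp: carrier_fundamental_group[OF Y(1)])
    from h obtain p where p: "p \<in> loops X x" "h = ?c (map q p)" by (auto simp: H)
    from P obtain r v where r: "edge_path X x r v" "map q r = P" "q v = q x"
      using locally_bijective_lift_path[OF X(1) q x, of P "q x"] unfolding loops_iff by blast
    obtain \<sigma> where \<sigma>: "graph_map X X \<sigma>" "\<sigma> x = v" "\<forall>y\<in>elems X. q (\<sigma> y) = q y"
      using tr[OF x edge_path_end[OF X(1) r(1)]] r(3) by auto
    have sp: "edge_path X v (map \<sigma> p) v"
      using edge_path_map[OF X(1) \<sigma>(1)] p(1) \<sigma>(2) by (auto simp: loops_iff)
    have "map q (map \<sigma> p) = map q p" if "edge_path X u p w" for u w p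
      using that \<sigma>(3) by (induction p arbitrary: u) auto
    then have sq: "map q (map \<sigma> p) = map q p" using p(1) loops_iff by metis
    let ?l = "r @ map \<sigma> p @ rev (map (bar X) r)"
    have l: "?l \<in> loops X x"
      using r(1) sp edge_path_rev[OF X(1) r(1)] by (auto simp: loops_iff edge_path_append[OF X(1)])
    have "map q ?l = P @ map q p @ rev (map (bar Y) P)"
      using rev[OF r(1)] sq r(2) by simp
    moreover have "a \<otimes>\<^bsub>?G\<^esub> h \<otimes>\<^bsub>?G\<^esub> inv\<^bsub>?G\<^esub> a = ?c (P @ map q p @ rev (map (bar Y) P))"
      unfolding p(2) P(2) fundamental_group_inv[OF Y(1) qx P(1)]
        fundamental_group_mult[OF Y(1) P(1) L[OF p(1)]]
        fundamental_group_mult[OF Y(1) loops_append[OF Y(1) P(1) L[OF p(1)]] loops_rev[OF Y(1) P(1)]]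
      by simp
    ultimately have "a \<otimes>\<^bsub>?G\<^esub> h \<otimes>\<^bsub>?G\<^esub> inv\<^bsub>?G\<^esub> a = ?c (map q ?l)" by simp
    then show ?thesis unfolding H by (rule image_eqI[OF _ l])
  qed
  ultimately have "?H \<lhd> ?G" unfolding normal_inv_iff by blast
  then show ?thesis unfolding finite_regular_covering_def using X Y q x by blast
qed

subsection \<open>Entourages of profinite graphs\<close>

lemma uniform_structureD:
  assumes "uniform_structure X U"
  shows "U \<noteq> {}" "W \<in> U \<Longrightarrow> x \<in> X \<Longrightarrow> (x, x) \<in> W" "W \<in> U \<Longrightarrow> W \<subseteq> X \<times> X"
    "W \<in> U \<Longrightarrow> W \<subseteq> W' \<Longrightarrow> W' \<subseteq> X \<times> X \<Longrightarrow> W' \<in> U"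
proof -
  show "U \<noteq> {}" using assms unfolding uniform_structure_def by (rule conjunct1)
  have "\<forall>W\<in>U. Id_on X \<subseteq> W \<and> W \<subseteq> X \<times> X"
    using assms unfolding uniform_structure_def by (elim conjE)
  then show "W \<in> U \<Longrightarrow> x \<in> X \<Longrightarrow> (x, x) \<in> W" "W \<in> U \<Longrightarrow> W \<subseteq> X \<times> X"
    by blast+
  have "\<forall>W\<in>U. \<forall>W'. W \<subseteq> W' \<and> W' \<subseteq> X \<times> X \<longrightarrow> W' \<in> U"
    using assms unfolding uniform_structure_def by (elim conjE)
  then show "W \<in> U \<Longrightarrow> W \<subseteq> W' \<Longrightarrow> W' \<subseteq> X \<times> X \<Longrightarrow> W' \<in> U" by simp
qed

lemma topspace_uniform_topology:
  assumes "uniform_structure X U"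
  shows "topspace (uniform_topology X U) = X"
proof -
  obtain W where W: "W \<in> U" using uniform_structureD(1)[OF assms] by blast
  have "W `` {x} \<subseteq> X" for x using uniform_structureD(3)[OF assms W] by blast
  then have "openin (uniform_topology X U) X"
    unfolding openin_uniform_topology[OF assms] using W by blast
  moreover have "topspace (uniform_topology X U) \<subseteq> X"
    using openin_topspace[of "uniform_topology X U"] openin_uniform_topology[OF assms] by blast
  ultimately show ?thesis using openin_subset by blast
qed

lemma openin_saturated:
  assumes "uniform_structure X U" "E \<in> U" "S \<subseteq> X" "\<And>x y. x \<in> S \<Longrightarrow> (x, y) \<in> E \<Longrightarrow> y \<in> S"
  shows "openin (uniform_topology X U) S"
  unfolding openin_uniform_topology[OF assms(1)] using assms by blast

lemma closedin_saturated:
  assumes "uniform_structure X U" "E \<in> U" "sym E" "S \<subseteq> X"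
    "\<And>x y. x \<in> S \<Longrightarrow> (x, y) \<in> E \<Longrightarrow> y \<in> S"
  shows "closedin (uniform_topology X U) S"
proof -
  have "openin (uniform_topology X U) (X - S)"
    by (rule openin_saturated[OF assms(1,2)])
      (use assms uniform_structureD(3)[OF assms(1,2)] in \<open>auto dest: symD\<close>)
  then show ?thesis
    by (simp add: closedin_def topspace_uniform_topology[OF assms(1)] assms(4))
qed

lemma openin_equiv_class:
  assumes "uniform_structure X U" "E \<in> U" "equiv X E"
  shows "openin (uniform_topology X U) (E `` {x})"
  by (rule openin_saturated[OF assms(1,2)]) (use assms(3) in \<open>auto simp: equiv_def dest: transD\<close>)

lemma closedin_equiv_class:
  assumes "uniform_structure X U" "E \<in> U" "equiv X E"
  shows "closedin (uniform_topology X U) (E `` {x})"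
  by (rule closedin_saturated[OF assms(1,2)]) (use assms(3) in \<open>auto simp: equiv_def dest: transD\<close>)

lemma continuous_map_into_discrete:
  assumes "uniform_structure X U" "kernel_on X p \<in> U" "p ` X \<subseteq> D"
  shows "continuous_map (uniform_topology X U) (discrete_topology D) p"
  unfolding continuous_map topspace_uniform_topology[OF assms(1)]
  by (auto intro!: openin_saturated[OF assms(1,2)] simp: kernel_on_iff assms(3))

text \<open>On a base of equivalence relations, transitivity makes each member its own half in the
  last axiom, and symmetry puts it inside the inverse of whatever contains it.\<close>

lemma uniform_structure_equiv_base:
  assumes ne: "B \<noteq> {}" and eq: "\<And>E. E \<in> B \<Longrightarrow> equiv X E"
    and dir: "\<And>E F. E \<in> B \<Longrightarrow> F \<in> B \<Longrightarrow> \<exists>D\<in>B. D \<subseteq> E \<inter> F"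
  shows "uniform_structure X {W. W \<subseteq> X \<times> X \<and> (\<exists>E\<in>B. E \<subseteq> W)}"
  unfolding uniform_structure_def
proof (intro conjI ballI allI impI)
  obtain E where "E \<in> B" using ne by blast
  then have "E \<in> {W. W \<subseteq> X \<times> X \<and> (\<exists>E\<in>B. E \<subseteq> W)}"
    using eq[of E] by (auto simp: equiv_def)
  then show "{W. W \<subseteq> X \<times> X \<and> (\<exists>E\<in>B. E \<subseteq> W)} \<noteq> {}" by force
next
  fix W assume "W \<in> {W. W \<subseteq> X \<times> X \<and> (\<exists>E\<in>B. E \<subseteq> W)}"
  then obtain E where W: "W \<subseteq> X \<times> X" and E: "E \<in> B" "E \<subseteq> W" by blast
  note e = eq[OF E(1)]
  show "Id_on X \<subseteq> W" "W \<subseteq> X \<times> X" using W E e by (auto simp: equiv_def refl_on_def)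
  have "E \<subseteq> W\<inverse>" using E e by (auto simp: equiv_def dest: symD)
  then show "W\<inverse> \<in> {W. W \<subseteq> X \<times> X \<and> (\<exists>E\<in>B. E \<subseteq> W)}" using W E(1) by blast
  have "E O E \<subseteq> W" using E e by (auto simp: equiv_def dest: transD)
  moreover have "E \<subseteq> X \<times> X" using E W by blast
  ultimately show "\<exists>D\<in>{W. W \<subseteq> X \<times> X \<and> (\<exists>E\<in>B. E \<subseteq> W)}. D O D \<subseteq> W" using E(1) by blast
  {
    fix W' assume "W \<subseteq> W' \<and> W' \<subseteq> X \<times> X"
    then show "W' \<in> {W. W \<subseteq> X \<times> X \<and> (\<exists>E\<in>B. E \<subseteq> W)}" using E by blast
  }
  fix W' assume "W' \<in> {W. W \<subseteq> X \<times> X \<and> (\<exists>E\<in>B. E \<subseteq> W)}"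
  then obtain F where "F \<in> B" "F \<subseteq> W'" by blast
  then show "W \<inter> W' \<in> {W. W \<subseteq> X \<times> X \<and> (\<exists>E\<in>B. E \<subseteq> W)}"
    using dir[OF E(1), of F] W E(2) by blast
qed

section \<open>Directed sets\<close>

lemma directed_setD:
  assumes "directed_set I leq"
  shows "I \<noteq> {}" "i \<in> I \<Longrightarrow> leq i i"
    "i \<in> I \<Longrightarrow> j \<in> I \<Longrightarrow> k \<in> I \<Longrightarrow> leq i j \<Longrightarrow> leq j k \<Longrightarrow> leq i k"
    "i \<in> I \<Longrightarrow> j \<in> I \<Longrightarrow> \<exists>k\<in>I. leq i k \<and> leq j k"
proof -
  show "I \<noteq> {}" using assms unfolding directed_set_def by (rule conjunct1)
  have "\<forall>i\<in>I. leq i i" using assms unfolding directed_set_def by (elim conjE)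
  then show "i \<in> I \<Longrightarrow> leq i i" by (rule bspec)
  have "\<forall>i\<in>I. \<forall>j\<in>I. \<forall>k\<in>I. leq i j \<and> leq j k \<longrightarrow> leq i k"
    using assms unfolding directed_set_def by (elim conjE)
  then show "i \<in> I \<Longrightarrow> j \<in> I \<Longrightarrow> k \<in> I \<Longrightarrow> leq i j \<Longrightarrow> leq j k \<Longrightarrow> leq i k"
    by (elim ballE[of I _ i] ballE[of I _ j] ballE[of I _ k]) simp_all
  have "\<forall>i\<in>I. \<forall>j\<in>I. \<exists>k\<in>I. leq i k \<and> leq j k"
    using assms unfolding directed_set_def by (elim conjE)
  then show "i \<in> I \<Longrightarrow> j \<in> I \<Longrightarrow> \<exists>k\<in>I. leq i k \<and> leq j k" by simp
qed

lemma directed_set_upper_bound: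
  assumes I: "directed_set I leq" and "finite J" "J \<subseteq> I"
  shows "\<exists>k\<in>I. \<forall>j\<in>J. leq j k"
  using assms(2,3)
proof (induction J rule: finite_induct)
  case empty
  then show ?case using directed_setD(1)[OF I] by blast
next
  case (insert j J)
  then obtain k where k: "k \<in> I" "\<forall>i\<in>J. leq i k" by auto
  moreover obtain l where "l \<in> I" "leq j l" "leq k l"
    using directed_setD(4)[OF I, of j k] insert.prems k(1) by blast
  moreover from this have "leq i l" if "i \<in> J" for i
    using directed_setD(3)[OF I, of i k l] insert.prems k that by blast
  ultimately show ?case by blast
qed

section \<open>Compactness arguments on a profinite graph\<close>

locale profinite =
  fixes \<Gamma> :: "'a graph" and U :: "('a \<times> 'a) set set"
  assumes profinite: "profinite_graph \<Gamma> U"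
begin

abbreviation T :: "'a topology" where "T \<equiv> uniform_topology (elems \<Gamma>) U"

lemma wf: "wf_graph \<Gamma>" and us: "uniform_structure (elems \<Gamma>) U"
  and Hausdorff: "Hausdorff_space T" and compact: "compact_space T"
  and refine: "W \<in> U \<Longrightarrow> \<exists>R. compatible_cofinite_entourage \<Gamma> U R \<and> R \<subseteq> W"
  using profinite by (auto simp: profinite_graph_def cofinite_graph_def)

lemmas topspace_T [simp] = topspace_uniform_topology[OF us]

lemma cceD:
  assumes "compatible_cofinite_entourage \<Gamma> U R"
  shows "R \<in> U" "compatible \<Gamma> R" "equiv (elems \<Gamma>) R" "finite (elems \<Gamma> // R)" "R \<subseteq> elems \<Gamma> \<times> elems \<Gamma>"
    "x \<in> elems \<Gamma> \<Longrightarrow> (x, x) \<in> R" "(x, y) \<in> R \<Longrightarrow> (y, x) \<in> R" "(x, y) \<in> R \<Longrightarrow> (y, z) \<in> R \<Longrightarrow> (x, z) \<in> R"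
  using assms unfolding compatible_cofinite_entourage_def compatible_def equiv_def refl_on_def
  by (auto dest: symD transD)

lemma separated:
  assumes "x \<in> elems \<Gamma>" "y \<in> elems \<Gamma>" "x \<noteq> y"
  shows "\<exists>W\<in>U. (x, y) \<notin> W"
proof -
  obtain V V' where V: "openin T V" "openin T V'" "x \<in> V" "y \<in> V'" "disjnt V V'"
    using Hausdorff assms unfolding Hausdorff_space_def by (metis topspace_T)
  then obtain W where "W \<in> U" "W `` {x} \<subseteq> V" unfolding openin_uniform_topology[OF us] by blast
  then show ?thesis using V by (auto simp: disjnt_def)
qed

lemma Inter_finite_entourages:
  assumes "finite \<F>" "\<F> \<noteq> {}" "\<F> \<subseteq> U"
  shows "\<Inter>\<F> \<in> U"
  using assms by (induction rule: finite_ne_induct) (auto intro: uniform_structure_Int[OF us])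

text \<open>Compactness makes open classes uniform: around each \<open>x\<close> some
  \<open>R x\<close> has its class of \<open>x\<close> inside that of \<open>E\<close>, finitely
  many of these classes cover, and the intersection of the corresponding \<open>R x\<close> lies in
  \<open>E\<close>, since a class that contains \<open>y\<close> contains everything related to
  \<open>y\<close>. This provides the uniform continuity of covering transformations.\<close>

lemma equiv_entourage_of_open_classes:
  assumes E: "equiv (elems \<Gamma>) E" and op: "\<And>x. x \<in> elems \<Gamma> \<Longrightarrow> openin T (E `` {x})"
  shows "E \<in> U"
proof -
  have EX: "E \<subseteq> elems \<Gamma> \<times> elems \<Gamma>" using E by (auto simp: equiv_def)
  have "\<exists>R. compatible_cofinite_entourage \<Gamma> U R \<and> R `` {x} \<subseteq> E `` {x}" if x: "x \<in> elems \<Gamma>" for x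
  proof -
    have "x \<in> E `` {x}" using E x by (auto simp: equiv_def refl_on_def)
    then obtain W where "W \<in> U" "W `` {x} \<subseteq> E `` {x}"
      using op[OF x] unfolding openin_uniform_topology[OF us] by blast
    then show ?thesis using refine[of W] by blast
  qed
  then obtain R where R: "\<And>x. x \<in> elems \<Gamma> \<Longrightarrow> compatible_cofinite_entourage \<Gamma> U (R x)"
    "\<And>x. x \<in> elems \<Gamma> \<Longrightarrow> R x `` {x} \<subseteq> E `` {x}" by metis
  let ?V = "\<lambda>x. R x `` {x}"
  have "\<forall>V\<in>?V ` elems \<Gamma>. openin T V"
    using R(1) openin_equiv_class[OF us cceD(1) cceD(3)] by blast
  moreover have "topspace T \<subseteq> \<Union>(?V ` elems \<Gamma>)" using R(1) cceD(6) by force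
  ultimately obtain \<F> where \<F>: "finite \<F>" "\<F> \<subseteq> ?V ` elems \<Gamma>" "topspace T \<subseteq> \<Union>\<F>"
    using compact unfolding compact_space_alt by meson
  then obtain A where A: "A \<subseteq> elems \<Gamma>" "finite A" "elems \<Gamma> \<subseteq> (\<Union>x\<in>A. ?V x)"
    using finite_subset_image[OF \<F>(1,2)] by auto
  show ?thesis
  \<comment> \<open>The intersection of an empty family is \<open>UNIV\<close>, which is no
    entourage here; the case occurs only for the empty graph.\<close>
  proof (cases "A = {}")
    case True
    then have "elems \<Gamma> = {}" using A by blast
    moreover obtain W where "W \<in> U" using uniform_structureD(1)[OF us] by blast
    ultimately show ?thesis using uniform_structureD(3)[OF us] EX by fastforce
  next
    case False
    have "\<Inter>(R ` A) \<in> U"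
      using A False R(1) cceD(1) by (intro Inter_finite_entourages) auto
    moreover have "\<Inter>(R ` A) \<subseteq> E"
    proof clarify
      fix y z assume yz: "(y, z) \<in> \<Inter>(R ` A)"
      have "\<Inter>(R ` A) \<subseteq> elems \<Gamma> \<times> elems \<Gamma>" using uniform_structureD(3)[OF us calculation] .
      then obtain x where x: "x \<in> A" "(x, y) \<in> R x" using A(3) yz by blast
      then have x': "compatible_cofinite_entourage \<Gamma> U (R x)" using R(1) A(1) by blast
      have "(x, z) \<in> R x" using cceD(8)[OF x' x(2)] yz x(1) by blast
      then have "(x, y) \<in> E" "(x, z) \<in> E" using x R(2) A(1) by blast+
      then show "(y, z) \<in> E" using E unfolding equiv_def by (meson symD transD)
    qed
    ultimately show ?thesis using uniform_structureD(4)[OF us] EX by blast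
  qed
qed

text \<open>The classes of the \<open>x i\<close> modulo \<open>E i\<close> are closed, and by
  directedness any finitely many of them share a point, namely \<open>x k\<close> for an upper bound
  \<open>k\<close> of their indices. Compactness gives a point common to all.\<close>

lemma inverse_limit_point:
  assumes I: "directed_set I leq"
    and E: "\<And>i. i \<in> I \<Longrightarrow> E i \<in> U" "\<And>i. i \<in> I \<Longrightarrow> equiv (elems \<Gamma>) (E i)"
    and mono: "\<And>i j. i \<in> I \<Longrightarrow> j \<in> I \<Longrightarrow> leq i j \<Longrightarrow> E j \<subseteq> E i"
    and x: "\<And>i. i \<in> I \<Longrightarrow> x i \<in> elems \<Gamma>"
    and coh: "\<And>i j. i \<in> I \<Longrightarrow> j \<in> I \<Longrightarrow> leq i j \<Longrightarrow> (x i, x j) \<in> E i"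
  shows "\<exists>z\<in>elems \<Gamma>. \<forall>i\<in>I. (x i, z) \<in> E i"
proof -
  let ?C = "\<lambda>i. E i `` {x i}"
  have "\<Inter>(?C ` I) \<noteq> {}"
  proof -
    have "\<forall>C\<in>?C ` I. closedin T C" using closedin_equiv_class[OF us E] by blast
    moreover have "\<Inter>\<F> \<noteq> {}" if F: "finite \<F>" "\<F> \<subseteq> ?C ` I" for \<F>
    proof -
      obtain J where J: "J \<subseteq> I" "finite J" "\<F> = ?C ` J"
        using finite_subset_image[OF F] by auto
      obtain k where k: "k \<in> I" "\<forall>j\<in>J. leq j k" using directed_set_upper_bound[OF I J(2,1)] by blast
      have "x k \<in> \<Inter>\<F>" using J k coh by blast
      then show ?thesis by blast
    qed
    moreover have "(\<forall>C\<in>?C ` I. closedin T C) \<and> (\<forall>\<F>. finite \<F> \<and> \<F> \<subseteq> ?C ` I \<longrightarrow> \<Inter>\<F> \<noteq> {})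
        \<longrightarrow> \<Inter>(?C ` I) \<noteq> {}"
      using compact unfolding compact_space_fip by (rule spec)
    ultimately show ?thesis by (elim mp) (intro conjI allI impI, assumption, elim conjE)
  qed
  then obtain z where z: "\<forall>i\<in>I. (x i, z) \<in> E i" by auto
  obtain i where i: "i \<in> I" using directed_setD(1)[OF I] by blast
  then have "z \<in> elems \<Gamma>" using z E(2)[OF i] by (auto simp: equiv_def)
  then show ?thesis using z by blast
qed

text \<open>The map into the limit is onto by the compactness argument for coherent families and
  injective by \<open>sep\<close>; a continuous bijection from a compact to a Hausdorff space is a
  homeomorphism.\<close>

lemma inverse_limit_homeomorphism:
  assumes I: "directed_set I leq"
    and q: "\<And>i. i \<in> I \<Longrightarrow> graph_quotient \<Gamma> (X i) (p i)" "\<And>i. i \<in> I \<Longrightarrow> wf_graph (X i)"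
    and E: "\<And>i. i \<in> I \<Longrightarrow> kernel_on (elems \<Gamma>) (p i) \<in> U"
    and \<phi>: "\<And>i j x. i \<in> I \<Longrightarrow> j \<in> I \<Longrightarrow> leq i j \<Longrightarrow> x \<in> elems \<Gamma> \<Longrightarrow> \<phi> i j (p j x) = p i x"
    and sep: "\<And>x y. x \<in> elems \<Gamma> \<Longrightarrow> y \<in> elems \<Gamma> \<Longrightarrow> (\<And>i. i \<in> I \<Longrightarrow> p i x = p i y) \<Longrightarrow> x = y"
  shows "graph_homeomorphism \<Gamma> T (inverse_limit_graph I leq X \<phi>)
    (inverse_limit_topology I leq X (\<lambda>i. discrete_topology (elems (X i))) \<phi>) (\<lambda>x. \<lambda>i\<in>I. p i x)"
    (is "graph_homeomorphism _ _ ?L ?TL ?a")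
proof -
  note gm = graph_mapD[OF graph_quotientD(1)[OF q(1)]]
  obtain i0 where i0: "i0 \<in> I" using directed_setD(1)[OF I] by blast
  have aV: "?a x \<in> verts ?L" if "x \<in> verts \<Gamma>" for x
    using that gm(1) \<phi> by (auto simp: inverse_limit_graph_def)
  have aE: "?a x \<in> edges ?L" if "x \<in> edges \<Gamma>" for x
    using that gm(2) \<phi> by (auto simp: inverse_limit_graph_def)
  have onto: "\<exists>z\<in>elems \<Gamma>. ?a z = y"
    if y: "y \<in> extensional I" "\<And>i. i \<in> I \<Longrightarrow> y i \<in> elems (X i)"
      "\<And>i j. i \<in> I \<Longrightarrow> j \<in> I \<Longrightarrow> leq i j \<Longrightarrow> \<phi> i j (y j) = y i" for y
  proof -
    have "\<exists>x. x \<in> elems \<Gamma> \<and> p i x = y i" if "i \<in> I" for i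
      using y(2)[OF that] graph_quotientD(4)[OF q(1)[OF that]] by auto
    then obtain x where x: "\<And>i. i \<in> I \<Longrightarrow> x i \<in> elems \<Gamma>" "\<And>i. i \<in> I \<Longrightarrow> p i (x i) = y i"
      by metis
    have "\<exists>z\<in>elems \<Gamma>. \<forall>i\<in>I. (x i, z) \<in> kernel_on (elems \<Gamma>) (p i)"
    proof (rule inverse_limit_point[OF I E])
      fix i j assume ij: "i \<in> I" "j \<in> I" "leq i j"
      show "kernel_on (elems \<Gamma>) (p j) \<subseteq> kernel_on (elems \<Gamma>) (p i)"
        using \<phi>[OF ij] by (auto simp: kernel_on_def) metis
      show "(x i, x j) \<in> kernel_on (elems \<Gamma>) (p i)"
        using \<phi>[OF ij x(1)[OF ij(2)]] y(3)[OF ij] x ij by (simp add: kernel_on_iff)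
    qed (use x in \<open>auto simp: equiv_kernel_on\<close>)
    then obtain z where "z \<in> elems \<Gamma>" "\<forall>i\<in>I. p i z = y i" using x(2) by (auto simp: kernel_on_iff)
    then show ?thesis using y(1) by (intro bexI[of _ z]) (auto simp: extensional_def)
  qed
  have V: "verts ?L = ?a ` verts \<Gamma>"
  proof
    show "verts ?L \<subseteq> ?a ` verts \<Gamma>"
    proof
      fix y assume y: "y \<in> verts ?L"
      then obtain z where z: "z \<in> elems \<Gamma>" "?a z = y"
        using onto[of y] by (auto simp: inverse_limit_graph_def PiE_iff)
      \<comment> \<open>One coordinate tells vertices from edges, because \<open>p i0\<close>
        preserves the kind and the kinds are disjoint in \<open>X i0\<close>.\<close>
      have "p i0 z \<in> verts (X i0)" using y z(2) i0 by (auto simp: inverse_limit_graph_def PiE_iff)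
      then have "z \<in> verts \<Gamma>"
        using z(1) gm(2)[OF i0] wf_graph_disjoint[OF q(2)[OF i0]] by (auto simp: elems_def)
      then show "y \<in> ?a ` verts \<Gamma>" using z(2) by blast
    qed
  qed (use aV in blast)
  have Ed: "edges ?L = ?a ` edges \<Gamma>"
  proof
    show "edges ?L \<subseteq> ?a ` edges \<Gamma>"
    proof
      fix y assume y: "y \<in> edges ?L"
      then obtain z where z: "z \<in> elems \<Gamma>" "?a z = y"
        using onto[of y] by (auto simp: inverse_limit_graph_def PiE_iff)
      have "p i0 z \<in> edges (X i0)" using y z(2) i0 by (auto simp: inverse_limit_graph_def PiE_iff)
      then have "z \<in> edges \<Gamma>"
        using z(1) gm(1)[OF i0] wf_graph_disjoint[OF q(2)[OF i0]] by (auto simp: elems_def)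
      then show "y \<in> ?a ` edges \<Gamma>" using z(2) by blast
    qed
  qed (use aE in blast)
  have L: "elems ?L = ?a ` elems \<Gamma>" using V Ed by (simp add: elems_def image_Un)
  have sub: "elems ?L \<subseteq> (\<Pi>\<^sub>E i\<in>I. elems (X i))"
    using gm(3) by (auto simp: L)
  have "graph_map \<Gamma> ?L ?a"
    unfolding graph_map_def
  proof (intro conjI ballI)
    fix e assume e: "e \<in> edges \<Gamma>"
    show "?a (src \<Gamma> e) = src ?L (?a e)" "?a (tgt \<Gamma> e) = tgt ?L (?a e)" "?a (bar \<Gamma> e) = bar ?L (?a e)"
      using gm(4-6)[OF _ e] by (auto simp: inverse_limit_graph_def)
  qed (use aV aE in auto)
  moreover have "homeomorphic_map T ?TL ?a"
  proof (rule continuous_imp_homeomorphic_map)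
    have top: "topspace ?TL = elems ?L"
      using sub by (auto simp: inverse_limit_topology_def topspace_product_topology)
    show "Hausdorff_space ?TL"
      unfolding inverse_limit_topology_def
      by (intro Hausdorff_space_subtopology) (simp add: Hausdorff_space_product_topology Hausdorff_space_discrete_topology)
    show "continuous_map T ?TL ?a"
      unfolding inverse_limit_topology_def continuous_map_in_subtopology continuous_map_componentwise
      using L continuous_map_into_discrete[OF us E] graph_quotientD(4)[OF q(1)] by auto
    show "?a ` topspace T = topspace ?TL" using top L by simp
    show "inj_on ?a (topspace T)"
    proof (rule inj_onI)
      fix x y assume xy: "x \<in> topspace T" "y \<in> topspace T" "?a x = ?a y"
      have "p i x = p i y" if "i \<in> I" for i using fun_cong[OF xy(3), of i] that by simp
      then show "x = y" using sep xy by simp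
    qed
  qed (rule compact)
  ultimately show ?thesis by (simp add: graph_homeomorphism_def)
qed

text \<open>The uniformity is generated by the images of the relations in \<E>. Its topology is
  identified with the quotient topology through the identity map, which is continuous from a compact
  to a Hausdorff space. The last conclusion keeps track of the generating entourages for the passage
  to the limit.\<close>

lemma profinite_graph_quotient:
  fixes \<Delta> :: "'b graph" and f :: "'a \<Rightarrow> 'b"
  assumes wf\<Delta>: "wf_graph \<Delta>" and f: "graph_quotient \<Gamma> \<Delta> f"
    and ne: "\<E> \<noteq> {}"
    and E: "\<And>E. E \<in> \<E> \<Longrightarrow> compatible_cofinite_entourage \<Gamma> U E"
    and ker: "\<And>E. E \<in> \<E> \<Longrightarrow> kernel_on (elems \<Gamma>) f \<subseteq> E"
    and dir: "\<And>E F. E \<in> \<E> \<Longrightarrow> F \<in> \<E> \<Longrightarrow> \<exists>D\<in>\<E>. D \<subseteq> E \<inter> F"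
    and sep: "\<And>x y. x \<in> elems \<Gamma> \<Longrightarrow> y \<in> elems \<Gamma> \<Longrightarrow> (\<And>E. E \<in> \<E> \<Longrightarrow> (x, y) \<in> E) \<Longrightarrow> f x = f y"
  obtains U' where "profinite_graph \<Delta> U'" "uniform_topology (elems \<Delta>) U' = quotient_topology T f"
    "\<And>E. E \<in> \<E> \<Longrightarrow> map_prod f f ` E \<in> U'"
proof -
  let ?X = "elems \<Delta>" and ?B = "(\<lambda>E. map_prod f f ` E) ` \<E>"
  define U' where "U' = {W. W \<subseteq> ?X \<times> ?X \<and> (\<exists>E\<in>?B. E \<subseteq> W)}"
  note gm = graph_mapD[OF graph_quotientD(1)[OF f]]
  have X: "?X = f ` elems \<Gamma>" using graph_quotientD(4)[OF f] .
  \<comment> \<open>As \<open>E\<close> contains the kernel of \<open>f\<close>, its image acquires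
    no accidental pairs: membership can be tested on any preimages.\<close>
  have mem: "(f x, f y) \<in> map_prod f f ` E \<longleftrightarrow> (x, y) \<in> E"
    if e: "E \<in> \<E>" and x: "x \<in> elems \<Gamma>" and y: "y \<in> elems \<Gamma>" for E x y
  proof
    assume "(f x, f y) \<in> map_prod f f ` E"
    then obtain x' y' where xy: "(x', y') \<in> E" "f x = f x'" "f y = f y'" by auto
    then have "x' \<in> elems \<Gamma>" "y' \<in> elems \<Gamma>" using cceD(5)[OF E[OF e]] by auto
    then have "(x, x') \<in> E" "(y', y) \<in> E" using ker[OF e] xy x y by (auto simp: kernel_on_def)
    then show "(x, y) \<in> E" using xy(1) cceD(8)[OF E[OF e]] by blast
  next
    assume "(x, y) \<in> E"
    then show "(f x, f y) \<in> map_prod f f ` E" by force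
  qed
  have sub: "map_prod f f ` E \<subseteq> ?X \<times> ?X" if "E \<in> \<E>" for E
    using cceD(5)[OF E[OF that]] X by auto
  have eq: "equiv ?X (map_prod f f ` E)" if e: "E \<in> \<E>" for E
  proof (rule equivI)
    show "map_prod f f ` E \<subseteq> ?X \<times> ?X" by (rule sub[OF e])
    show "refl_on ?X (map_prod f f ` E)"
      using cceD(6)[OF E[OF e]] mem[OF e] by (auto simp: refl_on_def X)
    show "sym (map_prod f f ` E)"
      using cceD(7)[OF E[OF e]] by (force simp: sym_def)
    show "trans (map_prod f f ` E)"
    proof (rule transI)
      fix a b c assume ab: "(a, b) \<in> map_prod f f ` E" and bc: "(b, c) \<in> map_prod f f ` E"
      then have "a \<in> ?X" "b \<in> ?X" "c \<in> ?X" using sub[OF e] by auto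
      then obtain x y z where x: "x \<in> elems \<Gamma>" "a = f x" and y: "y \<in> elems \<Gamma>" "b = f y"
        and z: "z \<in> elems \<Gamma>" "c = f z"
        unfolding X by blast
      have "(x, y) \<in> E" "(y, z) \<in> E"
        using ab bc mem[OF e x(1) y(1)] mem[OF e y(1) z(1)] x(2) y(2) z(2) by simp_all
      then have "(x, z) \<in> E" by (rule cceD(8)[OF E[OF e]])
      then show "(a, c) \<in> map_prod f f ` E" using mem[OF e x(1) z(1)] x(2) z(2) by simp
    qed
  qed
  have us': "uniform_structure ?X U'"
    unfolding U'_def
  proof (rule uniform_structure_equiv_base)
    show "?B \<noteq> {}" using ne by blast
    fix A A' assume "A \<in> ?B" "A' \<in> ?B"
    then obtain E F where EF: "E \<in> \<E>" "F \<in> \<E>" "A = map_prod f f ` E" "A' = map_prod f f ` F" by blast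
    then obtain D where "D \<in> \<E>" "D \<subseteq> E \<inter> F" using dir by blast
    then show "\<exists>D\<in>?B. D \<subseteq> A \<inter> A'" unfolding EF(3,4) by blast
  qed (use eq in blast)
  have BU: "map_prod f f ` E \<in> U'" if "E \<in> \<E>" for E
    using sub[OF that] that unfolding U'_def by blast
  have U'E: "\<exists>E\<in>\<E>. map_prod f f ` E \<subseteq> W" if "W \<in> U'" for W
    using that unfolding U'_def by simp
  let ?T' = "uniform_topology ?X U'"
  have top': "topspace ?T' = ?X" by (rule topspace_uniform_topology[OF us'])
  have cc: "compatible_cofinite_entourage \<Delta> U' (map_prod f f ` E)" if e: "E \<in> \<E>" for E
  proof -
    note c = compatibleD[OF cceD(2)[OF E[OF e]]]
    have "compatible \<Delta> (map_prod f f ` E)"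
      unfolding compatible_def
    proof (intro conjI ballI impI)
      show "equiv ?X (map_prod f f ` E)" by (rule eq[OF e])
      fix v d assume "v \<in> verts \<Delta>" "d \<in> edges \<Delta>"
      then obtain x y where xy: "x \<in> verts \<Gamma>" "v = f x" "y \<in> edges \<Gamma>" "d = f y"
        unfolding graph_quotientD(2,3)[OF f] by blast
      then show "(v, d) \<notin> map_prod f f ` E"
        using c(2)[OF xy(1,3)] mem[OF e, of x y] by simp
    next
      fix d assume "d \<in> edges \<Delta>"
      then obtain e' where e': "e' \<in> edges \<Gamma>" "d = f e'" by (auto simp: graph_quotientD(3)[OF f])
      then show "(d, bar \<Delta> d) \<notin> map_prod f f ` E"
        using c(7)[OF e'(1)] mem[OF e, of e' "bar \<Gamma> e'"] wf_graphD(3)[OF wf e'(1)] gm(6)[OF e'(1)]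
        by simp
    next
      fix d1 d2 assume d: "d1 \<in> edges \<Delta>" "d2 \<in> edges \<Delta>" "(d1, d2) \<in> map_prod f f ` E"
      then obtain e1 e2 where e12: "e1 \<in> edges \<Gamma>" "d1 = f e1" "e2 \<in> edges \<Gamma>" "d2 = f e2"
        by (auto simp: graph_quotientD(3)[OF f])
      then have r: "(e1, e2) \<in> E" using d(3) mem[OF e, of e1 e2] by simp
      note s = gm(4-6)[OF e12(1), symmetric] gm(4-6)[OF e12(3), symmetric]
      show "(src \<Delta> d1, src \<Delta> d2) \<in> map_prod f f ` E"
        using c(4)[OF e12(1,3) r] unfolding e12(2,4) s by force
      show "(tgt \<Delta> d1, tgt \<Delta> d2) \<in> map_prod f f ` E"
        using c(5)[OF e12(1,3) r] unfolding e12(2,4) s by force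
      show "(bar \<Delta> d1, bar \<Delta> d2) \<in> map_prod f f ` E"
        using c(6)[OF e12(1,3) r] unfolding e12(2,4) s by force
    qed
    moreover have "finite (?X // (map_prod f f ` E))"
    proof (rule finite_subset)
      show "finite ((\<lambda>C. f ` C) ` (elems \<Gamma> // E))" using cceD(4)[OF E[OF e]] by simp
      show "?X // (map_prod f f ` E) \<subseteq> (\<lambda>C. f ` C) ` (elems \<Gamma> // E)"
      proof
        fix C assume "C \<in> ?X // (map_prod f f ` E)"
        then obtain x where x: "x \<in> elems \<Gamma>" "C = (map_prod f f ` E) `` {f x}"
          unfolding X by (auto elim!: quotientE)
        \<comment> \<open>Classes of the image relation are images of classes, so there are only
          finitely many.\<close>
        have "C = f ` (E `` {x})"
        proof
          show "f ` (E `` {x}) \<subseteq> C" unfolding x(2) by force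
          show "C \<subseteq> f ` (E `` {x})"
          proof
            fix c assume c: "c \<in> C"
            then obtain y where y: "y \<in> elems \<Gamma>" "c = f y" using sub[OF e] x(2) X by blast
            have "(f x, f y) \<in> map_prod f f ` E" using c unfolding x(2) y(2) by simp
            then have "(x, y) \<in> E" using mem[OF e x(1) y(1)] by simp
            then show "c \<in> f ` (E `` {x})" using y(2) by blast
          qed
        qed
        then show "C \<in> (\<lambda>C. f ` C) ` (elems \<Gamma> // E)" using x(1) by (auto intro: quotientI)
      qed
    qed
    ultimately show ?thesis
      unfolding compatible_cofinite_entourage_def using BU[OF e] by blast
  qed
  have haus: "Hausdorff_space ?T'"
    unfolding Hausdorff_space_def
  proof (intro allI impI)
    fix a b assume ab: "a \<in> topspace ?T' \<and> b \<in> topspace ?T' \<and> a \<noteq> b"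
    then have "a \<in> f ` elems \<Gamma>" "b \<in> f ` elems \<Gamma>" using top' X by simp_all
    then obtain x y where xy: "x \<in> elems \<Gamma>" "y \<in> elems \<Gamma>" "a = f x" "b = f y" by blast
    then obtain E where e: "E \<in> \<E>" "(x, y) \<notin> E" using sep[of x y] ab by blast
    let ?E = "map_prod f f ` E"
    have n: "(a, b) \<notin> ?E" using e(2) mem[OF e(1) xy(1,2)] xy(3,4) by simp
    show "\<exists>V W. openin ?T' V \<and> openin ?T' W \<and> a \<in> V \<and> b \<in> W \<and> disjnt V W"
    proof (intro exI conjI)
      show "openin ?T' (?E `` {a})" "openin ?T' (?E `` {b})"
        by (rule openin_equiv_class[OF us' BU[OF e(1)] eq[OF e(1)]])+
      show "a \<in> ?E `` {a}" "b \<in> ?E `` {b}"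
        using mem[OF e(1) xy(1) xy(1)] mem[OF e(1) xy(2) xy(2)] cceD(6)[OF E[OF e(1)]] xy by simp_all
      show "disjnt (?E `` {a}) (?E `` {b})"
        unfolding disjnt_def using quotient_disj[OF eq[OF e(1)] quotientI quotientI, of a b]
          eq_equiv_class_iff[OF eq[OF e(1)], of a b] n ab top' by simp
    qed
  qed
  let ?Q = "quotient_topology T f"
  have qm: "quotient_map T ?Q f" by (rule quotient_map_quotient_topology)
  have topQ: "topspace ?Q = ?X" using quotient_imp_surjective_map[OF qm] X by simp
  have compQ: "compact_space ?Q"
    using image_compactin[OF compact[unfolded compact_space_def] quotient_imp_continuous_map[OF qm]]
      topQ X by (simp add: compact_space_def)
  have id: "continuous_map ?Q ?T' (\<lambda>x. x)"
    unfolding continuous_map topQ top'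
  proof (intro conjI allI impI)
    fix V assume V: "openin ?T' V"
    then have VX: "V \<subseteq> ?X" using openin_subset top' by blast
    have "openin T {x \<in> elems \<Gamma>. f x \<in> V}"
      unfolding openin_uniform_topology[OF us]
    proof (intro conjI ballI)
      fix x assume x: "x \<in> {x \<in> elems \<Gamma>. f x \<in> V}"
      then obtain W where "W \<in> U'" "W `` {f x} \<subseteq> V"
        using V unfolding openin_uniform_topology[OF us'] by blast
      then obtain E where e: "E \<in> \<E>" "(map_prod f f ` E) `` {f x} \<subseteq> V"
        using U'E[of W] by (meson Image_mono order_refl order_trans)
      have "E `` {x} \<subseteq> {x \<in> elems \<Gamma>. f x \<in> V}"
      proof
        fix y assume "y \<in> E `` {x}"
        then have y: "(x, y) \<in> E" by blast
        then have xy: "x \<in> elems \<Gamma>" "y \<in> elems \<Gamma>" using cceD(5)[OF E[OF e(1)]] by auto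
        then have "f y \<in> (map_prod f f ` E) `` {f x}" using mem[OF e(1) xy] y by simp
        then show "y \<in> {x \<in> elems \<Gamma>. f x \<in> V}" using subsetD[OF e(2)] xy(2) by simp
      qed
      then show "\<exists>W\<in>U. W `` {x} \<subseteq> {x \<in> elems \<Gamma>. f x \<in> V}" using cceD(1)[OF E[OF e(1)]] by blast
    qed blast
    then have "openin ?Q V" using VX X by (simp add: openin_quotient_topology)
    moreover have "{x \<in> ?X. x \<in> V} = V" using VX by blast
    ultimately show "openin ?Q {x \<in> ?X. x \<in> V}" by simp
  qed simp
  have "homeomorphic_map ?Q ?T' (\<lambda>x. x)"
    by (rule continuous_imp_homeomorphic_map[OF id compQ haus]) (simp_all add: topQ top')
  then have Q: "?T' = ?Q"
    using homeomorphic_map_openness_eq[of ?Q ?T' "\<lambda>x. x"] openin_subset[of ?Q] openin_subset[of ?T']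
    by (simp add: topology_eq topQ top') meson
  have "profinite_graph \<Delta> U'"
    unfolding profinite_graph_def cofinite_graph_def
  proof (intro conjI ballI)
    show "compact_space (uniform_topology (elems \<Delta>) U')" unfolding Q by (rule compQ)
    fix W assume "W \<in> U'"
    then show "\<exists>R. compatible_cofinite_entourage \<Delta> U' R \<and> R \<subseteq> W" using U'E[of W] cc by meson
  qed (use wf\<Delta> us' haus in auto)
  then show ?thesis using that[OF _ Q BU] by simp
qed

end

text \<open>The identity and composition laws are checked on elements that come from \<Gamma>, where
  both sides are values of the same projection.\<close>

lemma inverse_system_of_quotients:
  assumes wf: "wf_graph \<Gamma>" and I: "directed_set I leq"
    and q: "\<And>i. i \<in> I \<Longrightarrow> graph_quotient \<Gamma> (X i) (p i)" "\<And>i. i \<in> I \<Longrightarrow> wf_graph (X i)"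
    and \<phi>: "\<And>i j x. i \<in> I \<Longrightarrow> j \<in> I \<Longrightarrow> leq i j \<Longrightarrow> x \<in> elems \<Gamma> \<Longrightarrow> \<phi> i j (p j x) = p i x"
  shows "inverse_system I leq X (\<lambda>i. discrete_topology (elems (X i))) \<phi>"
  unfolding inverse_system_def
proof (intro conjI ballI impI)
  fix i j assume ij: "i \<in> I" "j \<in> I" "leq i j"
  show gm: "graph_map (X j) (X i) (\<phi> i j)"
    using graph_quotient_factor[OF wf q(1)[OF ij(2)] graph_quotientD(1)[OF q(1)[OF ij(1)]]] \<phi>[OF ij]
    by blast
  show "continuous_map (discrete_topology (elems (X j))) (discrete_topology (elems (X i))) (\<phi> i j)"
    using graph_mapD(3)[OF gm] by (simp add: Pi_iff)
next
  fix i x assume i: "i \<in> I" and x: "x \<in> elems (X i)"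
  then obtain y where "y \<in> elems \<Gamma>" "x = p i y" using graph_quotientD(4)[OF q(1)] by blast
  then show "\<phi> i i x = x" using \<phi>[OF i i directed_setD(2)[OF I i]] by simp
next
  fix i j k x assume ijk: "i \<in> I" "j \<in> I" "k \<in> I" "leq i j \<and> leq j k" and x: "x \<in> elems (X k)"
  then obtain y where y: "y \<in> elems \<Gamma>" "x = p k y" using graph_quotientD(4)[OF q(1)] by blast
  have "leq i k" using directed_setD(3)[OF I ijk(1-3)] ijk(4) by blast
  then show "\<phi> i j (\<phi> j k x) = \<phi> i k x" using \<phi> ijk y by simp
qed (use I q(2) in auto)

text \<open>Numbering the classes turns a finite quotient into a graph on \<open>nat\<close>, the
  type that \<open>regular_covering\<close> requires of the finite graphs.\<close>

lemma finite_quotient_code: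
  assumes E: "equiv X E" and fin: "finite (X // E)"
  shows "\<exists>c :: 'a \<Rightarrow> nat. kernel_on X c = E"
proof -
  obtain h :: "'a set \<Rightarrow> nat" where h: "inj_on h (X // E)"
    using finite_imp_inj_to_nat_seg[OF fin] by blast
  have "(x, y) \<in> kernel_on X (\<lambda>x. h (E `` {x})) \<longleftrightarrow> (x, y) \<in> E" for x y
  proof -
    have "x \<in> X \<and> y \<in> X" if "(x, y) \<in> E" using that E by (auto simp: equiv_def)
    moreover have "h (E `` {x}) = h (E `` {y}) \<longleftrightarrow> (x, y) \<in> E" if "x \<in> X" "y \<in> X"
      using inj_on_eq_iff[OF h quotientI[OF that(1)] quotientI[OF that(2)]]
        eq_equiv_class_iff[OF E that] by simp
    ultimately show ?thesis by (auto simp: kernel_on_iff)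
  qed
  then have "kernel_on X (\<lambda>x. h (E `` {x})) = E" by auto
  then show ?thesis by blast
qed

subsection \<open>The finite quotients of a residually free action\<close>

locale residually_free_action = profinite \<Gamma> U
  for \<Gamma> :: "'a graph" and U :: "('a \<times> 'a) set set" +
  fixes G :: "('g, 'm) monoid_scheme" (structure) and TG :: "'g topology" and \<phi> :: "'g \<Rightarrow> 'a \<Rightarrow> 'a"
  assumes profinite_group: "profinite_group G TG"
    and connected: "connected_cofinite_graph \<Gamma> U"
    and graph_action: "graph_action G \<Gamma> \<phi>"
    and continuous_action: "continuous_action TG T \<phi>"
    and residually_free: "residually_free G \<Gamma> U \<phi>"
    and no_inversions: "without_edge_inversions G \<Gamma> \<phi>"
begin

sublocale group_action G "elems \<Gamma>" \<phi>
  using graph_action by (simp add: graph_action_def)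

sublocale group G
  using group_hom by (simp add: group_hom_def)

abbreviation f :: "'a \<Rightarrow> 'a set" where "f \<equiv> orbit G \<phi>"

lemma topspace_TG [simp]: "topspace TG = carrier G"
  and compact_TG: "compact_space TG"
  using profinite_group by (auto simp: profinite_group_def topological_group_def)

lemma act_graph_map: "g \<in> carrier G \<Longrightarrow> graph_map \<Gamma> \<Gamma> (\<phi> g)"
  using graph_action by (simp add: graph_action_def)

lemmas act_simps = graph_mapD[OF act_graph_map]

lemma act_closed [simp]: "g \<in> carrier G \<Longrightarrow> x \<in> elems \<Gamma> \<Longrightarrow> \<phi> g x \<in> elems \<Gamma>"
  by (rule act_simps(3))

lemma act_mult: "g \<in> carrier G \<Longrightarrow> h \<in> carrier G \<Longrightarrow> x \<in> elems \<Gamma> \<Longrightarrow> \<phi> (g \<otimes> h) x = \<phi> g (\<phi> h x)"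
  by (simp add: composition_rule)

lemma act_one [simp]: "x \<in> elems \<Gamma> \<Longrightarrow> \<phi> \<one> x = x"
  using id_eq_one by (metis restrict_apply')

lemma act_inv [simp]:
  assumes "g \<in> carrier G" "x \<in> elems \<Gamma>"
  shows "\<phi> (inv g) (\<phi> g x) = x" "\<phi> g (\<phi> (inv g) x) = x"
  using assms act_mult[of "inv g" g x] act_mult[of g "inv g" x] by simp_all

lemma orbit_eq_iff:
  assumes "x \<in> elems \<Gamma>" "y \<in> elems \<Gamma>"
  shows "f x = f y \<longleftrightarrow> (\<exists>g\<in>carrier G. \<phi> g x = y)"
proof
  assume "f x = f y"
  then have "y \<in> f x" using orbit_refl[OF assms(2)] by simp
  then show "\<exists>g\<in>carrier G. \<phi> g x = y" by (auto simp: orbit_def)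
next
  assume "\<exists>g\<in>carrier G. \<phi> g x = y"
  then obtain g where g: "g \<in> carrier G" "y = \<phi> g x" by blast
  have "\<phi> h x = \<phi> (h \<otimes> inv g) y" if "h \<in> carrier G" for h
    using that g assms act_mult[of h "inv g" y] by simp
  moreover have "\<phi> h y = \<phi> (h \<otimes> g) x" if "h \<in> carrier G" for h
    using that g assms act_mult[of h g x] by simp
  ultimately show "f x = f y"
    unfolding orbit_def using g(1) m_closed inv_closed by (intro Collect_cong iffI) (elim exE conjE; metis)+
qed

lemma f_act: "g \<in> carrier G \<Longrightarrow> x \<in> elems \<Gamma> \<Longrightarrow> f (\<phi> g x) = f x"
  using orbit_eq_iff[of x "\<phi> g x"] by auto

lemma graph_quotient_orbit: "graph_quotient \<Gamma> (orbit_graph G \<Gamma> \<phi>) f"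
proof -
  have "f (s e) = s ` f e" if "e \<in> edges \<Gamma>" "s \<in> {src \<Gamma>, tgt \<Gamma>, bar \<Gamma>}" for s e
  proof -
    have "\<phi> g (s e) = s (\<phi> g e)" if "g \<in> carrier G" for g
      using act_simps(4-6)[OF that \<open>e \<in> edges \<Gamma>\<close>] \<open>s \<in> {src \<Gamma>, tgt \<Gamma>, bar \<Gamma>}\<close> by auto
    then show ?thesis by (simp add: orbit_def setcompr_eq_image image_image)
  qed
  then show ?thesis
    unfolding graph_quotient_def graph_map_def orbit_graph_def orbits_def by auto
qed

text \<open>The absence of edge inversions enters here for \<Gamma> itself: no edge lies in the
  orbit of its reverse.\<close>

lemma compatible_orbit_kernel: "compatible \<Gamma> (kernel_on (elems \<Gamma>) f)"
  unfolding compatible_def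
proof (intro conjI ballI impI)
  show "equiv (elems \<Gamma>) (kernel_on (elems \<Gamma>) f)" by (rule equiv_kernel_on)
  fix v e assume "v \<in> verts \<Gamma>" "e \<in> edges \<Gamma>"
  then show "(v, e) \<notin> kernel_on (elems \<Gamma>) f"
    using orbit_eq_iff[of v e] act_simps(1) wf_graph_disjoint[OF wf] by (auto simp: kernel_on_iff)
next
  fix e assume "e \<in> edges \<Gamma>"
  then show "(e, bar \<Gamma> e) \<notin> kernel_on (elems \<Gamma>) f"
    using orbit_eq_iff[of e "bar \<Gamma> e"] no_inversions
    by (auto simp: kernel_on_iff without_edge_inversions_def)
next
  fix e1 e2 assume e: "e1 \<in> edges \<Gamma>" "e2 \<in> edges \<Gamma>" "(e1, e2) \<in> kernel_on (elems \<Gamma>) f"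
  then obtain g where g: "g \<in> carrier G" "\<phi> g e1 = e2"
    using orbit_eq_iff[of e1 e2] by (auto simp: kernel_on_iff)
  note s = act_simps(4-6)[OF g(1) e(1), unfolded g(2), symmetric]
  show "(src \<Gamma> e1, src \<Gamma> e2) \<in> kernel_on (elems \<Gamma>) f"
    "(tgt \<Gamma> e1, tgt \<Gamma> e2) \<in> kernel_on (elems \<Gamma>) f"
    "(bar \<Gamma> e1, bar \<Gamma> e2) \<in> kernel_on (elems \<Gamma>) f"
    using e wf_graphD[OF wf] g(1) by (simp_all add: kernel_on_iff s f_act)
qed

lemma wf_orbit_graph: "wf_graph (orbit_graph G \<Gamma> \<phi>)"
  by (rule graph_quotient_wf[OF wf graph_quotient_orbit compatible_orbit_kernel])

section \<open>Continuity of the action and inversions modulo an entourage\<close>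

lemma continuous_act_left: "x \<in> elems \<Gamma> \<Longrightarrow> continuous_map TG T (\<lambda>g. \<phi> g x)"
proof -
  assume "x \<in> elems \<Gamma>"
  then have "continuous_map TG (prod_topology TG T) (\<lambda>g. (g, x))"
    by (intro continuous_map_pairedI) auto
  from continuous_map_compose[OF this continuous_action[unfolded continuous_action_def]]
  show ?thesis by (simp add: comp_def)
qed

lemma continuous_act_right: "g \<in> carrier G \<Longrightarrow> continuous_map T T (\<phi> g)"
proof -
  assume "g \<in> carrier G"
  then have "continuous_map T (prod_topology TG T) (\<lambda>x. (g, x))"
    by (intro continuous_map_pairedI) auto
  from continuous_map_compose[OF this continuous_action[unfolded continuous_action_def]]
  show ?thesis by (simp add: comp_def)
qed

text \<open>That no group element inverts an edge of \<Gamma> does not prevent it from inverting a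
  class of edges modulo a coarse relation. Each point of the product of G and \<Gamma> has a
  neighbourhood on which one relation excludes this; compactness leaves finitely many such
  relations, and their intersection excludes it everywhere.\<close>

lemma entourage_without_inversions:
  "\<exists>W\<in>U. \<forall>g\<in>carrier G. \<forall>e\<in>edges \<Gamma>. (\<phi> g e, bar \<Gamma> e) \<notin> W"
proof -
  let ?P = "prod_topology TG T"
  have "\<exists>R. compatible_cofinite_entourage \<Gamma> U R \<and>
      (\<forall>h y. h \<in> carrier G \<and> y \<in> edges \<Gamma> \<and> (\<phi> g x, \<phi> h y) \<in> R \<and> (x, y) \<in> R \<longrightarrow> (\<phi> h y, bar \<Gamma> y) \<notin> R)"
    if g: "g \<in> carrier G" and x: "x \<in> elems \<Gamma>" for g x
  proof (cases "x \<in> edges \<Gamma>")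
    case True
    then have "\<phi> g x \<noteq> bar \<Gamma> x" "bar \<Gamma> x \<in> elems \<Gamma>"
      using g no_inversions wf_graphD[OF wf] by (auto simp: without_edge_inversions_def)
    then obtain W where "W \<in> U" "(\<phi> g x, bar \<Gamma> x) \<notin> W" using separated g x by (meson act_closed)
    then obtain R where R: "compatible_cofinite_entourage \<Gamma> U R" "(\<phi> g x, bar \<Gamma> x) \<notin> R"
      using refine by blast
    \<comment> \<open>Otherwise the chain \<open>\<phi> g x\<close>, \<open>\<phi> h y\<close>,
      \<open>bar y\<close>, \<open>bar x\<close> would relate \<open>\<phi> g x\<close> to
      \<open>bar x\<close>.\<close>
    have "(\<phi> h y, bar \<Gamma> y) \<notin> R" if "y \<in> edges \<Gamma>" "(\<phi> g x, \<phi> h y) \<in> R" "(x, y) \<in> R" for h y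
    proof
      assume "(\<phi> h y, bar \<Gamma> y) \<in> R"
      then have "(\<phi> g x, bar \<Gamma> y) \<in> R" by (rule cceD(8)[OF R(1) that(2)])
      moreover have "(bar \<Gamma> y, bar \<Gamma> x) \<in> R"
        using compatibleD(6)[OF cceD(2)[OF R(1)] that(1) True cceD(7)[OF R(1) that(3)]] .
      ultimately show False using R(2) cceD(8)[OF R(1)] by blast
    qed
    then show ?thesis using R(1) by blast
  next
    case False
    obtain R where R: "compatible_cofinite_entourage \<Gamma> U R"
      using refine uniform_structureD(1)[OF us] by blast
    \<comment> \<open>Away from edges there is nothing to exclude: a compatible relation relates a
      vertex to vertices only.\<close>
    have "y \<notin> edges \<Gamma>" if "(x, y) \<in> R" for y
      using compatible_edge_iff(1)[OF cceD(2)[OF R] that] False by simp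
    then show ?thesis using R by blast
  qed
  then obtain R where R: "\<And>g x. g \<in> carrier G \<Longrightarrow> x \<in> elems \<Gamma> \<Longrightarrow> compatible_cofinite_entourage \<Gamma> U (R g x)"
    "\<And>g x h y. g \<in> carrier G \<Longrightarrow> x \<in> elems \<Gamma> \<Longrightarrow> h \<in> carrier G \<Longrightarrow> y \<in> edges \<Gamma> \<Longrightarrow>
       (\<phi> g x, \<phi> h y) \<in> R g x \<Longrightarrow> (x, y) \<in> R g x \<Longrightarrow> (\<phi> h y, bar \<Gamma> y) \<notin> R g x"
    by metis
  define V where "V g x = {z \<in> topspace ?P. (case z of (h, y) \<Rightarrow> \<phi> h y) \<in> R g x `` {\<phi> g x}} \<inter>
    {z \<in> topspace ?P. snd z \<in> R g x `` {x}}" for g x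
  have V: "openin ?P (V g x)" if "g \<in> carrier G" "x \<in> elems \<Gamma>" for g x
    unfolding V_def
    using openin_equiv_class[OF us cceD(1,3)[OF R(1)[OF that]]]
    by (intro openin_Int openin_continuous_map_preimage[OF continuous_action[unfolded continuous_action_def]]
      openin_continuous_map_preimage[OF continuous_map_snd])
  let ?I = "carrier G \<times> elems \<Gamma>" and ?V = "\<lambda>z. V (fst z) (snd z)"
  have "compact_space ?P" using compact_TG compact by (simp add: compact_space_prod_topology)
  moreover have "\<forall>W\<in>?V ` ?I. openin ?P W" using V by auto
  moreover have "topspace ?P \<subseteq> \<Union>(?V ` ?I)"
  proof
    fix z assume z: "z \<in> topspace ?P"
    then have "fst z \<in> carrier G" "snd z \<in> elems \<Gamma>" by auto
    then have "z \<in> ?V z" using z cceD(6)[OF R(1)] by (auto simp: V_def)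
    moreover have "z \<in> ?I" using z by simp
    ultimately show "z \<in> \<Union>(?V ` ?I)" by blast
  qed
  ultimately obtain \<F> where \<F>: "finite \<F>" "\<F> \<subseteq> ?V ` ?I" "topspace ?P \<subseteq> \<Union>\<F>"
    unfolding compact_space_alt by meson
  then obtain A where A: "A \<subseteq> ?I" "finite A" "topspace ?P \<subseteq> \<Union>(?V ` A)"
    using finite_subset_image[OF \<F>(1,2)] by blast
  obtain W0 where W0: "W0 \<in> U" using uniform_structureD(1)[OF us] by blast
  let ?R = "\<lambda>z. R (fst z) (snd z)"
  \<comment> \<open>\<open>W0\<close> guards against an empty subfamily, whose intersection would be
    \<open>UNIV\<close>.\<close>
  let ?W = "\<Inter>(insert W0 (?R ` A))"
  have "?W \<in> U"
    using A W0 R(1) cceD(1) by (intro Inter_finite_entourages) auto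
  moreover have "(\<phi> h y, bar \<Gamma> y) \<notin> ?W" if "h \<in> carrier G" "y \<in> edges \<Gamma>" for h y
  proof -
    have "(h, y) \<in> topspace ?P" using that by simp
    then obtain g x where gx: "(g, x) \<in> A" "(h, y) \<in> V g x" using A(3) by fastforce
    then have "g \<in> carrier G" "x \<in> elems \<Gamma>" "(\<phi> g x, \<phi> h y) \<in> R g x" "(x, y) \<in> R g x"
      using A(1) by (auto simp: V_def)
    then have "(\<phi> h y, bar \<Gamma> y) \<notin> R g x" using R(2) that by blast
    then show ?thesis using gx(1) by force
  qed
  ultimately show ?thesis by blast
qed

text \<open>The third condition is freeness of G modulo the class kernel, said without cosets: an
  element that fixes one class fixes all. The fourth forbids inversions in \<Gamma>/R, as required
  for the compatibility of \<open>orbit_rel R\<close>.\<close>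

definition \<R> :: "('a \<times> 'a) set set" where
  "\<R> = {R. compatible_cofinite_entourage \<Gamma> U R \<and> invariant_relation G \<phi> R \<and>
     (\<forall>g\<in>carrier G. \<forall>x\<in>elems \<Gamma>. (\<phi> g x, x) \<in> R \<longrightarrow> (\<forall>y\<in>elems \<Gamma>. (\<phi> g y, y) \<in> R)) \<and>
     (\<forall>g\<in>carrier G. \<forall>e\<in>edges \<Gamma>. (\<phi> g e, bar \<Gamma> e) \<notin> R)}"

lemma invariant_relationD:
  assumes "invariant_relation G \<phi> R" "g \<in> carrier G" "(x, y) \<in> R"
  shows "(\<phi> g x, \<phi> g y) \<in> R"
proof -
  have "map_prod (\<phi> g) (\<phi> g) (x, y) \<in> map_prod (\<phi> g) (\<phi> g) ` R" using assms(3) by (rule imageI)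
  then show ?thesis using assms(1,2) by (simp add: invariant_relation_def)
qed

lemma \<R>D:
  assumes "R \<in> \<R>"
  shows "compatible_cofinite_entourage \<Gamma> U R" "invariant_relation G \<phi> R"
    "g \<in> carrier G \<Longrightarrow> (x, y) \<in> R \<Longrightarrow> (\<phi> g x, \<phi> g y) \<in> R"
    "g \<in> carrier G \<Longrightarrow> x \<in> elems \<Gamma> \<Longrightarrow> (\<phi> g x, x) \<in> R \<Longrightarrow> y \<in> elems \<Gamma> \<Longrightarrow> (\<phi> g y, y) \<in> R"
    "g \<in> carrier G \<Longrightarrow> e \<in> edges \<Gamma> \<Longrightarrow> (\<phi> g e, bar \<Gamma> e) \<notin> R"
proof -
  show i: "invariant_relation G \<phi> R" using assms by (simp add: \<R>_def)
  then show "g \<in> carrier G \<Longrightarrow> (x, y) \<in> R \<Longrightarrow> (\<phi> g x, \<phi> g y) \<in> R" by (rule invariant_relationD)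
qed (use assms in \<open>auto simp: \<R>_def\<close>)

lemma class_action_class:
  assumes R: "equiv (elems \<Gamma>) R" "invariant_relation G \<phi> R" and g: "g \<in> carrier G" and x: "x \<in> elems \<Gamma>"
  shows "class_action \<phi> R g (R `` {x}) = R `` {\<phi> g x}"
proof
  have x': "(x, x) \<in> R" using R(1) x by (auto simp: equiv_def refl_on_def)
  show "R `` {\<phi> g x} \<subseteq> class_action \<phi> R g (R `` {x})"
    using x' unfolding class_action_def by blast
  show "class_action \<phi> R g (R `` {x}) \<subseteq> R `` {\<phi> g x}"
    using invariant_relationD[OF R(2) g, of x] R(1) unfolding class_action_def equiv_def
    by (auto dest: transD)
qed

text \<open>A relation given by residual freeness is in \<open>\<R>\<close> if it also lies inside
  an entourage that excludes inversions. Freeness for cosets becomes freeness for elements: if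
  \<open>g\<close> fixes a class, so does the whole coset of \<open>g\<close>, hence that coset is
  the kernel.\<close>

lemma fundamental_system_\<R>:
  assumes W: "W \<in> U"
  shows "\<exists>R\<in>\<R>. R \<subseteq> W"
proof -
  obtain W' where W': "W' \<in> U" "\<forall>g\<in>carrier G. \<forall>e\<in>edges \<Gamma>. (\<phi> g e, bar \<Gamma> e) \<notin> W'"
    using entourage_without_inversions by blast
  obtain F where F: "fundamental_system U F"
    "\<forall>R\<in>F. compatible_cofinite_entourage \<Gamma> U R \<and> invariant_relation G \<phi> R \<and>
        free_action (G Mod class_kernel G \<Gamma> \<phi> R) (elems \<Gamma> // R) (coset_action \<phi> R)"
    using residually_free unfolding residually_free_def by blast
  obtain R where R: "R \<in> F" "R \<subseteq> W \<inter> W'"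
    using F(1) uniform_structure_Int[OF us W W'(1)] unfolding fundamental_system_def by blast
  let ?N = "class_kernel G \<Gamma> \<phi> R"
  have c: "compatible_cofinite_entourage \<Gamma> U R" and i: "invariant_relation G \<phi> R"
    and fr: "free_action (G Mod ?N) (elems \<Gamma> // R) (coset_action \<phi> R)" using F(2) R(1) by auto
  note act = class_action_class[OF cceD(3)[OF c] i]
  have N: "n \<in> ?N \<longleftrightarrow> n \<in> carrier G \<and> (\<forall>y\<in>elems \<Gamma>. (\<phi> n y, y) \<in> R)" for n
  proof -
    have "(\<forall>C\<in>elems \<Gamma> // R. class_action \<phi> R n C = C) \<longleftrightarrow> (\<forall>y\<in>elems \<Gamma>. (\<phi> n y, y) \<in> R)"
      if n: "n \<in> carrier G"
    proof -
      have "class_action \<phi> R n (R `` {y}) = R `` {y} \<longleftrightarrow> (\<phi> n y, y) \<in> R" if "y \<in> elems \<Gamma>" for y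
        using act[OF n that] eq_equiv_class_iff[OF cceD(3)[OF c] act_closed[OF n that] that] by simp
      then show ?thesis by (auto simp: quotient_def)
    qed
    then show ?thesis unfolding class_kernel_def by blast
  qed
  have one: "\<one> \<in> ?N" using cceD(6)[OF c] by (simp add: N)
  have "(\<phi> g y, y) \<in> R" if g: "g \<in> carrier G" and x: "x \<in> elems \<Gamma>" "(\<phi> g x, x) \<in> R" and y: "y \<in> elems \<Gamma>"
    for g x y
  proof -
    let ?K = "?N #> g"
    have K: "?K \<in> carrier (G Mod ?N)" using g by (auto simp: carrier_FactGroup)
    \<comment> \<open>\<open>k\<close> is \<open>g\<close> followed by an element of the kernel,
      which moves no class.\<close>
    have "class_action \<phi> R k (R `` {x}) = R `` {x}" if k: "k \<in> ?K" for k
    proof -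
      obtain n where n: "n \<in> ?N" "k = n \<otimes> g" using k by (auto simp: r_coset_def)
      then have n': "n \<in> carrier G" "(\<phi> n (\<phi> g x), \<phi> g x) \<in> R" using N g x(1) by auto
      then have "(\<phi> k x, x) \<in> R" using n(2) act_mult[OF n'(1) g x(1)] cceD(8)[OF c _ x(2)] by simp
      then show ?thesis
        using act[of k x] n' n(2) g x(1) eq_equiv_class_iff[OF cceD(3)[OF c], of "\<phi> k x" x] by simp
    qed
    moreover have "g \<in> ?K" using one g by (force simp: r_coset_def)
    ultimately have "coset_action \<phi> R ?K (R `` {x}) = R `` {x}"
      unfolding coset_action_def by blast
    then have "?K = ?N"
      using fr K quotientI[OF x(1)] unfolding free_action_def one_FactGroup by blast
    then have "g \<in> ?N" using \<open>g \<in> ?K\<close> by simp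
    then show ?thesis using N y by blast
  qed
  moreover have "(\<phi> g e, bar \<Gamma> e) \<notin> R" if "g \<in> carrier G" "e \<in> edges \<Gamma>" for g e
    using W'(2) R(2) that by blast
  ultimately have "R \<in> \<R>" unfolding \<R>_def using c i by blast
  then show ?thesis using R(2) by blast
qed

lemma \<R>_nonempty: "\<R> \<noteq> {}"
  using fundamental_system_\<R> uniform_structureD(1)[OF us] by blast

lemma \<R>_Int: "R \<in> \<R> \<Longrightarrow> S \<in> \<R> \<Longrightarrow> \<exists>Q\<in>\<R>. Q \<subseteq> R \<inter> S"
  using fundamental_system_\<R> uniform_structure_Int[OF us] cceD(1)[OF \<R>D(1)] by blast

text \<open>Indices are ordered by reverse inclusion: a smaller relation gives a finer
  quotient.\<close>

lemma \<R>_directed: "directed_set \<R> (\<lambda>R S. S \<subseteq> R)"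
  unfolding directed_set_def using \<R>_nonempty \<R>_Int by (intro conjI) (simp, simp, blast, simp)

lemma \<R>_separates:
  assumes "x \<in> elems \<Gamma>" "y \<in> elems \<Gamma>" "\<And>R. R \<in> \<R> \<Longrightarrow> (x, y) \<in> R"
  shows "x = y"
  using separated[OF assms(1,2)] fundamental_system_\<R> assms(3) by blast

section \<open>The orbit relation thickened by R\<close>

definition orbit_rel :: "('a \<times> 'a) set \<Rightarrow> ('a \<times> 'a) set" where
  "orbit_rel R = {(x, y). x \<in> elems \<Gamma> \<and> y \<in> elems \<Gamma> \<and> (\<exists>g\<in>carrier G. (\<phi> g x, y) \<in> R)}"

lemma orbit_relI: "g \<in> carrier G \<Longrightarrow> x \<in> elems \<Gamma> \<Longrightarrow> y \<in> elems \<Gamma> \<Longrightarrow> (\<phi> g x, y) \<in> R \<Longrightarrow> (x, y) \<in> orbit_rel R"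
  by (auto simp: orbit_rel_def)

lemma orbit_relE:
  assumes "(x, y) \<in> orbit_rel R"
  obtains g where "g \<in> carrier G" "x \<in> elems \<Gamma>" "y \<in> elems \<Gamma>" "(\<phi> g x, y) \<in> R"
  using assms by (auto simp: orbit_rel_def)

lemma orbit_rel_mono: "R \<subseteq> S \<Longrightarrow> orbit_rel R \<subseteq> orbit_rel S"
  by (auto simp: orbit_rel_def)

lemma subset_orbit_rel:
  assumes "R \<in> \<R>"
  shows "R \<subseteq> orbit_rel R"
proof clarify
  fix x y assume xy: "(x, y) \<in> R"
  then have "x \<in> elems \<Gamma>" "y \<in> elems \<Gamma>" using cceD(5)[OF \<R>D(1)[OF assms]] by auto
  then show "(x, y) \<in> orbit_rel R" using orbit_relI[of \<one> x y R] xy by simp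
qed

lemma orbit_kernel_subset:
  assumes "R \<in> \<R>"
  shows "kernel_on (elems \<Gamma>) f \<subseteq> orbit_rel R"
proof clarify
  fix x y assume "(x, y) \<in> kernel_on (elems \<Gamma>) f"
  then have xy: "x \<in> elems \<Gamma>" "y \<in> elems \<Gamma>" "f x = f y" by (auto simp: kernel_on_iff)
  then obtain g where "g \<in> carrier G" "\<phi> g x = y" using orbit_eq_iff by blast
  then show "(x, y) \<in> orbit_rel R"
    using orbit_relI[of g x y R] xy cceD(6)[OF \<R>D(1)[OF assms] xy(2)] by simp
qed

text \<open>Invariance of R lets group elements be moved across a pair, which gives symmetry with
  \<open>inv g\<close> and transitivity with \<open>h \<otimes> g\<close>. An edge equivalent to its
  reverse would be an inversion modulo R. An equivalence relation containing R is again an entourage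
  with finitely many classes.\<close>

lemma orbit_rel_cce:
  assumes R: "R \<in> \<R>"
  shows "compatible_cofinite_entourage \<Gamma> U (orbit_rel R)"
proof -
  note c = cceD[OF \<R>D(1)[OF R]] and r = \<R>D[OF R]
  have sub: "orbit_rel R \<subseteq> elems \<Gamma> \<times> elems \<Gamma>" by (auto simp: orbit_rel_def)
  have eq: "equiv (elems \<Gamma>) (orbit_rel R)"
  proof (rule equivI[OF sub])
    show "refl_on (elems \<Gamma>) (orbit_rel R)"
      using subset_orbit_rel[OF R] c(6) by (auto simp: refl_on_def)
    show "sym (orbit_rel R)"
    proof (rule symI)
      fix x y assume "(x, y) \<in> orbit_rel R"
      then obtain g where g: "g \<in> carrier G" "x \<in> elems \<Gamma>" "y \<in> elems \<Gamma>" "(\<phi> g x, y) \<in> R"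
        by (rule orbit_relE)
      have "(\<phi> (inv g) y, x) \<in> R"
        using r(3)[OF inv_closed[OF g(1)] c(7)[OF g(4)]] g by simp
      then show "(y, x) \<in> orbit_rel R" using orbit_relI[OF inv_closed[OF g(1)] g(3,2)] by blast
    qed
    show "trans (orbit_rel R)"
    proof (rule transI)
      fix x y z assume "(x, y) \<in> orbit_rel R" and yz: "(y, z) \<in> orbit_rel R"
      then obtain g where g: "g \<in> carrier G" "x \<in> elems \<Gamma>" "y \<in> elems \<Gamma>" "(\<phi> g x, y) \<in> R"
        by (elim orbit_relE)
      from yz obtain h where h: "h \<in> carrier G" "z \<in> elems \<Gamma>" "(\<phi> h y, z) \<in> R"
        by (elim orbit_relE)
      have "(\<phi> (h \<otimes> g) x, z) \<in> R"
        using c(8)[OF r(3)[OF h(1) g(4)] h(3)] act_mult[OF h(1) g(1,2)] by simp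
      then show "(x, z) \<in> orbit_rel R" using orbit_relI[OF m_closed[OF h(1) g(1)] g(2) h(2)] by blast
    qed
  qed
  have "compatible \<Gamma> (orbit_rel R)"
    unfolding compatible_def
  proof (intro conjI ballI impI)
    fix v e assume ve: "v \<in> verts \<Gamma>" "e \<in> edges \<Gamma>"
    show "(v, e) \<notin> orbit_rel R"
      using compatibleD(2)[OF c(2) act_simps(1)[OF _ ve(1)] ve(2)] by (auto elim: orbit_relE)
  next
    fix e assume "e \<in> edges \<Gamma>"
    then show "(e, bar \<Gamma> e) \<notin> orbit_rel R" using r(5) by (auto elim: orbit_relE)
  next
    fix e1 e2 assume e: "e1 \<in> edges \<Gamma>" "e2 \<in> edges \<Gamma>" "(e1, e2) \<in> orbit_rel R"
    then obtain g where g: "g \<in> carrier G" "(\<phi> g e1, e2) \<in> R" by (elim orbit_relE)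
    note e1 = act_simps(2)[OF g(1) e(1)] and s = act_simps(4-6)[OF g(1) e(1)]
      and w = wf_graphD(1-3)[OF wf e(1)] wf_graphD(1-3)[OF wf e(2)]
    show "(src \<Gamma> e1, src \<Gamma> e2) \<in> orbit_rel R"
      using compatibleD(4)[OF c(2) e1 e(2) g(2)] w by (intro orbit_relI[OF g(1)]) (simp_all add: s)
    show "(tgt \<Gamma> e1, tgt \<Gamma> e2) \<in> orbit_rel R"
      using compatibleD(5)[OF c(2) e1 e(2) g(2)] w by (intro orbit_relI[OF g(1)]) (simp_all add: s)
    show "(bar \<Gamma> e1, bar \<Gamma> e2) \<in> orbit_rel R"
      using compatibleD(6)[OF c(2) e1 e(2) g(2)] w by (intro orbit_relI[OF g(1)]) (simp_all add: s)
  qed (rule eq)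
  moreover have "finite (elems \<Gamma> // orbit_rel R)"
    by (rule finite_refines_finite[OF c(4) subset_orbit_rel[OF R] c(3) eq])
  moreover have "orbit_rel R \<in> U"
    by (rule uniform_structureD(4)[OF us c(1) subset_orbit_rel[OF R] sub])
  ultimately show ?thesis by (simp add: compatible_cofinite_entourage_def)
qed

text \<open>The orbit of \<open>x\<close> is a continuous image of the compact group, hence closed
  in the Hausdorff space; if it misses \<open>y\<close>, some R in \<open>\<R>\<close> keeps the
  class of \<open>y\<close> away from it, against the hypothesis for that R.\<close>

lemma orbit_rel_separates:
  assumes x: "x \<in> elems \<Gamma>" and y: "y \<in> elems \<Gamma>" and xy: "\<And>R. R \<in> \<R> \<Longrightarrow> (x, y) \<in> orbit_rel R"
  shows "f x = f y"
proof (rule ccontr)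
  assume n: "f x \<noteq> f y"
  let ?O = "(\<lambda>g. \<phi> g x) ` carrier G"
  have "compactin T ?O"
    using image_compactin[OF compact_TG[unfolded compact_space_def] continuous_act_left[OF x]] by simp
  then have "openin T (elems \<Gamma> - ?O)"
    using compactin_imp_closedin[OF Hausdorff] by (simp add: closedin_def)
  moreover have "y \<in> elems \<Gamma> - ?O" using n y orbit_eq_iff[OF x y] by auto
  ultimately obtain W where W: "W \<in> U" "W `` {y} \<subseteq> elems \<Gamma> - ?O"
    unfolding openin_uniform_topology[OF us] by blast
  obtain R where R: "R \<in> \<R>" "R \<subseteq> W" using fundamental_system_\<R>[OF W(1)] by blast
  obtain g where g: "g \<in> carrier G" "(\<phi> g x, y) \<in> R" using xy[OF R(1)] by (elim orbit_relE)
  have "(y, \<phi> g x) \<in> W" using cceD(7)[OF \<R>D(1)[OF R(1)] g(2)] R(2) by blast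
  then show False using W(2) g(1) by blast
qed

end

subsection \<open>The orbit map as a regular covering\<close>

text \<open>The structure maps of \<open>quotient_graph\<close> saturate the image of a class. For a
  compatible relation that image lies in a single class, which any representative
  determines.\<close>

lemma graph_quotient_quotient_graph:
  assumes wf: "wf_graph \<Gamma>" and c: "compatible \<Gamma> R"
  shows "graph_quotient \<Gamma> (quotient_graph \<Gamma> R) (\<lambda>x. R `` {x})"
proof -
  note eq = compatibleD(1)[OF c]
  have cls: "R `` (s ` (R `` {e})) = R `` {s e}"
    if e: "e \<in> edges \<Gamma>" and s: "\<And>d. d \<in> edges \<Gamma> \<Longrightarrow> (e, d) \<in> R \<Longrightarrow> (s e, s d) \<in> R" for s e
  proof -
    have "(e, e) \<in> R" using eq e by (simp add: equiv_def refl_on_def)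
    moreover have "R `` {s d} = R `` {s e}" if "(e, d) \<in> R" for d
    proof -
      have "d \<in> edges \<Gamma>" using compatible_edge_iff(1)[OF c that] e by simp
      then show ?thesis using equiv_class_eq[OF eq s[OF _ that]] by simp
    qed
    ultimately show ?thesis by blast
  qed
  have "R `` (src \<Gamma> ` (R `` {e})) = R `` {src \<Gamma> e}" "R `` (tgt \<Gamma> ` (R `` {e})) = R `` {tgt \<Gamma> e}"
    "R `` (bar \<Gamma> ` (R `` {e})) = R `` {bar \<Gamma> e}" if "e \<in> edges \<Gamma>" for e
    using cls[OF that] compatibleD(4-6)[OF c that] by blast+
  then show ?thesis
    unfolding graph_quotient_def graph_map_def quotient_graph_def by (auto simp: quotient_def)
qed

lemma kernel_on_class_map: "equiv X R \<Longrightarrow> kernel_on X (\<lambda>x. R `` {x}) = R"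
  unfolding kernel_on_def using equiv_class_eq_iff[of X R] by auto

lemma factor_map_kernel:
  assumes "kernel_on X p \<subseteq> kernel_on X q" "x \<in> X"
  shows "factor_map X p q (p x) = q x"
proof (rule factor_map_eq[OF assms(2)])
  fix y z assume "y \<in> X" "z \<in> X" "p y = p z"
  then have "(y, z) \<in> kernel_on X p" by (simp add: kernel_on_iff)
  then have "(y, z) \<in> kernel_on X q" using assms(1) by blast
  then show "q y = q z" by (simp add: kernel_on_iff)
qed

text \<open>Continuity of the operations and total disconnectedness are read off from G through the
  continuous inverse \<open>\<psi>\<close>. This is how the group of covering transformations is
  seen to be profinite.\<close>

lemma profinite_group_transfer:
  assumes G: "profinite_group G TG" and H: "group H"
    and iso: "\<phi> \<in> iso G H" and hom: "homeomorphic_map TG S \<phi>"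
  shows "profinite_group H S"
proof -
  have tg: "group G" "topspace TG = carrier G"
    "continuous_map (prod_topology TG TG) TG (\<lambda>(x, y). x \<otimes>\<^bsub>G\<^esub> y)"
    "continuous_map TG TG (\<lambda>x. inv\<^bsub>G\<^esub> x)"
    and G': "compact_space TG" "Hausdorff_space TG" "\<And>C. connectedin TG C \<Longrightarrow> \<exists>x. C \<subseteq> {x}"
    using G by (auto simp: profinite_group_def topological_group_def)
  interpret group_hom G H \<phi>
    using tg(1) H iso by (simp add: group_hom_def group_hom_axioms_def iso_def)
  obtain \<psi> where "homeomorphic_maps TG S \<phi> \<psi>" using hom unfolding homeomorphic_map_maps by blast
  then have c: "continuous_map TG S \<phi>" "continuous_map S TG \<psi>"
    and \<psi>: "\<And>y. y \<in> topspace S \<Longrightarrow> \<phi> (\<psi> y) = y" by (auto simp: homeomorphic_maps_def)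
  have top: "topspace S = carrier H"
    using homeomorphic_imp_surjective_map[OF hom] iso tg(2) by (auto simp: iso_def bij_betw_def)
  have \<psi>G: "\<psi> y \<in> carrier G" if "y \<in> carrier H" for y
    using continuous_map_image_subset_topspace[OF c(2)] that top tg(2) by auto
  have "continuous_map (prod_topology S S) (prod_topology TG TG) (\<lambda>z. (\<psi> (fst z), \<psi> (snd z)))"
    by (intro continuous_map_pairedI continuous_map_compose[OF continuous_map_fst c(2), unfolded comp_def]
      continuous_map_compose[OF continuous_map_snd c(2), unfolded comp_def])
  from continuous_map_compose[OF continuous_map_compose[OF this tg(3)] c(1)]
  have "continuous_map (prod_topology S S) S (\<lambda>(x, y). x \<otimes>\<^bsub>H\<^esub> y)"
    by (rule continuous_map_eq) (auto simp: top \<psi>G \<psi>)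
  moreover from continuous_map_compose[OF continuous_map_compose[OF c(2) tg(4)] c(1)]
  have "continuous_map S S (\<lambda>x. inv\<^bsub>H\<^esub> x)"
    by (rule continuous_map_eq) (auto simp: top \<psi>G \<psi>)
  moreover have "\<exists>x. C \<subseteq> {x}" if C: "connectedin S C" for C
  proof -
    obtain x where x: "\<psi> ` C \<subseteq> {x}" using G'(3)[OF connectedin_continuous_map_image[OF c(2) C]] by blast
    have "y = \<phi> x" if "y \<in> C" for y
    proof -
      have "y \<in> topspace S" using connectedin_subset_topspace[OF C] that by blast
      then show ?thesis using \<psi>[of y] x that by auto
    qed
    then show ?thesis by blast
  qed
  moreover have "TG homeomorphic_space S" using hom homeomorphic_space by blast
  then have "compact_space S" "Hausdorff_space S"
    using homeomorphic_compact_space homeomorphic_Hausdorff_space G'(1,2) by auto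
  ultimately show ?thesis
    unfolding profinite_group_def topological_group_def using H top by simp
qed

section \<open>Finite regular coverings between the quotients\<close>

context residually_free_action
begin

text \<open>Connectedness is given for the graph of classes; the factor map carries paths from there
  to any other graph with the same kernel.\<close>

lemma path_connected_quotient:
  assumes R: "compatible_cofinite_entourage \<Gamma> U R"
    and p: "graph_quotient \<Gamma> \<Delta> p" "kernel_on (elems \<Gamma>) p = R"
  shows "path_connected_graph \<Delta>"
proof -
  let ?Q = "quotient_graph \<Gamma> R" and ?k = "\<lambda>x. R `` {x}"
  note q = graph_quotient_quotient_graph[OF wf cceD(2)[OF R]]
  have k: "kernel_on (elems \<Gamma>) ?k = R" by (rule kernel_on_class_map[OF cceD(3)[OF R]])
  have wfQ: "wf_graph ?Q" by (rule graph_quotient_wf[OF wf q]) (simp add: k cceD(2)[OF R])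
  have "p x = p y" if "x \<in> elems \<Gamma>" "y \<in> elems \<Gamma>" "?k x = ?k y" for x y
  proof -
    have "(x, y) \<in> kernel_on (elems \<Gamma>) ?k" using that by (simp add: kernel_on_iff)
    then show ?thesis using k p(2) kernel_on_iff by metis
  qed
  then have "factor_map (elems \<Gamma>) ?k p (?k x) = p x" if "x \<in> elems \<Gamma>" for x
    using factor_map_eq[of x "elems \<Gamma>" ?k p] that by blast
  from graph_quotient_comp_factor[OF wf q p(1) this]
  have "graph_quotient ?Q \<Delta> (factor_map (elems \<Gamma>) ?k p)" .
  moreover have "path_connected_graph ?Q" using connected R by (simp add: connected_cofinite_graph_def)
  ultimately show ?thesis by (rule path_connected_graph_image[OF wfQ])
qed

lemma finite_quotient:
  assumes R: "compatible_cofinite_entourage \<Gamma> U R"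
    and p: "graph_quotient \<Gamma> \<Delta> p" "kernel_on (elems \<Gamma>) p = R"
  shows "finite (elems \<Delta>)"
proof -
  have "p x \<in> (\<lambda>C. p (SOME y. y \<in> C)) ` (elems \<Gamma> // R)" if x: "x \<in> elems \<Gamma>" for x
  proof (rule image_eqI)
    have "(x, SOME y. y \<in> R `` {x}) \<in> R"
      using someI[of "\<lambda>y. y \<in> R `` {x}" x] cceD(6)[OF R x] by simp
    then show "p x = p (SOME y. y \<in> R `` {x})" using p(2) kernel_on_iff by metis
  qed (rule quotientI[OF x])
  then have "elems \<Delta> \<subseteq> (\<lambda>C. p (SOME y. y \<in> C)) ` (elems \<Gamma> // R)"
    unfolding graph_quotientD(4)[OF p(1)] by blast
  then show ?thesis using cceD(4)[OF R] finite_subset by blast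
qed

text \<open>Freeness is applied to \<open>inv g \<otimes> k\<close>, which fixes the class of
  \<open>x\<close>. So two translations that agree modulo R at one point agree modulo R everywhere:
  unique lifting in its algebraic form.\<close>

lemma \<R>_free:
  assumes R: "R \<in> \<R>" and g: "g \<in> carrier G" "k \<in> carrier G" and x: "x \<in> elems \<Gamma>"
    and xR: "(\<phi> k x, \<phi> g x) \<in> R" and y: "y \<in> elems \<Gamma>"
  shows "(\<phi> k y, \<phi> g y) \<in> R"
proof -
  let ?h = "inv g \<otimes> k"
  have h: "?h \<in> carrier G" using g by simp
  have "(\<phi> ?h x, x) \<in> R"
    using \<R>D(3)[OF R inv_closed[OF g(1)] xR] g x by (simp add: act_mult)
  then have "(\<phi> ?h y, y) \<in> R" by (rule \<R>D(4)[OF R h x _ y])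
  then have "(\<phi> g (\<phi> ?h y), \<phi> g y) \<in> R" by (rule \<R>D(3)[OF R g(1)])
  then show ?thesis using g y by (simp add: act_mult)
qed

text \<open>Freeness on the classes makes the projection injective on stars: a group element that moves
  a lift of an edge to another one with the same source fixes the class of the source.\<close>

lemma finite_regular_covering_quotients:
  assumes R: "R \<in> \<R>"
    and c: "graph_quotient \<Gamma> X c" "kernel_on (elems \<Gamma>) c = R"
    and d: "graph_quotient \<Gamma> Y d" "kernel_on (elems \<Gamma>) d = orbit_rel R"
    and q: "\<And>x. x \<in> elems \<Gamma> \<Longrightarrow> q (c x) = d x"
  shows "finite_regular_covering X Y q"
proof (rule finite_regular_coveringI)
  note R1 = \<R>D(1)[OF R] and R2 = orbit_rel_cce[OF R]
  note gc = graph_mapD[OF graph_quotientD(1)[OF c(1)]] and gd = graph_mapD[OF graph_quotientD(1)[OF d(1)]]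
  have cR: "c x = c y \<longleftrightarrow> (x, y) \<in> R" and dR: "d x = d y \<longleftrightarrow> (x, y) \<in> orbit_rel R"
    if "x \<in> elems \<Gamma>" "y \<in> elems \<Gamma>" for x y
    using that kernel_on_iff[of x y "elems \<Gamma>"] c(2) d(2) by auto
  show "wf_graph X" by (rule graph_quotient_wf[OF wf c(1)]) (simp add: c(2) cceD(2)[OF R1])
  show "wf_graph Y" by (rule graph_quotient_wf[OF wf d(1)]) (simp add: d(2) cceD(2)[OF R2])
  show "finite (elems X)" by (rule finite_quotient[OF R1 c])
  show "finite (elems Y)" by (rule finite_quotient[OF R2 d])
  show "path_connected_graph X" by (rule path_connected_quotient[OF R1 c])
  show "path_connected_graph Y" by (rule path_connected_quotient[OF R2 d])
  show "graph_map X Y q" by (rule graph_quotient_factor[OF wf c(1) graph_quotientD(1)[OF d(1)] q])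
  show "locally_bijective X Y q"
    unfolding locally_bijective_def
  proof
    fix v assume "v \<in> verts X"
    then obtain x where x: "x \<in> verts \<Gamma>" "v = c x" unfolding graph_quotientD(2)[OF c(1)] by blast
    have lift: "\<exists>e. e \<in> edges \<Gamma> \<and> n = c e \<and> (src \<Gamma> e, x) \<in> R" if "n \<in> edges X" "src X n = v" for n
    proof -
      obtain e where e: "e \<in> edges \<Gamma>" "n = c e" using \<open>n \<in> edges X\<close> unfolding graph_quotientD(3)[OF c(1)] by blast
      then have "c (src \<Gamma> e) = c x" using that(2) gc(4)[OF e(1)] x(2) by simp
      then show ?thesis using e cR wf_graphD(1)[OF wf e(1)] x(1) by auto
    qed
    show "bij_betw q {e \<in> edges X. src X e = v} {e \<in> edges Y. src Y e = q v}"
      unfolding bij_betw_def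
    proof
      show "inj_on q {e \<in> edges X. src X e = v}"
      proof (rule inj_onI)
        fix m n assume m: "m \<in> {e \<in> edges X. src X e = v}" and n: "n \<in> {e \<in> edges X. src X e = v}"
          and mn: "q m = q n"
        obtain e e' where e: "e \<in> edges \<Gamma>" "m = c e" "(src \<Gamma> e, x) \<in> R"
          and e': "e' \<in> edges \<Gamma>" "n = c e'" "(src \<Gamma> e', x) \<in> R" using lift m n by blast
        have "(e, e') \<in> orbit_rel R" using mn e e' q dR by simp
        then obtain g where g: "g \<in> carrier G" "(\<phi> g e, e') \<in> R" by (elim orbit_relE)
        have "(src \<Gamma> (\<phi> g e), src \<Gamma> e') \<in> R"
          by (rule compatibleD(4)[OF cceD(2)[OF R1] act_simps(2)[OF g(1) e(1)] e'(1) g(2)])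
        then have "(\<phi> g (src \<Gamma> e), src \<Gamma> e') \<in> R" by (simp add: act_simps(4)[OF g(1) e(1)])
        moreover have "(src \<Gamma> e', src \<Gamma> e) \<in> R"
          using cceD(8)[OF R1 e'(3) cceD(7)[OF R1 e(3)]] .
        ultimately have "(\<phi> g (src \<Gamma> e), src \<Gamma> e) \<in> R" by (rule cceD(8)[OF R1])
        then have "(\<phi> g e, e) \<in> R"
          using \<R>D(4)[OF R g(1), of "src \<Gamma> e" e] wf_graphD(1)[OF wf e(1)] e(1) by simp
        then have "(e, e') \<in> R" using cceD(7,8)[OF R1] g(2) by blast
        then show "m = n" using e e' cR by simp
      qed
      show "q ` {e \<in> edges X. src X e = v} = {e \<in> edges Y. src Y e = q v}"
      proof
        show "q ` {e \<in> edges X. src X e = v} \<subseteq> {e \<in> edges Y. src Y e = q v}"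
          using graph_mapD(2,4)[OF \<open>graph_map X Y q\<close>] by auto
        show "{e \<in> edges Y. src Y e = q v} \<subseteq> q ` {e \<in> edges X. src X e = v}"
        proof
          fix n assume n: "n \<in> {e \<in> edges Y. src Y e = q v}"
          then obtain e where e: "e \<in> edges \<Gamma>" "n = d e" using graph_quotientD(3)[OF d(1)] by blast
          have se: "src \<Gamma> e \<in> elems \<Gamma>" using wf_graphD(1)[OF wf e(1)] by simp
          have "d (src \<Gamma> e) = d x" using n e gd(4)[OF e(1)] x q by simp
          then have "(src \<Gamma> e, x) \<in> orbit_rel R" using dR se x(1) by simp
          \<comment> \<open>The translate of \<open>e\<close> by \<open>g\<close> has its source in
            the class of \<open>x\<close> and the same image in \<open>Y\<close> as
            \<open>e\<close>.\<close>
          then obtain g where g: "g \<in> carrier G" "(\<phi> g (src \<Gamma> e), x) \<in> R" by (elim orbit_relE)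
          have ge: "\<phi> g e \<in> edges \<Gamma>" by (rule act_simps(2)[OF g(1) e(1)])
          have "src X (c (\<phi> g e)) = c (\<phi> g (src \<Gamma> e))"
            by (simp add: gc(4)[OF ge, symmetric] act_simps(4)[OF g(1) e(1)])
          also have "\<dots> = v" using cR[of "\<phi> g (src \<Gamma> e)" x] g se x by simp
          finally have "c (\<phi> g e) \<in> {e \<in> edges X. src X e = v}" using gc(2)[OF ge] by simp
          moreover have "q (c (\<phi> g e)) = n"
          proof -
            have "(\<phi> g e, e) \<in> orbit_rel R"
              using orbit_relI[of "inv g" "\<phi> g e" e R] g e(1) cceD(6)[OF R1, of e] by simp
            then show ?thesis using q[of "\<phi> g e"] dR[of "\<phi> g e" e] e g by simp
          qed
          ultimately show "n \<in> q ` {e \<in> edges X. src X e = v}" by blast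
        qed
      qed
    qed
  qed
  fix u v assume "u \<in> verts X" "v \<in> verts X" and uv: "q u = q v"
  then obtain x y where x: "x \<in> verts \<Gamma>" "u = c x" and y: "y \<in> verts \<Gamma>" "v = c y"
    unfolding graph_quotientD(2)[OF c(1)] by blast
  then have "(x, y) \<in> orbit_rel R" using uv q dR by simp
  then obtain g where g: "g \<in> carrier G" "(\<phi> g x, y) \<in> R" by (elim orbit_relE)
  \<comment> \<open>The deck transformation that \<open>g\<close> induces on \<open>X\<close>, well
    defined because R is invariant.\<close>
  let ?s = "factor_map (elems \<Gamma>) c (c \<circ> \<phi> g)"
  have s: "?s (c z) = c (\<phi> g z)" if "z \<in> elems \<Gamma>" for z
  proof -
    have "(c \<circ> \<phi> g) a = (c \<circ> \<phi> g) b" if "a \<in> elems \<Gamma>" "b \<in> elems \<Gamma>" "c a = c b" for a b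
      using that cR \<R>D(3)[OF R g(1)] g(1) by simp
    then have "?s (c z) = (c \<circ> \<phi> g) z" using factor_map_eq[of z "elems \<Gamma>" c "c \<circ> \<phi> g"] that by blast
    then show ?thesis by simp
  qed
  have "graph_map \<Gamma> X (c \<circ> \<phi> g)"
    using act_simps[OF g(1)] gc unfolding graph_map_def by auto
  then have "graph_map X X ?s"
    by (rule graph_quotient_factor[OF wf c(1)]) (simp add: s)
  moreover have "?s u = v" using s[of x] x y g cR[of "\<phi> g x" y] by simp
  moreover have "q (?s n) = q n" if n: "n \<in> elems X" for n
  proof -
    obtain z where z: "z \<in> elems \<Gamma>" "n = c z" using n unfolding graph_quotientD(4)[OF c(1)] by blast
    have "(\<phi> g z, z) \<in> orbit_rel R"
      using orbit_relI[of "inv g" "\<phi> g z" z R] g z(1) cceD(6)[OF R1, of z] by simp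
    then show ?thesis using z s q dR[of "\<phi> g z" z] g by simp
  qed
  ultimately show "\<exists>\<sigma>. graph_map X X \<sigma> \<and> \<sigma> u = v \<and> (\<forall>n\<in>elems X. q (\<sigma> n) = q n)" by blast
qed

text \<open>The last conclusion later makes the projections from the orbit graph to its finite
  quotients continuous.\<close>

lemma orbit_graph_profinite:
  obtains U' where "profinite_graph (orbit_graph G \<Gamma> \<phi>) U'"
    "uniform_topology (elems (orbit_graph G \<Gamma> \<phi>)) U' = quotient_topology T f"
    "\<And>R. R \<in> \<R> \<Longrightarrow> map_prod f f ` orbit_rel R \<in> U'"
proof -
  have ne: "orbit_rel ` \<R> \<noteq> {}" using \<R>_nonempty by blast
  have cce: "compatible_cofinite_entourage \<Gamma> U E" if "E \<in> orbit_rel ` \<R>" for E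
    using that orbit_rel_cce by blast
  have ker: "kernel_on (elems \<Gamma>) f \<subseteq> E" if "E \<in> orbit_rel ` \<R>" for E
    using that orbit_kernel_subset by blast
  have dir: "\<exists>D\<in>orbit_rel ` \<R>. D \<subseteq> E \<inter> F" if "E \<in> orbit_rel ` \<R>" "F \<in> orbit_rel ` \<R>" for E F
  proof -
    obtain R S where R: "R \<in> \<R>" "E = orbit_rel R" and S: "S \<in> \<R>" "F = orbit_rel S"
      using \<open>E \<in> orbit_rel ` \<R>\<close> \<open>F \<in> orbit_rel ` \<R>\<close> by blast
    obtain Q where Q: "Q \<in> \<R>" "Q \<subseteq> R" "Q \<subseteq> S" using \<R>_Int[OF R(1) S(1)] by blast
    show ?thesis
      unfolding R(2) S(2) using orbit_rel_mono[OF Q(2)] orbit_rel_mono[OF Q(3)]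
      by (intro bexI[OF _ imageI[OF Q(1)]] Int_greatest)
  qed
  have sep: "f x = f y" if "x \<in> elems \<Gamma>" "y \<in> elems \<Gamma>" "\<And>E. E \<in> orbit_rel ` \<R> \<Longrightarrow> (x, y) \<in> E" for x y
    by (rule orbit_rel_separates[OF that(1,2)]) (rule that(3)[OF imageI])
  obtain U' where "profinite_graph (orbit_graph G \<Gamma> \<phi>) U'"
    "uniform_topology (elems (orbit_graph G \<Gamma> \<phi>)) U' = quotient_topology T f"
    "\<And>E. E \<in> orbit_rel ` \<R> \<Longrightarrow> map_prod f f ` E \<in> U'"
    using profinite_graph_quotient[OF wf_orbit_graph graph_quotient_orbit ne cce ker dir sep] by blast
  then show ?thesis by (intro that) auto
qed

text \<open>Both systems are indexed by \<open>\<R>\<close>: at R the source projection has kernel R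
  and the target projection has kernel \<open>orbit_rel R\<close>. The maps of the diagram are
  factor maps, obtained from inclusions between these kernels and the kernel of \<open>f\<close>, so
  commutativity is checked on elements coming from \<Gamma>.\<close>

lemma regular_covering_orbit_map:
  "regular_covering \<Gamma> T (orbit_graph G \<Gamma> \<phi>) (quotient_topology T f) f"
proof -
  let ?\<Delta> = "orbit_graph G \<Gamma> \<phi>" and ?leq = "\<lambda>R S :: ('a \<times> 'a) set. S \<subseteq> R"
  obtain U' where U': "profinite_graph ?\<Delta> U'"
    "uniform_topology (elems ?\<Delta>) U' = quotient_topology T f"
    "\<And>R. R \<in> \<R> \<Longrightarrow> map_prod f f ` orbit_rel R \<in> U'" using orbit_graph_profinite by blast
  interpret \<Delta>: profinite ?\<Delta> U' by (rule profinite.intro[OF U'(1)])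
  have "\<exists>c :: 'a \<Rightarrow> nat. kernel_on (elems \<Gamma>) c = R" if "compatible_cofinite_entourage \<Gamma> U R" for R
    using finite_quotient_code[OF cceD(3,4)[OF that]] .
  \<comment> \<open>With the condition under the quantifiers, one choice function numbers the
    classes of every relation and serves R and \<open>orbit_rel R\<close> alike.\<close>
  then have "\<forall>R. \<exists>c :: 'a \<Rightarrow> nat. compatible_cofinite_entourage \<Gamma> U R \<longrightarrow> kernel_on (elems \<Gamma>) c = R" by blast
  then obtain c :: "('a \<times> 'a) set \<Rightarrow> 'a \<Rightarrow> nat" where
    code: "\<And>R. compatible_cofinite_entourage \<Gamma> U R \<Longrightarrow> kernel_on (elems \<Gamma>) (c R) = R" by metis
  define d where "d R = c (orbit_rel R)" for R
  have c: "kernel_on (elems \<Gamma>) (c R) = R" and d: "kernel_on (elems \<Gamma>) (d R) = orbit_rel R"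
    if "R \<in> \<R>" for R
    using code \<R>D(1)[OF that] orbit_rel_cce[OF that] by (auto simp: d_def)
  define X where "X R = image_graph \<Gamma> (c R)" for R
  define Y where "Y R = image_graph \<Gamma> (d R)" for R
  have X: "graph_quotient \<Gamma> (X R) (c R)" and Y: "graph_quotient \<Gamma> (Y R) (d R)" if "R \<in> \<R>" for R
    unfolding X_def Y_def
    using cceD(2)[OF \<R>D(1)[OF that]] cceD(2)[OF orbit_rel_cce[OF that]]
    by (auto intro!: graph_quotient_image_graph[OF wf] simp: c[OF that] d[OF that])
  have wfX: "wf_graph (X R)" and wfY: "wf_graph (Y R)" if "R \<in> \<R>" for R
    using graph_quotient_wf[OF wf X[OF that]] graph_quotient_wf[OF wf Y[OF that]]
      cceD(2)[OF \<R>D(1)[OF that]] cceD(2)[OF orbit_rel_cce[OF that]] by (auto simp: c[OF that] d[OF that])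
  define \<alpha> where "\<alpha> R S = factor_map (elems \<Gamma>) (c S) (c R)" for R S
  define \<beta> where "\<beta> R S = factor_map (elems \<Gamma>) (d S) (d R)" for R S
  define q where "q R = factor_map (elems \<Gamma>) (c R) (d R)" for R
  define p where "p R = factor_map (elems \<Gamma>) f (d R)" for R
  have \<alpha>: "\<alpha> R S (c S x) = c R x" and \<beta>: "\<beta> R S (d S x) = d R x"
    if "R \<in> \<R>" "S \<in> \<R>" "S \<subseteq> R" "x \<in> elems \<Gamma>" for R S x
    unfolding \<alpha>_def \<beta>_def using that orbit_rel_mono[OF that(3)] by (simp_all add: factor_map_kernel c d)
  have q: "q R (c R x) = d R x" if "R \<in> \<R>" "x \<in> elems \<Gamma>" for R x
    unfolding q_def using that subset_orbit_rel[OF that(1)] by (simp add: factor_map_kernel c d)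
  have p: "p R (f x) = d R x" if "R \<in> \<R>" "x \<in> elems \<Gamma>" for R x
    unfolding p_def using that orbit_kernel_subset[OF that(1)] by (simp add: factor_map_kernel c d)
  have qmap: "graph_map (X R) (Y R) (q R)" if "R \<in> \<R>" for R
    by (rule graph_quotient_factor[OF wf X[OF that] graph_quotientD(1)[OF Y[OF that]] q[OF that]])
  have pq: "graph_quotient ?\<Delta> (Y R) (p R)" if "R \<in> \<R>" for R
    by (rule graph_quotient_comp_factor[OF wf graph_quotient_orbit Y[OF that] p[OF that]])
  have elems\<Delta>: "elems ?\<Delta> = f ` elems \<Gamma>" by (rule graph_quotientD(4)[OF graph_quotient_orbit])
  let ?TX = "\<lambda>R. discrete_topology (elems (X R))" and ?TY = "\<lambda>R. discrete_topology (elems (Y R))"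
  have sysX: "inverse_system \<R> ?leq X ?TX \<alpha>"
    by (rule inverse_system_of_quotients[OF wf \<R>_directed X wfX \<alpha>])
  have sysY: "inverse_system \<R> ?leq Y ?TY \<beta>"
    by (rule inverse_system_of_quotients[OF wf \<R>_directed Y wfY \<beta>])
  have sys: "inverse_system_of_maps \<R> ?leq X ?TX \<alpha> Y ?TY \<beta> q"
    unfolding inverse_system_of_maps_def
  proof (intro conjI ballI impI)
    fix R assume R: "R \<in> \<R>"
    show "graph_map (X R) (Y R) (q R)" by (rule qmap[OF R])
    show "continuous_map (?TX R) (?TY R) (q R)" using graph_mapD(3)[OF qmap[OF R]] by (simp add: Pi_iff)
    fix S n assume S: "S \<in> \<R>" "S \<subseteq> R" and n: "n \<in> elems (X S)"
    then obtain x where "x \<in> elems \<Gamma>" "n = c S x" using graph_quotientD(4)[OF X[OF S(1)]] by blast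
    then show "q R (\<alpha> R S n) = \<beta> R S (q S n)" using R S by (simp add: \<alpha> \<beta> q)
  qed (rule sysX sysY)+
  have cov: "\<forall>R\<in>\<R>. finite_regular_covering (X R) (Y R) (q R)"
    using finite_regular_covering_quotients X c Y d q by blast
  have a: "graph_homeomorphism \<Gamma> T (inverse_limit_graph \<R> ?leq X \<alpha>)
      (inverse_limit_topology \<R> ?leq X ?TX \<alpha>) (\<lambda>x. \<lambda>R\<in>\<R>. c R x)"
  proof (rule inverse_limit_homeomorphism[OF \<R>_directed X wfX _ \<alpha>])
    show "kernel_on (elems \<Gamma>) (c R) \<in> U" if "R \<in> \<R>" for R
      using that cceD(1)[OF \<R>D(1)[OF that]] by (simp add: c)
    fix x y assume xy: "x \<in> elems \<Gamma>" "y \<in> elems \<Gamma>" "\<And>R. R \<in> \<R> \<Longrightarrow> c R x = c R y"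
    have "(x, y) \<in> R" if "R \<in> \<R>" for R
      using xy that c[OF that] kernel_on_iff[of x y "elems \<Gamma>" "c R"] by simp
    then show "x = y" using \<R>_separates xy by blast
  qed
  have "graph_homeomorphism ?\<Delta> \<Delta>.T (inverse_limit_graph \<R> ?leq Y \<beta>)
      (inverse_limit_topology \<R> ?leq Y ?TY \<beta>) (\<lambda>x. \<lambda>R\<in>\<R>. p R x)"
  proof (rule \<Delta>.inverse_limit_homeomorphism[OF \<R>_directed pq wfY])
    \<comment> \<open>The kernel contains the image of \<open>orbit_rel R\<close>, which is a known
      entourage.\<close>
    show "kernel_on (elems ?\<Delta>) (p R) \<in> U'" if R: "R \<in> \<R>" for R
    proof (rule uniform_structureD(4)[OF \<Delta>.us U'(3)[OF R]])
      show "map_prod f f ` orbit_rel R \<subseteq> kernel_on (elems ?\<Delta>) (p R)"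
      proof clarify
        fix x y assume xy: "(x, y) \<in> orbit_rel R"
        then have xy': "x \<in> elems \<Gamma>" "y \<in> elems \<Gamma>" by (auto simp: orbit_rel_def)
        have "d R x = d R y" using xy d[OF R] kernel_on_iff[of x y "elems \<Gamma>" "d R"] by simp
        then show "(f x, f y) \<in> kernel_on (elems ?\<Delta>) (p R)"
          using xy' by (simp add: kernel_on_iff elems\<Delta> p[OF R])
      qed
    qed (auto simp: kernel_on_def)
    show "\<beta> R S (p S n) = p R n" if "R \<in> \<R>" "S \<in> \<R>" "S \<subseteq> R" "n \<in> elems ?\<Delta>" for R S n
      using that unfolding elems\<Delta> by (auto simp: p \<beta>)
    fix m n assume "m \<in> elems ?\<Delta>" "n \<in> elems ?\<Delta>" and mn: "\<And>R. R \<in> \<R> \<Longrightarrow> p R m = p R n"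
    then obtain x y where x: "x \<in> elems \<Gamma>" "m = f x" and y: "y \<in> elems \<Gamma>" "n = f y"
      unfolding elems\<Delta> by blast
    have "(x, y) \<in> orbit_rel R" if R: "R \<in> \<R>" for R
      using mn[OF R] x y p[OF R] d[OF R] kernel_on_iff[of x y "elems \<Gamma>" "d R"] by simp
    then show "m = n" unfolding x(2) y(2) by (rule orbit_rel_separates[OF x(1) y(1)])
  qed
  then have b: "graph_homeomorphism ?\<Delta> (quotient_topology T f) (inverse_limit_graph \<R> ?leq Y \<beta>)
      (inverse_limit_topology \<R> ?leq Y ?TY \<beta>) (\<lambda>x. \<lambda>R\<in>\<R>. p R x)" unfolding U'(2) .
  have "\<forall>x\<in>elems \<Gamma>. (\<lambda>R\<in>\<R>. p R (f x)) = inverse_limit_map \<R> q (\<lambda>R\<in>\<R>. c R x)"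
    unfolding inverse_limit_map_def by (intro ballI restrict_ext) (simp add: p q)
  then have lim: "is_inverse_limit_of_maps \<Gamma> T ?\<Delta> (quotient_topology T f) f \<R> ?leq X ?TX \<alpha> Y ?TY \<beta> q"
    unfolding is_inverse_limit_of_maps_def using a b by blast
  have "profinite_graph_space \<Gamma> T" "profinite_graph_space ?\<Delta> (quotient_topology T f)"
    using profinite U'(1,2) unfolding profinite_graph_space_def by blast+
  moreover have "continuous_map T (quotient_topology T f) f"
    by (rule quotient_imp_continuous_map[OF quotient_map_quotient_topology])
  ultimately show ?thesis
    unfolding regular_covering_def using graph_quotientD(1)[OF graph_quotient_orbit] sys cov lim by blast
qed

end

subsection \<open>Covering transformations\<close>

context residually_free_action
begin

abbreviation A :: "('a \<Rightarrow> 'a) monoid" where "A \<equiv> covering_transformations \<Gamma> T f"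

lemma covering_transformation_iff:
  "h \<in> carrier A \<longleftrightarrow> h \<in> Bij (elems \<Gamma>) \<and> graph_map \<Gamma> \<Gamma> h \<and> homeomorphic_map T T h \<and>
    (\<forall>x\<in>elems \<Gamma>. f (h x) = f x)"
  by (simp add: covering_transformations_def)

lemma act_covering_transformation:
  assumes g: "g \<in> carrier G"
  shows "\<phi> g \<in> carrier A"
proof -
  have "homeomorphic_maps T T (\<phi> g) (\<phi> (inv g))"
    using g continuous_act_right[of g] continuous_act_right[of "inv g"] by (simp add: homeomorphic_maps_def)
  then show ?thesis
    using bij_prop0[OF g] act_graph_map[OF g] f_act[OF g] homeomorphic_map_maps
    unfolding covering_transformation_iff by blast
qed

text \<open>Unique path lifting in the finite covering \<open>\<Gamma>/R \<rightarrow> \<Gamma>/(G R)\<close>: the maps \<open>h\<close> and \<open>\<phi> g\<close> induce on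
  \<open>\<Gamma>/S\<close> two lifts of the same map that agree at one vertex, and \<open>\<Gamma>/S\<close> is path connected.\<close>

lemma covering_transformation_mod_entourage:
  assumes R: "R \<in> \<R>" and h: "h \<in> carrier A" and g: "g \<in> carrier G"
    and v: "v \<in> verts \<Gamma>" "h v = \<phi> g v" and x: "x \<in> elems \<Gamma>"
  shows "(h x, \<phi> g x) \<in> R"
proof -
  have hm: "graph_map \<Gamma> \<Gamma> h" and hc: "continuous_map T T h" and hf: "\<And>x. x \<in> elems \<Gamma> \<Longrightarrow> f (h x) = f x"
    using h homeomorphic_imp_continuous_map unfolding covering_transformation_iff by blast+
  note hs = graph_mapD[OF hm] and R1 = \<R>D(1)[OF R]
  \<comment> \<open>The pullback of R along \<open>h\<close>. Its classes are preimages of classes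
    of R, hence open, and compactness turns it into an entourage.\<close>
  let ?E = "{(x, y). x \<in> elems \<Gamma> \<and> y \<in> elems \<Gamma> \<and> (h x, h y) \<in> R}"
  have "?E \<in> U"
  proof (rule equiv_entourage_of_open_classes)
    show "equiv (elems \<Gamma>) ?E"
    proof (intro equivI refl_onI symI transI)
      show "?E \<subseteq> elems \<Gamma> \<times> elems \<Gamma>" by blast
      show "(x, x) \<in> ?E" if "x \<in> elems \<Gamma>" for x using that cceD(6)[OF R1 hs(3)[OF that]] by simp
      show "(y, x) \<in> ?E" if "(x, y) \<in> ?E" for x y using that cceD(7)[OF R1] by simp
      show "(x, z) \<in> ?E" if "(x, y) \<in> ?E" "(y, z) \<in> ?E" for x y z
        using that cceD(8)[OF R1, of "h x" "h y" "h z"] by simp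
    qed
    fix x assume "x \<in> elems \<Gamma>"
    then have "?E `` {x} = {y \<in> topspace T. h y \<in> R `` {h x}}" by auto
    then show "openin T (?E `` {x})"
      using openin_continuous_map_preimage[OF hc openin_equiv_class[OF us cceD(1,3)[OF R1]]] by simp
  qed
  \<comment> \<open>S refines both R and the pullback, so \<open>h\<close> and
    \<open>\<phi> g\<close> both descend to maps from \<Gamma>/S to \<Gamma>/R.\<close>
  then obtain S where S: "compatible_cofinite_entourage \<Gamma> U S" "S \<subseteq> R \<inter> ?E"
    using refine uniform_structure_Int[OF us cceD(1)[OF R1]] by blast
  let ?Q = "quotient_graph \<Gamma> S"
  note q = graph_quotient_quotient_graph[OF wf cceD(2)[OF S(1)]]
  note qm = graph_mapD[OF graph_quotientD(1)[OF q]]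
  define P where "P u \<longleftrightarrow> (h u, \<phi> g u) \<in> R" for u
  have P_S: "P w" if "P u" "(u, w) \<in> S" for u w
  proof -
    have "(h u, h w) \<in> R" "(\<phi> g u, \<phi> g w) \<in> R" using that(2) S(2) \<R>D(3)[OF R g] by auto
    then show ?thesis using that(1) cceD(7,8)[OF R1] unfolding P_def by blast
  qed
  \<comment> \<open>\<open>h e\<close> lies in the orbit of \<open>e\<close>, so \<open>h\<close>
    moves this edge as some \<open>k\<close> does. At the source \<open>k\<close> and
    \<open>g\<close> agree modulo R, and freeness carries the agreement to the edge.\<close>
  have P_edge: "P e" if e: "e \<in> edges \<Gamma>" and s: "P (src \<Gamma> e)" for e
  proof -
    have ee: "e \<in> elems \<Gamma>" "src \<Gamma> e \<in> elems \<Gamma>" using e wf_graphD(1)[OF wf e] by auto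
    obtain k where k: "k \<in> carrier G" "\<phi> k e = h e"
      using orbit_eq_iff[OF ee(1) hs(3)[OF ee(1)]] hf[OF ee(1)] by auto
    have "(\<phi> k (src \<Gamma> e), \<phi> g (src \<Gamma> e)) \<in> R"
      using s hs(4)[OF e] act_simps(4)[OF k(1) e] k(2) unfolding P_def by simp
    from \<R>_free[OF R g k(1) ee(2) this ee(1)] show ?thesis unfolding P_def k(2) .
  qed
  have P_tgt: "P (tgt \<Gamma> e)" if e: "e \<in> edges \<Gamma>" and s: "P e" for e
    using compatibleD(5)[OF cceD(2)[OF R1] hs(2)[OF e] act_simps(2)[OF g e]] s
    unfolding P_def hs(5)[OF e] act_simps(5)[OF g e] .
  \<comment> \<open>A path in \<Gamma>/S need not lift to a path in \<Gamma>: consecutive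
    representatives meet only modulo S, and \<open>P_S\<close> bridges the gaps.\<close>
  have P_path: "P w" if "edge_path ?Q (S `` {u}) l (S `` {w})" "u \<in> verts \<Gamma>" "w \<in> verts \<Gamma>" "P u" for u l w
    using that
  proof (induction l arbitrary: u)
    case Nil
    then have "(u, w) \<in> S" using eq_equiv_class_iff[OF cceD(3)[OF S(1)], of u w] by simp
    then show ?case using P_S Nil.prems(4) by blast
  next
    case (Cons D l)
    then have D: "D \<in> edges ?Q" "src ?Q D = S `` {u}" "edge_path ?Q (tgt ?Q D) l (S `` {w})" by auto
    then obtain e where e: "e \<in> edges \<Gamma>" "D = S `` {e}" unfolding graph_quotientD(3)[OF q] by blast
    note we = wf_graphD(1,2)[OF wf e(1)]
    have "S `` {u} = S `` {src \<Gamma> e}" using D(2) qm(4)[OF e(1)] e(2) by simp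
    then have "(u, src \<Gamma> e) \<in> S"
      using eq_equiv_class_iff[OF cceD(3)[OF S(1)], of u "src \<Gamma> e"] Cons.prems(2) we by simp
    then have "P (tgt \<Gamma> e)" using P_S[OF Cons.prems(4)] P_edge[OF e(1)] P_tgt[OF e(1)] by blast
    moreover have "edge_path ?Q (S `` {tgt \<Gamma> e}) l (S `` {w})" using D(3) qm(5)[OF e(1)] e(2) by simp
    ultimately show ?case using Cons.IH we(2) Cons.prems(3) by blast
  qed
  have "P v" using v(2) cceD(6)[OF R1, of "\<phi> g v"] g v(1) by (simp add: P_def)
  moreover have "path_connected_graph ?Q" using connected S(1) by (simp add: connected_cofinite_graph_def)
  ultimately have P_verts: "P w" if "w \<in> verts \<Gamma>" for w
  proof -
    have "S `` {v} \<in> verts ?Q" "S `` {w} \<in> verts ?Q" using qm(1) v(1) that by blast+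
    then obtain l where "edge_path ?Q (S `` {v}) l (S `` {w})"
      using \<open>path_connected_graph ?Q\<close> unfolding path_connected_graph_def by blast
    then show ?thesis using P_path v(1) that \<open>P v\<close> by blast
  qed
  have "P x"
  proof (cases "x \<in> verts \<Gamma>")
    case False
    then have "x \<in> edges \<Gamma>" using x by (simp add: elems_def)
    then show ?thesis using P_edge P_verts wf_graphD(1)[OF wf] by blast
  qed (rule P_verts)
  then show ?thesis by (simp add: P_def)
qed

lemma verts_nonempty: "verts \<Gamma> \<noteq> {}"
proof -
  obtain R where R: "compatible_cofinite_entourage \<Gamma> U R"
    using refine uniform_structureD(1)[OF us] by blast
  then have "elems (quotient_graph \<Gamma> R) \<noteq> {}"
    using connected unfolding connected_cofinite_graph_def path_connected_graph_def by blast
  then have "elems \<Gamma> \<noteq> {}"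
    using graph_quotientD(4)[OF graph_quotient_quotient_graph[OF wf cceD(2)[OF R]]] by simp
  then show ?thesis using wf_graphD(1)[OF wf] by (auto simp: elems_def)
qed

lemma carrier_covering_transformations: "carrier A = \<phi> ` carrier G"
proof
  show "\<phi> ` carrier G \<subseteq> carrier A" using act_covering_transformation by blast
  show "carrier A \<subseteq> \<phi> ` carrier G"
  proof
    fix h assume h: "h \<in> carrier A"
    then have hB: "h \<in> Bij (elems \<Gamma>)" and hm: "graph_map \<Gamma> \<Gamma> h" by (auto simp: covering_transformation_iff)
    obtain v where v: "v \<in> verts \<Gamma>" using verts_nonempty by blast
    have "f (h v) = f v" using h v by (simp add: covering_transformation_iff)
    then obtain g where g: "g \<in> carrier G" "\<phi> g v = h v"
      using orbit_eq_iff[of v "h v"] v graph_mapD(3)[OF hm, of v] by auto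
    have "h x = \<phi> g x" if x: "x \<in> elems \<Gamma>" for x
      using \<R>_separates[OF graph_mapD(3)[OF hm x] act_closed[OF g(1) x]]
        covering_transformation_mod_entourage[OF _ h g(1) v g(2)[symmetric] x] by blast
    \<comment> \<open>Members of \<open>Bij\<close> are extensional, so agreement on the elements is
      equality of functions.\<close>
    then have "h = \<phi> g"
      by (rule extensionalityI[OF Bij_imp_extensional[OF hB] Bij_imp_extensional[OF bij_prop0[OF g(1)]]])
    then show "h \<in> \<phi> ` carrier G" using g(1) by blast
  qed
qed

text \<open>Once the carrier is known to be the image of \<open>\<phi>\<close>, it is a subgroup of
  \<open>BijGroup\<close> as the image of a homomorphism.\<close>

lemma group_covering_transformations: "group A"
proof -
  have "subgroup (\<phi> ` carrier G) (BijGroup (elems \<Gamma>))"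
    by (rule group_hom.img_is_subgroup[OF group_hom])
  then have "group ((BijGroup (elems \<Gamma>))\<lparr>carrier := \<phi> ` carrier G\<rparr>)"
    by (rule subgroup.subgroup_is_group[OF _ group_BijGroup])
  moreover have "(BijGroup (elems \<Gamma>))\<lparr>carrier := \<phi> ` carrier G\<rparr> = A"
    unfolding carrier_covering_transformations[symmetric] by (simp add: covering_transformations_def)
  ultimately show ?thesis by simp
qed

lemma mult_covering_transformations:
  assumes "g \<in> carrier G" "h \<in> carrier G"
  shows "\<phi> g \<otimes>\<^bsub>A\<^esub> \<phi> h = \<phi> (g \<otimes> h)"
  using group_hom.hom_mult[OF group_hom assms] by (simp add: covering_transformations_def)

lemma invariant_relation_covering_transformations:
  "invariant_relation A (\<lambda>\<alpha>. \<alpha>) R \<longleftrightarrow> invariant_relation G \<phi> R"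
  by (simp add: invariant_relation_def carrier_covering_transformations)

section \<open>The topology on the group of covering transformations\<close>

abbreviation TA :: "('a \<Rightarrow> 'a) topology" where "TA \<equiv> action_topology A \<Gamma> U"

text \<open>Invariance of R turns the left coset of the displacement subgroup at
  \<open>\<phi> g\<close> into the set of those \<open>\<phi> k\<close> that agree with
  \<open>\<phi> g\<close> modulo R, by passing between \<open>k\<close> and
  \<open>inv g \<otimes> k\<close>. Neighbourhoods can then be handled by elements of G
  alone.\<close>

lemma openin_TA:
  "openin TA W \<longleftrightarrow> W \<subseteq> \<phi> ` carrier G \<and>
     (\<forall>g\<in>carrier G. \<phi> g \<in> W \<longrightarrow> (\<exists>R. compatible_cofinite_entourage \<Gamma> U R \<and> invariant_relation G \<phi> R \<and>
        (\<forall>k\<in>carrier G. (\<forall>x\<in>elems \<Gamma>. (\<phi> k x, \<phi> g x) \<in> R) \<longrightarrow> \<phi> k \<in> W)))"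
proof -
  have coset: "\<phi> g <#\<^bsub>A\<^esub> displacement_subgroup A \<Gamma> R =
      {\<phi> k | k. k \<in> carrier G \<and> (\<forall>x\<in>elems \<Gamma>. (\<phi> k x, \<phi> g x) \<in> R)}" (is "?L = ?N")
    if i: "invariant_relation G \<phi> R" and g: "g \<in> carrier G" for g R
  proof
    show "?L \<subseteq> ?N"
    proof
      fix \<gamma> assume "\<gamma> \<in> ?L"
      then obtain k where k: "k \<in> carrier G" "\<forall>x\<in>elems \<Gamma>. (\<phi> k x, x) \<in> R" "\<gamma> = \<phi> g \<otimes>\<^bsub>A\<^esub> \<phi> k"
        by (auto simp: l_coset_def displacement_subgroup_def carrier_covering_transformations)
      have "(\<phi> (g \<otimes> k) x, \<phi> g x) \<in> R" if "x \<in> elems \<Gamma>" for x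
        using invariant_relationD[OF i g, of "\<phi> k x" x] k that g by (simp add: act_mult)
      then show "\<gamma> \<in> ?N" using k(1,3) g mult_covering_transformations[OF g k(1)] by blast
    qed
    show "?N \<subseteq> ?L"
    proof
      fix \<gamma> assume "\<gamma> \<in> ?N"
      then obtain k where k: "k \<in> carrier G" "\<forall>x\<in>elems \<Gamma>. (\<phi> k x, \<phi> g x) \<in> R" "\<gamma> = \<phi> k" by blast
      let ?h = "inv g \<otimes> k"
      have h: "?h \<in> carrier G" using g k(1) by simp
      have "(\<phi> ?h x, x) \<in> R" if "x \<in> elems \<Gamma>" for x
        using invariant_relationD[OF i inv_closed[OF g], of "\<phi> k x" "\<phi> g x"] k that g by (simp add: act_mult)
      then have "\<phi> ?h \<in> displacement_subgroup A \<Gamma> R"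
        using act_covering_transformation[OF h] by (simp add: displacement_subgroup_def)
      moreover have "\<gamma> = \<phi> g \<otimes>\<^bsub>A\<^esub> \<phi> ?h"
        using mult_covering_transformations[OF g h] g k(1,3) m_assoc[of g "inv g" k, symmetric] by simp
      ultimately show "\<gamma> \<in> ?L" unfolding l_coset_def by blast
    qed
  qed
  have sub: "carrier A \<subseteq> Bij (elems \<Gamma>)" using covering_transformation_iff by blast
  have "(\<exists>R. compatible_cofinite_entourage \<Gamma> U R \<and> invariant_relation A (\<lambda>\<alpha>. \<alpha>) R \<and>
        \<phi> g <#\<^bsub>A\<^esub> displacement_subgroup A \<Gamma> R \<subseteq> W) \<longleftrightarrow>
      (\<exists>R. compatible_cofinite_entourage \<Gamma> U R \<and> invariant_relation G \<phi> R \<and>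
        (\<forall>k\<in>carrier G. (\<forall>x\<in>elems \<Gamma>. (\<phi> k x, \<phi> g x) \<in> R) \<longrightarrow> \<phi> k \<in> W))" if g: "g \<in> carrier G" for g
    unfolding invariant_relation_covering_transformations
  proof (rule ex_cong1, intro conj_cong refl)
    fix R assume "invariant_relation G \<phi> R"
    show "\<phi> g <#\<^bsub>A\<^esub> displacement_subgroup A \<Gamma> R \<subseteq> W \<longleftrightarrow>
        (\<forall>k\<in>carrier G. (\<forall>x\<in>elems \<Gamma>. (\<phi> k x, \<phi> g x) \<in> R) \<longrightarrow> \<phi> k \<in> W)"
      unfolding coset[OF \<open>invariant_relation G \<phi> R\<close> g] by blast
  qed
  then show ?thesis
    unfolding openin_action_topology[OF us sub] unfolding carrier_covering_transformations by blast
qed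

lemma topspace_TA: "topspace TA = \<phi> ` carrier G"
proof -
  obtain R where "R \<in> \<R>" using \<R>_nonempty by blast
  then have "openin TA (\<phi> ` carrier G)"
    unfolding openin_TA using \<R>D(1,2) by blast
  moreover have "topspace TA \<subseteq> \<phi> ` carrier G" using openin_topspace[of TA] unfolding openin_TA by blast
  ultimately show ?thesis using openin_subset by blast
qed

text \<open>By invariance, agreement modulo R at all points follows from agreement at one
  representative of each class. There are finitely many classes, so the set is a finite intersection
  of preimages of open classes.\<close>

lemma openin_agree:
  assumes R: "compatible_cofinite_entourage \<Gamma> U R" "invariant_relation G \<phi> R" and g: "g \<in> carrier G"
  shows "openin TG {k \<in> carrier G. \<forall>x\<in>elems \<Gamma>. (\<phi> k x, \<phi> g x) \<in> R}"
proof -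
  define rep where "rep C = (SOME x :: 'a. x \<in> C)" for C
  have rep: "(x, rep (R `` {x})) \<in> R" if "x \<in> elems \<Gamma>" for x
    using someI[of "\<lambda>y. y \<in> R `` {x}" x] cceD(6)[OF R(1) that] by (simp add: rep_def)
  have repE: "rep C \<in> elems \<Gamma>" if "C \<in> elems \<Gamma> // R" for C
    using that rep cceD(5)[OF R(1)] by (auto elim!: quotientE)
  have "{k \<in> carrier G. \<forall>x\<in>elems \<Gamma>. (\<phi> k x, \<phi> g x) \<in> R} =
      (\<Inter>C\<in>elems \<Gamma> // R. {k \<in> topspace TG. \<phi> k (rep C) \<in> R `` {\<phi> g (rep C)}}) \<inter> topspace TG"
    (is "?N = ?M")
  proof
    show "?N \<subseteq> ?M" using repE cceD(7)[OF R(1)] by auto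
    show "?M \<subseteq> ?N"
    proof
      fix k assume k: "k \<in> ?M"
      then have kG: "k \<in> carrier G" by simp
      have "(\<phi> k x, \<phi> g x) \<in> R" if x: "x \<in> elems \<Gamma>" for x
      proof -
        let ?r = "rep (R `` {x})"
        have "(\<phi> g ?r, \<phi> k ?r) \<in> R" using k quotientI[OF x, of R] by blast
        moreover have "(\<phi> k x, \<phi> k ?r) \<in> R" "(\<phi> g x, \<phi> g ?r) \<in> R"
          using invariant_relationD[OF R(2) _ rep[OF x]] kG g by auto
        ultimately show ?thesis using cceD(7,8)[OF R(1)] by blast
      qed
      then show "k \<in> ?N" using kG by blast
    qed
  qed
  moreover have "openin TG ?M"
    using openin_continuous_map_preimage[OF continuous_act_left[OF repE]
        openin_equiv_class[OF us cceD(1,3)[OF R(1)]]]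
    by (intro openin_INT cceD(4)[OF R(1)]) blast
  ultimately show ?thesis by simp
qed

lemma continuous_TG_TA: "continuous_map TG TA \<phi>"
  unfolding continuous_map topspace_TA
proof (intro conjI allI impI)
  fix W assume W: "openin TA W"
  show "openin TG {g \<in> topspace TG. \<phi> g \<in> W}"
    unfolding openin_subopen[of TG "{g \<in> topspace TG. \<phi> g \<in> W}"]
  proof
    fix g assume "g \<in> {g \<in> topspace TG. \<phi> g \<in> W}"
    then have g: "g \<in> carrier G" "\<phi> g \<in> W" by auto
    then obtain R where R: "compatible_cofinite_entourage \<Gamma> U R" "invariant_relation G \<phi> R"
      "\<forall>k\<in>carrier G. (\<forall>x\<in>elems \<Gamma>. (\<phi> k x, \<phi> g x) \<in> R) \<longrightarrow> \<phi> k \<in> W"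
      using W unfolding openin_TA by blast
    let ?N = "{k \<in> carrier G. \<forall>x\<in>elems \<Gamma>. (\<phi> k x, \<phi> g x) \<in> R}"
    have "g \<in> ?N" "?N \<subseteq> {g \<in> topspace TG. \<phi> g \<in> W}" using g R(3) cceD(6)[OF R(1)] by auto
    then show "\<exists>N. openin TG N \<and> g \<in> N \<and> N \<subseteq> {g \<in> topspace TG. \<phi> g \<in> W}"
      using openin_agree[OF R(1,2) g(1)] by blast
  qed
qed simp

text \<open>If \<open>\<phi> g\<close> and \<open>\<phi> k\<close> differ at \<open>x\<close>, some
  R in \<open>\<R>\<close> separates their values there. The transformations that agree modulo R
  with one or with the other form two sets, open because agreement modulo R is transitive, and
  disjoint because of \<open>x\<close>.\<close>

lemma Hausdorff_TA: "Hausdorff_space TA"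
  unfolding Hausdorff_space_def
proof (intro allI impI)
  fix \<alpha> \<beta> assume ab: "\<alpha> \<in> topspace TA \<and> \<beta> \<in> topspace TA \<and> \<alpha> \<noteq> \<beta>"
  then obtain g k where g: "g \<in> carrier G" "\<alpha> = \<phi> g" and k: "k \<in> carrier G" "\<beta> = \<phi> k"
    unfolding topspace_TA by blast
  have "\<exists>x\<in>elems \<Gamma>. \<phi> g x \<noteq> \<phi> k x"
    using ab g k extensionalityI[OF Bij_imp_extensional[OF bij_prop0[OF g(1)]]
        Bij_imp_extensional[OF bij_prop0[OF k(1)]]] by blast
  then obtain x where x: "x \<in> elems \<Gamma>" "\<phi> g x \<noteq> \<phi> k x" by blast
  then obtain R where R: "R \<in> \<R>" "(\<phi> g x, \<phi> k x) \<notin> R"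
    using \<R>_separates[OF act_closed[OF g(1) x(1)] act_closed[OF k(1) x(1)]] by blast
  let ?N = "\<lambda>g. {\<phi> k | k. k \<in> carrier G \<and> (\<forall>x\<in>elems \<Gamma>. (\<phi> k x, \<phi> g x) \<in> R)}"
  have op: "openin TA (?N g)" for g
    unfolding openin_TA
  proof (intro conjI ballI impI)
    fix k assume "k \<in> carrier G" "\<phi> k \<in> ?N g"
    then have k: "\<forall>x\<in>elems \<Gamma>. (\<phi> k x, \<phi> g x) \<in> R" by auto
    have "\<phi> l \<in> ?N g" if "l \<in> carrier G" "\<forall>x\<in>elems \<Gamma>. (\<phi> l x, \<phi> k x) \<in> R" for l
      using that k cceD(8)[OF \<R>D(1)[OF R(1)]] by blast
    then show "\<exists>R. compatible_cofinite_entourage \<Gamma> U R \<and> invariant_relation G \<phi> R \<and>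
        (\<forall>l\<in>carrier G. (\<forall>x\<in>elems \<Gamma>. (\<phi> l x, \<phi> k x) \<in> R) \<longrightarrow> \<phi> l \<in> ?N g)"
      using \<R>D(1,2)[OF R(1)] by blast
  qed auto
  have self: "\<phi> g \<in> ?N g" if "g \<in> carrier G" for g
    using that cceD(6)[OF \<R>D(1)[OF R(1)]] by auto
  have "disjnt (?N g) (?N k)"
    unfolding disjnt_iff
  proof (intro allI notI, elim conjE)
    fix \<gamma> assume "\<gamma> \<in> ?N g" "\<gamma> \<in> ?N k"
    then have "(\<gamma> x, \<phi> g x) \<in> R" "(\<gamma> x, \<phi> k x) \<in> R" using x(1) by auto
    then show False using R(2) cceD(7,8)[OF \<R>D(1)[OF R(1)]] by blast
  qed
  then show "\<exists>V W. openin TA V \<and> openin TA W \<and> \<alpha> \<in> V \<and> \<beta> \<in> W \<and> disjnt V W"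
    unfolding g(2) k(2) using op[of g] op[of k] self[OF g(1)] self[OF k(1)] by (intro exI conjI)
qed

lemma profinite_group_iso_covering_transformations:
  assumes inj: "inj_on \<phi> (carrier G)"
  shows "profinite_group_iso G TG A TA \<phi>"
proof -
  have iso: "\<phi> \<in> iso G A"
    using inj mult_covering_transformations
    by (auto simp: iso_def hom_def bij_betw_def carrier_covering_transformations)
  have hom: "homeomorphic_map TG TA \<phi>"
    by (rule continuous_imp_homeomorphic_map[OF continuous_TG_TA compact_TG Hausdorff_TA])
      (simp_all add: topspace_TA inj)
  show ?thesis
    unfolding profinite_group_iso_def
    using profinite_group profinite_group_transfer[OF profinite_group group_covering_transformations iso hom]
      iso hom by simp
qed

end

text \<open>Residual freeness makes each quotient of G by a \<open>class_kernel\<close> act freely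
  but leaves open the intersection of these kernels, which is the kernel of \<open>\<phi>\<close>: a
  trivial action is residually free. The identification of G with the covering transformations is
  therefore surjectivity of \<open>\<phi>\<close> in general, and an isomorphism of profinite groups
  when the action is faithful.\<close>

theorem theorem19:
  fixes G :: "('g, 'm) monoid_scheme" and TG :: "'g topology"
    and \<Gamma> :: "'a graph" and U :: "('a \<times> 'a) set set"
    and \<phi> :: "'g \<Rightarrow> 'a \<Rightarrow> 'a"
  assumes "profinite_group G TG"
    and "profinite_graph \<Gamma> U"
    and "connected_cofinite_graph \<Gamma> U"
    and "graph_action G \<Gamma> \<phi>"
    and "continuous_action TG (uniform_topology (elems \<Gamma>) U) \<phi>"
    and "residually_free G \<Gamma> U \<phi>"
    and "without_edge_inversions G \<Gamma> \<phi>"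
  shows "let T = uniform_topology (elems \<Gamma>) U;
             f = orbit G \<phi>;
             A = covering_transformations \<Gamma> T f
         in profinite_graph_space (orbit_graph G \<Gamma> \<phi>) (quotient_topology T f) \<and>
            regular_covering \<Gamma> T (orbit_graph G \<Gamma> \<phi>) (quotient_topology T f) f \<and>
            \<phi> ` carrier G = carrier A \<and>
            (faithful_action G (elems \<Gamma>) \<phi> \<longrightarrow>
               profinite_group_iso G TG A (action_topology A \<Gamma> U) \<phi>)"
proof -
  interpret residually_free_action \<Gamma> U G TG \<phi>
    by (intro residually_free_action.intro profinite.intro residually_free_action_axioms.intro assms)
  have "profinite_graph_space (orbit_graph G \<Gamma> \<phi>) (quotient_topology T f)"
    using regular_covering_orbit_map unfolding regular_covering_def by blast
  moreover have "profinite_group_iso G TG A TA \<phi>" if "faithful_action G (elems \<Gamma>) \<phi>"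
    by (rule profinite_group_iso_covering_transformations[OF faithful_action.faithful[OF that]])
  ultimately show ?thesis
    unfolding Let_def using regular_covering_orbit_map carrier_covering_transformations by simp
qed

end
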